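(* Let $C$ be a finitely generated simple unital associative conformal algebra over $\mathbb{C}$. If $C$ has growth $1$ (i.e. $\operatorname{GKdim} C=1$), then there is an integer $N\ge 1$ such that $C$ is isomorphic, as a conformal algebra, to the conformal Weyl algebra $\mathrm{CEnd}_N$.
   Context: Everything is over $\mathbb{C}$. Conformal algebra: a $\mathbb{C}[\partial]$-module $C$ with $\mathbb{C}$-bilinear products $\circ_n$, $n\in\mathbb{Z}_{\ge 0}$, such that for all $a,b\in C$: (C1, locality) $a\circ_n b=0$ for all sufficiently large $n$; (C2) $\partial(a\circ_n b)=(\partial a)\circ_n b+a\circ_n(\partial b)$; (C3) $(\partial a)\circ_n b=-n\,a\circ_{n-1}b$ (so $(\partial a)\circ_0 b=0$). Subalgebras are $\mathbb{C}[\partial]$-submodules closed under all $\circ_n$; $C$ is finitely generated if it is generated by a finite set under $\partial$ and all the products. Isomorphisms are $\mathbb{C}[\partial]$-linear bijections preserving all $\circ_n$. Coefficient algebra: on $\tilde C=C[t,t^{-1}]=C\otimes\mathbb{C}[t,t^{-1}]$ put $(at^l)\circ_0(bt^m)=\sum_{j\ge 0}\binom{l}{j}(a\circ_j b)\,t^{l+m-j}$. Then $\operatorname{Coeff}C=(\tilde C,\circ_0)/(\partial+\frac{d}{dt})\tilde C$. The conformal algebra $C$ is called associative if $\operatorname{Coeff}C$ is an associative algebra; equivalently, $f\circ_m(g\circ_n h)=\sum_{j\ge 0}\binom{m}{j}(f\circ_j g)\circ_{m+n-j}h$ for all $f,g,h\in C$ and $m,n\ge 0$. Unital: there is $e\in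 C$ (a conformal identity) such that $e\circ_0 f=f$ for all $f\in C$ and the locality degree of $e$ with itself is $1$, i.e. $e\circ_n e=0$ for all $n\ge 1$ while $e\circ_0 e\ne 0$. Simple: $C$ has no ideals other than $0$ and $C$, where an ideal is a conformal subalgebra closed under left and right multiplications of every order by elements of $C$. Gelfand–Kirillov dimension: if $C$ is generated by $f_1,\dots,f_k$, let $C_r$ be the $\mathbb{C}[\partial]$-span of all products of at most $r$ generators (any bracketing, any orders of multiplication). Then $\operatorname{GKdim}C=\limsup_{r\to\infty}\frac{\log \operatorname{rk}_{\mathbb{C}[\partial]}C_r}{\log r}$; this does not depend on the choice of generators. Conformal Weyl algebra $\mathrm{CEnd}_N$ (the algebra of all conformal endomorphisms of a free $\mathbb{C}[\partial]$-module of rank $N$): let $W_t$ be the Weyl algebra localized at $t$, i.e. the algebra generated by $x,t,t^{-1}$ with $tt^{-1}=t^{-1}t=1$ and $xt-tx=1$ (so $x=\partial_t$). For $a\in \mathrm{Mat}_N(\mathbb{C}[x])$ let $f_a=\sum_{n\in\mathbb{Z}}at^nz^{-n-1}\in \mathrm{Mat}_N(W_t)[[z,z^{-1}]]$. The conformal Weyl algebra is the $\mathbb{C}[\partial]$-span of all $f_a$, with $\partial=d/dz$ and products $(u\circ_n v)(k)=\sum_{j\ge 0}(-1)^j\binom{n}{j}u(n-j)v(k+j)$ for formal distributions $u=\sum u(k)z^{-k-1}$, $v=\sum v(k)z^{-k-1}$; explicitly $f_a\circ_m f_b=(-1)^m f_{a\,\delta^m(b)}$ with $\delta=d/dx$.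 *)

theory Defs
  imports
    "HOL-Analysis.Analysis"
    "HOL-Computational_Algebra.Polynomial"
    "HOL-Library.Function_Algebras"
    "HOL-Library.Poly_Mapping"
begin

section \<open>Conformal algebras\<close>

text \<open>The scalars of the underlying module are the complex polynomials in \<open>\<partial>\<close>: the operator \<open>\<partial>\<close>
  itself is multiplication by \<open>[:0, 1:]\<close>, and a complex number \<open>c\<close> acts as \<open>[:c:]\<close>.\<close>

locale conformal_algebra = module scale
  for scale :: "complex poly \<Rightarrow> 'a::ab_group_add \<Rightarrow> 'a"  (infixr \<open>*s\<close> 75) +
  fixes cprod :: "nat \<Rightarrow> 'a \<Rightarrow> 'a \<Rightarrow> 'a"
  assumes cprod_add_left: "cprod n (a + b) c = cprod n a c + cprod n b c"
    and cprod_add_right: "cprod n a (b + c) = cprod n a b + cprod n a c"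
    and cprod_scale_left: "cprod n ([:z:] *s a) b = [:z:] *s cprod n a b"
    and cprod_scale_right: "cprod n a ([:z:] *s b) = [:z:] *s cprod n a b"
    and locality: "\<exists>n0. \<forall>n\<ge>n0. cprod n a b = 0"
    and der_cprod: "[:0, 1:] *s cprod n a b = cprod n ([:0, 1:] *s a) b + cprod n a ([:0, 1:] *s b)"
    and cprod_der_zero: "cprod 0 ([:0, 1:] *s a) b = 0"
    and cprod_der_Suc: "cprod (Suc n) ([:0, 1:] *s a) b = [:- of_nat (Suc n):] *s cprod n a b"
begin

definition der :: "'a \<Rightarrow> 'a"
  where "der a = [:0, 1:] *s a"

definition subalgebra :: "'a set \<Rightarrow> bool"
  where "subalgebra S \<longleftrightarrow> subspace S \<and> (\<forall>n. \<forall>a\<in>S. \<forall>b\<in>S. cprod n a b \<in> S)"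

definition generates :: "'a set \<Rightarrow> bool"
  where "generates F \<longleftrightarrow> subalgebra hull F = UNIV"

definition ideal :: "'a set \<Rightarrow> bool"
  where "ideal I \<longleftrightarrow> subalgebra I \<and> (\<forall>n a. \<forall>b\<in>I. cprod n a b \<in> I \<and> cprod n b a \<in> I)"

text \<open>The zero algebra is not excluded here; it is not unital.\<close>

definition simple :: bool
  where "simple \<longleftrightarrow> (\<forall>I. ideal I \<longrightarrow> I = {0} \<or> I = UNIV)"

definition conformal_identity :: "'a \<Rightarrow> bool"
  where "conformal_identity e \<longleftrightarrow>
    (\<forall>f. cprod 0 e f = f) \<and> cprod 0 e e \<noteq> 0 \<and> (\<forall>n\<ge>1. cprod n e e = 0)"

definition unital :: bool
  where "unital \<longleftrightarrow> (\<exists>e. conformal_identity e)"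

subsection \<open>The coefficient algebra and associativity\<close>

text \<open>Elements of \<open>C[t, t\<^sup>-\<^sup>1]\<close> are finitely supported maps \<open>int \<Rightarrow>\<^sub>0 'a\<close>, the monomial \<open>a t\<^sup>l\<close> being
  \<open>Poly_Mapping.single l a\<close>. In \<open>affine_prod\<close> the inner index set is finite by locality.\<close>

definition affine_prod :: "(int \<Rightarrow>\<^sub>0 'a) \<Rightarrow> (int \<Rightarrow>\<^sub>0 'a) \<Rightarrow> (int \<Rightarrow>\<^sub>0 'a)"
  where "affine_prod u v =
    (\<Sum>l\<in>Poly_Mapping.keys u. \<Sum>m\<in>Poly_Mapping.keys v.
      \<Sum>j | cprod j (Poly_Mapping.lookup u l) (Poly_Mapping.lookup v m) \<noteq> 0.
        Poly_Mapping.single (l + m - int j)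
          ([:(of_int l :: complex) gchoose j:]
             *s cprod j (Poly_Mapping.lookup u l) (Poly_Mapping.lookup v m)))"

definition affine_der :: "(int \<Rightarrow>\<^sub>0 'a) \<Rightarrow> (int \<Rightarrow>\<^sub>0 'a)"  \<comment> \<open>\<open>\<partial> + d/dt\<close>\<close>
  where "affine_der u =
    (\<Sum>l\<in>Poly_Mapping.keys u.
      Poly_Mapping.single l (der (Poly_Mapping.lookup u l)) +
      Poly_Mapping.single (l - 1) ([:of_int l:] *s Poly_Mapping.lookup u l))"

definition coeff_rel :: "((int \<Rightarrow>\<^sub>0 'a) \<times> (int \<Rightarrow>\<^sub>0 'a)) set"
  where "coeff_rel = {(u, v). u - v \<in> range affine_der}"

definition Coeff :: "(int \<Rightarrow>\<^sub>0 'a) set set"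
  where "Coeff = UNIV // coeff_rel"

definition coeff_mult :: "(int \<Rightarrow>\<^sub>0 'a) set \<Rightarrow> (int \<Rightarrow>\<^sub>0 'a) set \<Rightarrow> (int \<Rightarrow>\<^sub>0 'a) set"
  where "coeff_mult X Y = (\<Union>u\<in>X. \<Union>v\<in>Y. coeff_rel `` {affine_prod u v})"

definition associative :: bool
  where "associative \<longleftrightarrow>
    (\<forall>X\<in>Coeff. \<forall>Y\<in>Coeff. \<forall>Z\<in>Coeff.
      coeff_mult (coeff_mult X Y) Z = coeff_mult X (coeff_mult Y Z))"

subsection \<open>Gelfand--Kirillov dimension\<close>

text \<open>\<open>is_product F r a\<close>: \<open>a\<close> is a product of exactly \<open>r\<close> elements of \<open>F\<close>.\<close>

inductive is_product :: "'a set \<Rightarrow> nat \<Rightarrow> 'a \<Rightarrow> bool" for F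
  where
    generator: "f \<in> F \<Longrightarrow> is_product F 1 f"
  | product: "is_product F r a \<Longrightarrow> is_product F s b \<Longrightarrow> is_product F (r + s) (cprod n a b)"

definition filtration :: "'a set \<Rightarrow> nat \<Rightarrow> 'a set"
  where "filtration F r = span {a. \<exists>k\<le>r. is_product F k a}"

text \<open>The rank is the maximal size of a linearly independent subset. It is only applied to the
  finitely generated modules \<open>filtration F r\<close> with \<open>F\<close> finite, where the supremum is over a bounded
  set of natural numbers.\<close>

definition rank :: "'a set \<Rightarrow> nat"
  where "rank S = Sup {card B | B. finite B \<and> B \<subseteq> S \<and> independent B}"

text \<open>The dimension, computed with respect to a finite generating set \<open>F\<close>.\<close>

definition GKdim_wrt :: "'a set \<Rightarrow> ereal"
  where "GKdim_wrt F = limsup (\<lambda>r. ereal (ln (real (rank (filtration F r))) / ln (real r)))"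

end

text \<open>\<open>C[\<partial>]\<close>-linear bijections preserving all products, from the algebra \<open>(s1, p1)\<close> onto the
  submodule \<open>B\<close> of \<open>(s2, p2)\<close>.\<close>

definition conformal_isomorphism ::
    "(complex poly \<Rightarrow> 'a::ab_group_add \<Rightarrow> 'a) \<Rightarrow> (nat \<Rightarrow> 'a \<Rightarrow> 'a \<Rightarrow> 'a) \<Rightarrow>
     (complex poly \<Rightarrow> 'b::ab_group_add \<Rightarrow> 'b) \<Rightarrow> (nat \<Rightarrow> 'b \<Rightarrow> 'b \<Rightarrow> 'b) \<Rightarrow>
     'b set \<Rightarrow> ('a \<Rightarrow> 'b) \<Rightarrow> bool"
  where "conformal_isomorphism s1 p1 s2 p2 B \<phi> \<longleftrightarrow>
    module_hom s1 s2 \<phi> \<and> bij_betw \<phi> UNIV B \<and> (\<forall>n a b. \<phi> (p1 n a b) = p2 n (\<phi> a) (\<phi> b))"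

section \<open>The localized Weyl algebra\<close>

text \<open>The free associative algebra on three letters is the monoid algebra of the words in them.\<close>

datatype weyl_letter = Lx | Lt | Ltinv

datatype weyl_word = Word "weyl_letter list"

instantiation weyl_word :: monoid_add
begin

definition zero_weyl_word :: weyl_word
  where "0 = Word []"

fun plus_weyl_word :: "weyl_word \<Rightarrow> weyl_word \<Rightarrow> weyl_word"
  where "Word u + Word v = Word (u @ v)"

instance
proof
  fix a b c :: weyl_word
  show "a + b + c = a + (b + c)" by (cases a; cases b; cases c) simp
  show "0 + a = a" by (cases a) (simp add: zero_weyl_word_def)
  show "a + 0 = a" by (cases a) (simp add: zero_weyl_word_def)
qed

end

type_synonym weyl_free = "weyl_word \<Rightarrow>\<^sub>0 complex"

definition letter :: "weyl_letter \<Rightarrow> weyl_free"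
  where "letter g = Poly_Mapping.single (Word [g]) 1"

definition weyl_relators :: "weyl_free set"
  where "weyl_relators =
    {letter Lt * letter Ltinv - 1,
     letter Ltinv * letter Lt - 1,
     letter Lx * letter Lt - letter Lt * letter Lx - 1}"

text \<open>The two-sided ideal generated by the relators. Closure under multiplication by constants
  is a special case of closure under multiplication.\<close>

inductive_set weyl_ideal :: "weyl_free set"
  where
    relator: "r \<in> weyl_relators \<Longrightarrow> r \<in> weyl_ideal"
  | zero: "0 \<in> weyl_ideal"
  | add: "p \<in> weyl_ideal \<Longrightarrow> q \<in> weyl_ideal \<Longrightarrow> p + q \<in> weyl_ideal"
  | mult_left: "p \<in> weyl_ideal \<Longrightarrow> q * p \<in> weyl_ideal"
  | mult_right: "p \<in> weyl_ideal \<Longrightarrow> p * q \<in> weyl_ideal"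

lemma weyl_ideal_uminus: "p \<in> weyl_ideal \<Longrightarrow> - p \<in> weyl_ideal"
  using weyl_ideal.mult_left[of p "- 1"] by simp

definition weyl_rel :: "weyl_free \<Rightarrow> weyl_free \<Rightarrow> bool"
  where "weyl_rel p q \<longleftrightarrow> p - q \<in> weyl_ideal"

lemma equivp_weyl_rel: "equivp weyl_rel"
proof (rule equivpI)
  show "reflp weyl_rel"
    by (auto simp: reflp_def weyl_rel_def intro: weyl_ideal.zero)
  show "symp weyl_rel"
    unfolding symp_def weyl_rel_def using weyl_ideal_uminus by fastforce
  show "transp weyl_rel"
  proof (rule transpI)
    fix p q r assume "weyl_rel p q" "weyl_rel q r"
    hence "(p - q) + (q - r) \<in> weyl_ideal"
      unfolding weyl_rel_def by (rule weyl_ideal.add)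
    thus "weyl_rel p r" by (simp add: weyl_rel_def)
  qed
qed

quotient_type weyl = weyl_free / weyl_rel
  by (rule equivp_weyl_rel)

instantiation weyl :: "{ring, monoid_mult}"
begin

lift_definition zero_weyl :: weyl is 0 .

lift_definition one_weyl :: weyl is 1 .

lift_definition plus_weyl :: "weyl \<Rightarrow> weyl \<Rightarrow> weyl" is "(+)"
  unfolding weyl_rel_def by (simp only: add_diff_add weyl_ideal.add)

lift_definition uminus_weyl :: "weyl \<Rightarrow> weyl" is uminus
  unfolding weyl_rel_def by (simp only: minus_diff_minus weyl_ideal_uminus)

lift_definition minus_weyl :: "weyl \<Rightarrow> weyl \<Rightarrow> weyl" is "(-)"
proof -
  fix p q r s assume "weyl_rel p q" "weyl_rel r s"
  hence "(p - q) + - (r - s) \<in> weyl_ideal"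
    unfolding weyl_rel_def by (intro weyl_ideal.add weyl_ideal_uminus)
  thus "weyl_rel (p - r) (q - s)"
    unfolding weyl_rel_def by (simp add: algebra_simps)
qed

lift_definition times_weyl :: "weyl \<Rightarrow> weyl \<Rightarrow> weyl" is "(*)"
proof -
  fix p q r s assume "weyl_rel p q" "weyl_rel r s"
  hence "(p - q) * r + q * (r - s) \<in> weyl_ideal"
    unfolding weyl_rel_def
    by (intro weyl_ideal.add weyl_ideal.mult_left weyl_ideal.mult_right)
  thus "weyl_rel (p * r) (q * s)"
    unfolding weyl_rel_def by (simp add: algebra_simps)
qed

instance
proof
  fix a b c :: weyl
  have eq: "weyl_rel p q" if "p = q" for p q
    using that by (simp add: weyl_rel_def weyl_ideal.zero)
  show "a + b + c = a + (b + c)" by transfer (rule eq, simp add: algebra_simps)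
  show "a + b = b + a" by transfer (rule eq, simp add: algebra_simps)
  show "0 + a = a" by transfer (rule eq, simp)
  show "- a + a = 0" by transfer (rule eq, simp)
  show "a - b = a + - b" by transfer (rule eq, simp)
  show "a * b * c = a * (b * c)" by transfer (rule eq, simp add: algebra_simps)
  show "(a + b) * c = a * c + b * c" by transfer (rule eq, simp add: algebra_simps)
  show "a * (b + c) = a * b + a * c" by transfer (rule eq, simp add: algebra_simps)
  show "1 * a = a" by transfer (rule eq, simp)
  show "a * 1 = a" by transfer (rule eq, simp)
qed

end

lift_definition weyl_const :: "complex \<Rightarrow> weyl" is "Poly_Mapping.single 0" .

lift_definition weyl_x :: weyl is "letter Lx" .

lift_definition weyl_t :: weyl is "letter Lt" .

lift_definition weyl_tinv :: weyl is "letter Ltinv" .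

lemma weyl_const_0: "weyl_const 0 = 0"
  by (simp add: weyl_const_def zero_weyl_def)

lemma weyl_const_add: "weyl_const (c + d) = weyl_const c + weyl_const d"
  by transfer (simp add: single_add weyl_rel_def weyl_ideal.zero)

lemma weyl_const_1: "weyl_const 1 = 1"
  by (simp add: weyl_const_def one_weyl_def)

lemma weyl_const_mult: "weyl_const (c * d) = weyl_const c * weyl_const d"
  by transfer (simp add: mult_single weyl_rel_def weyl_ideal.zero)

lemma weyl_relations:
  "weyl_t * weyl_tinv = 1" "weyl_tinv * weyl_t = 1"
  "weyl_x * weyl_t - weyl_t * weyl_x = 1"
  by (transfer, simp add: weyl_rel_def weyl_relators_def weyl_ideal.relator)+

definition weyl_tpow :: "int \<Rightarrow> weyl"
  where "weyl_tpow n = (if n \<ge> 0 then weyl_t ^ nat n else weyl_tinv ^ nat (- n))"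

definition weyl_poly :: "complex poly \<Rightarrow> weyl"  \<comment> \<open>the polynomial evaluated at \<open>x\<close>\<close>
  where "weyl_poly p = (\<Sum>i\<le>Polynomial.degree p. weyl_const (poly.coeff p i) * weyl_x ^ i)"

section \<open>Matrix-valued formal distributions and the conformal Weyl algebra\<close>

text \<open>An \<open>N \<times> N\<close> matrix is a function of two indices vanishing unless both are below \<open>N\<close>.
  The value \<open>u k\<close> of a distribution is the coefficient of \<open>z\<^sup>-\<^sup>k\<^sup>-\<^sup>1\<close>.\<close>

type_synonym weyl_distr = "int \<Rightarrow> nat \<Rightarrow> nat \<Rightarrow> weyl"

definition distr_der :: "weyl_distr \<Rightarrow> weyl_distr"  \<comment> \<open>\<open>d/dz\<close>\<close>
  where "distr_der u = (\<lambda>k i j. weyl_const (- of_int k) * u (k - 1) i j)"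

definition distr_scale :: "complex poly \<Rightarrow> weyl_distr \<Rightarrow> weyl_distr"  \<comment> \<open>the action of \<open>p(d/dz)\<close>\<close>
  where "distr_scale p u =
    (\<lambda>k i j. \<Sum>m\<le>Polynomial.degree p. weyl_const (poly.coeff p m) * (distr_der ^^ m) u k i j)"

definition distr_prod :: "nat \<Rightarrow> nat \<Rightarrow> weyl_distr \<Rightarrow> weyl_distr \<Rightarrow> weyl_distr"
  where "distr_prod N n u v =
    (\<lambda>k i j. \<Sum>s\<le>n. weyl_const ((- 1) ^ s * of_nat (n choose s)) *
       (\<Sum>l<N. u (int n - int s) i l * v (k + int s) l j))"

lemma distr_der_add: "distr_der (u + v) = distr_der u + distr_der v"
  by (simp add: distr_der_def fun_eq_iff algebra_simps)

lemma distr_der_const: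
  "distr_der (\<lambda>k i j. weyl_const c * u k i j) = (\<lambda>k i j. weyl_const c * distr_der u k i j)"
  by (simp add: distr_der_def fun_eq_iff mult.assoc [symmetric] weyl_const_mult [symmetric]
      mult.commute)

lemma distr_der_zero: "distr_der 0 = 0"
  by (simp add: distr_der_def fun_eq_iff)

lemma distr_scale_zero_left: "distr_scale 0 u = 0"
  by (simp add: distr_scale_def fun_eq_iff weyl_const_0)

lemma distr_der_sum:
  "finite A \<Longrightarrow> distr_der (\<lambda>k i j. \<Sum>m\<in>A. f m k i j) = (\<lambda>k i j. \<Sum>m\<in>A. distr_der (f m) k i j)"
  by (simp add: distr_der_def fun_eq_iff sum_distrib_left)

lemma distr_scale_pCons:
  "distr_scale (pCons c p) u = (\<lambda>k i j. weyl_const c * u k i j) + distr_der (distr_scale p u)"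
proof (cases "p = 0")
  case True
  then show ?thesis
    by (simp add: distr_scale_zero_left distr_der_zero)
       (simp add: distr_scale_def fun_eq_iff)
next
  case False
  have "distr_der (distr_scale p u) =
      (\<lambda>k i j. \<Sum>m\<le>Polynomial.degree p. weyl_const (poly.coeff p m) * (distr_der ^^ Suc m) u k i j)"
    unfolding distr_scale_def by (simp add: distr_der_sum distr_der_const)
  with False show ?thesis
    by (simp add: distr_scale_def fun_eq_iff sum.atMost_Suc_shift del: sum.atMost_Suc)
qed

lemma distr_scale_add_right: "distr_scale p (u + v) = distr_scale p u + distr_scale p v"
proof (induction p)
  case 0
  show ?case by (simp add: distr_scale_zero_left)
next
  case (pCons c p)
  show ?case
    unfolding distr_scale_pCons pCons.IH distr_der_add by (simp add: fun_eq_iff algebra_simps)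
qed

lemma distr_scale_add_left: "distr_scale (p + q) u = distr_scale p u + distr_scale q u"
proof (induction p arbitrary: q)
  case 0
  show ?case by (simp add: distr_scale_zero_left)
next
  case (pCons c p)
  show ?case
  proof (cases q)
    case (pCons d r)
    show ?thesis
      unfolding pCons add_pCons distr_scale_pCons pCons.IH distr_der_add weyl_const_add
      by (simp add: fun_eq_iff algebra_simps)
  qed
qed

lemma distr_scale_smult:
  "distr_scale (smult c p) u = (\<lambda>k i j. weyl_const c * distr_scale p u k i j)"
proof (induction p)
  case 0
  show ?case by (simp add: distr_scale_zero_left fun_eq_iff)
next
  case (pCons a p)
  show ?case
    unfolding smult_pCons distr_scale_pCons pCons.IH distr_der_const
    by (simp add: fun_eq_iff distrib_left weyl_const_mult mult.assoc)
qed

lemma distr_scale_mult: "distr_scale (p * q) u = distr_scale p (distr_scale q u)"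
proof (induction p)
  case 0
  show ?case by (simp add: distr_scale_zero_left)
next
  case (pCons c p)
  have "distr_scale (pCons c p * q) u = distr_scale (smult c q) u + distr_scale (pCons 0 (p * q)) u"
    by (simp add: distr_scale_add_left)
  also have "\<dots> = distr_scale (pCons c p) (distr_scale q u)"
    by (simp add: distr_scale_smult distr_scale_pCons [of 0] distr_scale_pCons [of c] weyl_const_0
        pCons.IH fun_eq_iff)
  finally show ?case .
qed

interpretation distr: module distr_scale
proof
  fix p q and u v :: weyl_distr
  show "distr_scale p (u + v) = distr_scale p u + distr_scale p v"
    by (rule distr_scale_add_right)
  show "distr_scale (p + q) u = distr_scale p u + distr_scale q u"
    by (rule distr_scale_add_left)
  show "distr_scale p (distr_scale q u) = distr_scale (p * q) u"
    by (rule distr_scale_mult [symmetric])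
  show "distr_scale 1 u = u"
    by (simp add: distr_scale_def weyl_const_1)
qed

definition poly_matrices :: "nat \<Rightarrow> (nat \<Rightarrow> nat \<Rightarrow> complex poly) set"
  where "poly_matrices N = {a. \<forall>i j. \<not> (i < N \<and> j < N) \<longrightarrow> a i j = 0}"

definition weyl_field :: "(nat \<Rightarrow> nat \<Rightarrow> complex poly) \<Rightarrow> weyl_distr"
  where "weyl_field a = (\<lambda>n i j. weyl_poly (a i j) * weyl_tpow n)"

definition CEnd :: "nat \<Rightarrow> weyl_distr set"
  where "CEnd N = distr.span (weyl_field ` poly_matrices N)"

end

theory Submission
  imports
    Defs
    "HOL-Computational_Algebra.Fundamental_Theorem_Algebra"
    "HOL-Real_Asymp.Real_Asymp"
begin

text \<open>Every \<open>f\<close> is \<open>\<Sum>\<^sub>j (-1)\<^sup>j \<partial>\<^sup>j/j! (f \<circ>\<^sub>j e)\<close>, since the difference annihilates \<open>C\<close> from the left. Hence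
  \<open>C = \<complex>[\<partial>] \<otimes> B\<close> with \<open>B = {b. b \<circ>\<^sub>n e = 0 for n \<ge> 1}\<close>. This \<open>B\<close> is an associative algebra under
  \<open>\<circ>\<^sub>0\<close> with unit \<open>e\<close>, the map \<open>D b = - e \<circ>\<^sub>1 b\<close> is a locally nilpotent derivation of it, and
  \<open>a \<circ>\<^sub>n b = (-1)\<^sup>n a D\<^sup>n(b)\<close>. So it suffices to identify the differential algebra \<open>(B, D)\<close>, which is
  \<open>D\<close>-simple, with \<open>(Mat\<^sub>N(\<complex>[x]), d/dx)\<close>.

  \<open>B\<close> is finitely generated, and as its growth is subquadratic, Bergman's gap theorem bounds the
  dimension of the products of at most \<open>n\<close> generators by \<open>K (n + 1)\<close>. By the density theorem a
  simple module of dimension above \<open>K\<close> would force faster growth, so \<open>B\<close> maps onto some \<open>Mat\<^sub>N(\<complex>)\<close> by a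
  representation \<open>\<rho>\<close>. Then \<open>\<Phi>(b) = \<rho>(exp(x D) b)\<close> is a homomorphism from \<open>B\<close> to \<open>Mat\<^sub>N(\<complex>[x])\<close> taking \<open>D\<close>
  to \<open>d/dx\<close>, and it is injective by \<open>D\<close>-simplicity.

  The growth also makes \<open>B\<close> infinite-dimensional over \<open>\<complex>\<close>, so there are relations
  \<open>\<Sum>\<^sub>s x\<^sup>s \<Phi>(b\<^sub>s) = 0\<close> with coefficients in \<open>B\<close>. In one of least degree \<open>m\<close> the coefficient \<open>b\<^sub>m\<close> may be taken to be
  \<open>e\<close>, by \<open>D\<close>-simplicity, and then \<open>z = - b\<^sub>m\<^sub>-\<^sub>1/m\<close> is central with \<open>D z = e\<close>. Thus \<open>\<Phi>(z)\<close> is \<open>x\<close> up to a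
  constant, and \<open>\<Phi>\<close> is onto.\<close>

section \<open>Linear systems and repetitive words\<close>

text \<open>The growth hypothesis is used twice. From above, ranks below r powr (3/2) bound
  dimensions in B, since elements of B independent over \<complex> are independent over
  \<complex>[\<partial>] in C; then a single n for which the products of at most n generators span
  fewer than n^2/2 dimensions suffices for the gap theorem, because more than d normal words in
  every length d would give at least n(n+1)/2. From below, a finite-dimensional B would bound all
  ranks.

  The obstacle is to recognise B as a matrix algebra without a structure theory of algebras of
  linear growth. A single simple module is enough, because D moves it: \<rho> is evaluation at x =
  0, and exp(x D) shifts the point. What is missing after this is an element of B over x. Relations
  with x adjoined as a central indeterminate supply it: the matrices have N^2 entries, so N^2 + 1
  elements of B are dependent over \<complex>[x]. Once z is found, \<Sum> (-z)^k D^k(b) / k!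
  projects B onto the constants of D, and these carry all constant matrices.\<close>

lemma homogeneous_system_solvable:
  fixes m :: "'j \<Rightarrow> 'i \<Rightarrow> 'r::idom"
  assumes "finite I" "finite J" "card I < card J"
  shows "\<exists>c. (\<exists>j\<in>J. c j \<noteq> 0) \<and> (\<forall>i\<in>I. (\<Sum>j\<in>J. c j * m j i) = 0)"
  using assms
proof (induction I arbitrary: J m rule: finite_induct)
  case empty
  then have "J \<noteq> {}" by auto
  then show ?case by (intro exI[of _ "\<lambda>_. 1"]) auto
next
  case (insert i I)
  show ?case
  proof (cases "\<forall>j\<in>J. m j i = 0")
    case True
    have "card I < card J" using insert by simp
    then obtain c where "\<exists>j\<in>J. c j \<noteq> 0" "\<forall>i\<in>I. (\<Sum>j\<in>J. c j * m j i) = 0"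
      using insert.IH[OF insert.prems(1)] by blast
    with True show ?thesis by (intro exI[of _ c]) simp
  next
    case False
    then obtain j0 where j0: "j0 \<in> J" "m j0 i \<noteq> 0" by blast
    define J' where "J' = J - {j0}"
    \<comment> \<open>Elimination of the unknown \<open>j0\<close> with pivot \<open>m j0 i\<close>.
      It avoids division, so that the lemma serves over \<complex>[\<partial>] and \<complex>[x] as
      well as over \<complex>.\<close>
    define m' where "m' = (\<lambda>j i'. m j0 i * m j i' - m j i * m j0 i')"
    have J: "J = insert j0 J'" "j0 \<notin> J'" "finite J'"
      using j0 insert.prems(1) by (auto simp: J'_def)
    have "card I < card J'" using insert.prems insert.hyps J by simp
    then obtain c' where c': "\<exists>j\<in>J'. c' j \<noteq> 0" "\<And>i'. i' \<in> I \<Longrightarrow> (\<Sum>j\<in>J'. c' j * m' j i') = 0"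
      using insert.IH[OF J(3), of m'] by blast
    define c where "c = (\<lambda>j. if j = j0 then - (\<Sum>j\<in>J'. c' j * m j i) else c' j * m j0 i)"
    have eq: "(\<Sum>j\<in>J. c j * m j i') = (\<Sum>j\<in>J'. c' j * m' j i')" for i'
    proof -
      have "(\<Sum>j\<in>J. c j * m j i') = c j0 * m j0 i' + (\<Sum>j\<in>J'. c j * m j i')"
        using J by simp
      also have "(\<Sum>j\<in>J'. c j * m j i') = (\<Sum>j\<in>J'. c' j * m j0 i * m j i')"
        using J by (intro sum.cong) (auto simp: c_def)
      also have "c j0 * m j0 i' = (\<Sum>j\<in>J'. - (c' j * m j i * m j0 i'))"
        by (simp add: c_def sum_distrib_right sum_negf)
      finally show ?thesis
        by (simp add: m'_def sum.distrib[symmetric] algebra_simps)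
    qed
    have "(\<Sum>j\<in>J. c j * m j i) = 0" unfolding eq by (simp add: m'_def mult.commute)
    moreover have "\<exists>j\<in>J. c j \<noteq> 0"
    proof -
      obtain j where "j \<in> J'" "c' j \<noteq> 0" using c'(1) by blast
      with j0 J have "j \<in> J" "c j \<noteq> 0" by (auto simp: c_def)
      then show ?thesis by blast
    qed
    ultimately show ?thesis using c'(2) eq by (intro exI[of _ c]) auto
  qed
qed

text \<open>More coefficient rows than elements of \<open>T\<close> satisfy a linear relation. This
  bounds the supremum in \<open>rank\<close> on finitely generated submodules.\<close>

lemma independent_card_le_spanning:
  fixes scale :: "'r::idom \<Rightarrow> 'b::ab_group_add \<Rightarrow> 'b"
  assumes "module scale" and T: "finite T" and A: "\<not> module.dependent scale A" "A \<subseteq> module.span scale T"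
  shows "finite A \<and> card A \<le> card T"
proof (rule ccontr)
  interpret module scale by fact
  assume "\<not> (finite A \<and> card A \<le> card T)"
  then obtain J where J: "J \<subseteq> A" "finite J" "card T < card J"
    by (metis infinite_arbitrarily_large linorder_not_le lessI order_refl)
  have "\<forall>a\<in>J. \<exists>m. a = (\<Sum>t\<in>T. scale (m t) t)"
    using J A T by (auto simp: span_finite)
  then obtain m where m: "\<And>a. a \<in> J \<Longrightarrow> a = (\<Sum>t\<in>T. scale (m a t) t)" by metis
  obtain c where c: "\<exists>j\<in>J. c j \<noteq> 0" "\<forall>t\<in>T. (\<Sum>j\<in>J. c j * m j t) = 0"
    using homogeneous_system_solvable[OF T J(2,3), of m] by blast
  have "(\<Sum>a\<in>J. scale (c a) a) = (\<Sum>a\<in>J. \<Sum>t\<in>T. scale (c a * m a t) t)"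
  proof (rule sum.cong)
    fix a assume "a \<in> J"
    show "scale (c a) a = (\<Sum>t\<in>T. scale (c a * m a t) t)"
      using arg_cong[OF m[OF \<open>a \<in> J\<close>], of "scale (c a)"] by (simp add: scale_sum_right)
  qed simp
  also have "\<dots> = (\<Sum>t\<in>T. scale (\<Sum>a\<in>J. c a * m a t) t)"
    by (subst sum.swap) (simp add: scale_sum_left)
  also have "\<dots> = 0" using c by simp
  finally show False using J A c unfolding dependent_explicit by blast
qed

section \<open>Words with few factors of a given length\<close>

definition factor_closed :: "'l list set \<Rightarrow> bool"
  where "factor_closed W \<longleftrightarrow> (\<forall>a u b. a @ u @ b \<in> W \<longrightarrow> u \<in> W)"

lemma factor_closedD: "factor_closed W \<Longrightarrow> a @ u @ b \<in> W \<Longrightarrow> u \<in> W"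
  unfolding factor_closed_def by blast

text \<open>One step of the window drops a letter and gains the letter \<open>q\<close> places
  later, which agrees with it.\<close>

lemma periodic_window_sum:
  fixes g :: "nat \<Rightarrow> nat"
  assumes per: "\<And>i. lo \<le> i \<Longrightarrow> i + q < hi \<Longrightarrow> g (i + q) = g i" and "lo + k + q \<le> hi"
  shows "(\<Sum>i<q. g (lo + k + i)) = (\<Sum>i<q. g (lo + i))"
  using assms(2)
proof (induction k)
  case (Suc k)
  show ?case
  proof (cases q)
    case (Suc q')
    have "(\<Sum>i<q. g (lo + Suc k + i)) = (\<Sum>i<q'. g (lo + k + Suc i)) + g (lo + k + q)"
      by (simp add: Suc)
    also have "g (lo + k + q) = g (lo + k + 0)" using per[of "lo + k"] Suc.prems by simp
    also have "(\<Sum>i<q'. g (lo + k + Suc i)) + g (lo + k + 0) = (\<Sum>i<q. g (lo + k + i))"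
      unfolding Suc sum.lessThan_Suc_shift[of "\<lambda>i. g (lo + k + i)"] by (simp add: add.commute)
    finally show ?thesis using Suc.IH Suc.prems by simp
  qed simp
qed simp

text \<open>Two equal factors of length \<open>d\<close> starting at distance \<open>q \<le> d\<close> near the left end make the word
  \<open>q\<close>-periodic from there on. If \<open>q\<close> is the least such distance, the period can only break near the
  right end: otherwise the \<open>d + 1\<close> factors of length \<open>d\<close> up to the break would be distinct, as the
  window of length \<open>q\<close> ending with the break has another letter sum than the windows before it.\<close>

lemma long_word_periodic:
  fixes w :: "nat list"
  assumes W: "factor_closed W" and fin: "finite {u\<in>W. length u = d}"
    and card: "card {u\<in>W. length u = d} \<le> d" and w: "w \<in> W" "2 * d \<le> length w" and "0 < d"
  shows "\<exists>q. 0 < q \<and> q \<le> d \<and> (\<forall>i. d \<le> i \<and> i < length w - d \<longrightarrow> w ! (i + q) = w ! i)"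
proof -
  define n where "n = length w"
  define sub where "sub = (\<lambda>i. take d (drop i w))"
  have n: "2 * d \<le> n" "d \<le> n - d" using w by (simp_all add: n_def)
  have subW: "sub i \<in> {u\<in>W. length u = d}" if "i \<le> n - d" for i
  proof -
    have "take i w @ sub i @ drop d (drop i w) = w" unfolding sub_def by (metis append_take_drop_id)
    then have "sub i \<in> W" using w W factor_closedD by metis
    with that n show ?thesis by (simp add: sub_def n_def)
  qed
  \<comment> \<open>There are \<open>d + 1\<close> starting positions for at most \<open>d\<close>
    different factors.\<close>
  have pigeon: "\<exists>s t. a \<le> s \<and> s < t \<and> t \<le> a + d \<and> sub s = sub t" if "a + d \<le> n - d" for a
  proof -
    have "sub ` {a..a+d} \<subseteq> {u\<in>W. length u = d}" using subW that by auto
    then have "card (sub ` {a..a+d}) \<le> d" using card card_mono[OF fin] le_trans by blast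
    then have "\<not> inj_on sub {a..a+d}" using card_image[of sub "{a..a+d}"] by auto
    then obtain x y where "x \<in> {a..a+d}" "y \<in> {a..a+d}" "x \<noteq> y" "sub x = sub y"
      unfolding inj_on_def by blast
    then show ?thesis
      by (intro exI[of _ "min x y"] exI[of _ "max x y"]) (auto simp: min_def max_def)
  qed
  have subD: "w ! (s + k) = w ! (t + k)"
    if "sub s = sub t" "k < d" "s \<le> n - d" "t \<le> n - d" for s t k
  proof -
    have "sub s ! k = w ! (s + k)" "sub t ! k = w ! (t + k)"
      using that(2-) n by (simp_all add: sub_def n_def)
    with that(1) show ?thesis by simp
  qed
  define Q where "Q = (\<lambda>q. \<exists>s. s + q \<le> d \<and> 0 < q \<and> sub s = sub (s + q))"
  obtain s t where "s < t" "t \<le> d" "sub s = sub t" using pigeon[of 0] n by auto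
  then have "Q (t - s)" unfolding Q_def by (intro exI[of _ s]) auto
  define q where "q = (LEAST q. Q q)"
  have "Q q" unfolding q_def using \<open>Q (t - s)\<close> by (rule LeastI)
  then obtain s0 where s0: "s0 + q \<le> d" "0 < q" "sub s0 = sub (s0 + q)" unfolding Q_def by blast
  have qmin: "\<not> Q p" if "p < q" for p using that not_less_Least unfolding q_def by blast
  have start: "w ! (i + q) = w ! i" if "s0 \<le> i" "i < s0 + d" for i
    using subD[OF s0(3), of "i - s0"] that s0 n by (simp add: add.commute add.left_commute)
  have "w ! (i + q) = w ! i" if "s0 \<le> i" "i < n - d" for i
  proof (rule ccontr)
    assume "w ! (i + q) \<noteq> w ! i"
    define P where "P = (\<lambda>i. s0 \<le> i \<and> i < n - d \<and> w ! (i + q) \<noteq> w ! i)"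
    define j where "j = (LEAST i. P i)"
    have "P i" using that \<open>w ! (i + q) \<noteq> w ! i\<close> by (simp add: P_def)
    then have "P j" unfolding j_def by (rule LeastI)
    then have j: "s0 \<le> j" "j < n - d" "w ! (j + q) \<noteq> w ! j" by (simp_all add: P_def)
    have jmin: "w ! (k + q) = w ! k" if "s0 \<le> k" "k < j" for k
    proof -
      have "\<not> P k" using that not_less_Least unfolding j_def by blast
      with that j show ?thesis by (simp add: P_def)
    qed
    have jd: "s0 + d \<le> j" using start j by (meson not_le)
    define e where "e = j + q"
    define a where "a = j + 1 - d"
    have ad: "a + d = j + 1" "s0 < a" using jd s0 by (auto simp: a_def)
    obtain s t where st: "a \<le> s" "s < t" "t \<le> j + 1" "sub s = sub t"
      using pigeon[of a] ad j by auto
    show False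
    \<comment> \<open>If neither repeated factor reaches the breaking position \<open>e\<close>,
      both slide back by multiples of \<open>q\<close> to starts less than \<open>q\<close> apart,
      against the minimality of \<open>q\<close>. Otherwise the factor at \<open>t\<close> contains
      the window ending at \<open>e\<close>, which reappears \<open>t - s\<close> places earlier
      inside the periodic stretch.\<close>
    proof (cases "t + d \<le> e")
      case True
      have shift: "sub (k + q) = sub k" if "s0 \<le> k" "k + d \<le> j" for k
      proof (rule nth_equalityI)
        show "length (sub (k + q)) = length (sub k)" using that j s0 by (simp add: sub_def n_def[symmetric])
        fix i assume "i < length (sub (k + q))"
        then have "i < d" by (simp add: sub_def)
        then show "sub (k + q) ! i = sub k ! i"
          using jmin[of "k + i"] that j s0 by (simp add: sub_def n_def[symmetric] add.commute add.left_commute)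
      qed
      have red: "sub k = sub (s0 + (k - s0) mod q)" if "s0 \<le> k" "k + d \<le> e" for k
        using that
      proof (induction k rule: less_induct)
        case (less k)
        show ?case
        proof (cases "k < s0 + q")
          case True
          then show ?thesis using less by simp
        next
          case False
          then have "sub k = sub (k - q)" using shift[of "k - q"] less by (simp add: e_def)
          also have "\<dots> = sub (s0 + (k - q - s0) mod q)"
            using less.IH[of "k - q"] False less.prems s0 by simp
          also have "(k - q - s0) mod q = (k - s0) mod q"
            using False le_mod_geq[of q "k - s0"] by (simp add: diff_diff_left add.commute)
          finally show ?thesis .
        qed
      qed
      define x y where "x = (s - s0) mod q" and "y = (t - s0) mod q"
      have eq: "sub (s0 + x) = sub (s0 + y)"
        using red[of s] red[of t] st True ad by (simp add: x_def y_def)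
      have "t - s < q" using True st ad by (simp add: e_def)
      have "x \<noteq> y"
      proof
        assume "x = y"
        then have "q dvd (t - s0) - (s - s0)" using st ad by (intro mod_eq_dvd_iff_nat[THEN iffD1]) (auto simp: x_def y_def)
        with \<open>t - s < q\<close> st ad show False using nat_dvd_not_less[of "t - s" q] by simp
      qed
      moreover have "x < q" "y < q" using s0 by (simp_all add: x_def y_def)
      ultimately have "Q (if x < y then y - x else x - y)"
        unfolding Q_def using eq s0
        by (auto intro!: exI[of _ "s0 + min x y"] simp: min_def)
      moreover have "(if x < y then y - x else x - y) < q" using \<open>x < q\<close> \<open>y < q\<close> by auto
      ultimately show False using qmin by blast
    next
      case False
      define p where "p = t - s"
      have win: "w ! (j + 1 + i) = w ! (j + 1 - p + i)" if "i < q" for i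
      proof -
        have "w ! (s + (j + 1 + i - t)) = w ! (t + (j + 1 + i - t))"
          using st False that j ad s0 by (intro subD) (auto simp: e_def)
        moreover have "s + (j + 1 + i - t) = j + 1 - p + i" "t + (j + 1 + i - t) = j + 1 + i"
          using st by (auto simp: p_def)
        ultimately show ?thesis by metis
      qed
      have lo: "s0 + (j + 1 - p - s0) = j + 1 - p" "s0 + (j - s0) = j"
        using st ad jd by (auto simp: p_def)
      have "(\<Sum>i<q. w ! (j + 1 - p + i)) = (\<Sum>i<q. w ! (s0 + i))"
        using periodic_window_sum[of s0 q "j + q" "\<lambda>i. w ! i" "j + 1 - p - s0"] jmin lo(1) st ad
        by (simp add: p_def)
      also have "\<dots> = (\<Sum>i<q. w ! (j + i))"
        using periodic_window_sum[of s0 q "j + q" "\<lambda>i. w ! i" "j - s0"] jmin lo(2) by simp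
      finally have "(\<Sum>i<q. w ! (j + 1 + i)) = (\<Sum>i<q. w ! (j + i))" using win by simp
      moreover have "(\<Sum>i<q. w ! (j + 1 + i)) + w ! j = (\<Sum>i<q. w ! (j + i)) + w ! (j + q)"
        using sum.lessThan_Suc_shift[of "\<lambda>i. w ! (j + i)" q] by simp
      ultimately show False using j(3) by simp
    qed
  qed
  with s0 show ?thesis by (intro exI[of _ q]) (auto simp: n_def)
qed

text \<open>A word of length at least \<open>2 * d\<close> is recovered from its period, its first
  \<open>2 * d\<close> letters and its last \<open>d\<close> letters. The number of such triples
  does not depend on the length.\<close>

lemma card_words_bounded:
  fixes W :: "nat list set"
  assumes W: "factor_closed W" and letters: "\<And>w. w \<in> W \<Longrightarrow> set w \<subseteq> {..<k}"
    and card: "card {u\<in>W. length u = d} \<le> d" and d: "0 < d"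
  shows "\<exists>K. \<forall>n. card {w\<in>W. length w = n} \<le> K"
proof -
  define Wd where "Wd = (\<lambda>n. {w\<in>W. length w = n})"
  define X where "X = (\<lambda>n. {w. set w \<subseteq> {..<k} \<and> length w = n})"
  have Wd_sub: "Wd n \<subseteq> X n" for n using letters by (auto simp: Wd_def X_def)
  have finX: "finite (X n)" for n unfolding X_def by (rule finite_lists_length_eq) simp
  have finW: "finite (Wd n)" for n using Wd_sub finX finite_subset by blast
  define S where "S = {1..d} \<times> X (2 * d) \<times> X d"
  have finS: "finite S" unfolding S_def using finX by simp
  have "card (Wd n) \<le> card S" if n: "2 * d \<le> n" for n
  proof -
    have ex: "\<exists>q. 0 < q \<and> q \<le> d \<and> (\<forall>i. d \<le> i \<and> i < n - d \<longrightarrow> w ! (i + q) = w ! i)"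
      if "w \<in> Wd n" for w
      using long_word_periodic[OF W finW[of d, unfolded Wd_def] card _ _ d, of w] that n by (auto simp: Wd_def)
    then obtain q where q: "\<And>w. w \<in> Wd n \<Longrightarrow> 0 < q w \<and> q w \<le> d \<and>
        (\<forall>i. d \<le> i \<and> i < n - d \<longrightarrow> w ! (i + q w) = w ! i)" by metis
    define F where "F = (\<lambda>w. (q w, take (2 * d) w, drop (n - d) w))"
    have "inj_on F (Wd n)"
    proof (rule inj_onI)
      fix v w assume vw: "v \<in> Wd n" "w \<in> Wd n" "F v = F w"
      have len: "length v = n" "length w = n" using vw by (auto simp: Wd_def)
      have "v ! i = w ! i" if "i < n" for i using that
      proof (induction i rule: less_induct)
        case (less i)
        consider "i < 2 * d" | "n - d \<le> i" | "2 * d \<le> i" "i < n - d" by linarith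
        then show ?case
        proof cases
          case 1
          have "take (2 * d) v = take (2 * d) w" using vw by (simp add: F_def)
          with 1 show ?thesis by (metis nth_take)
        next
          case 2
          have "drop (n - d) v ! (i - (n - d)) = drop (n - d) w ! (i - (n - d))" using vw by (simp add: F_def)
          with 2 len show ?thesis by simp
        next
          case 3
          have qq: "q v = q w" "0 < q w" "q w \<le> d" using vw q[of w] by (auto simp: F_def)
          define l where "l = i - q w"
          have l: "i = l + q w" "d \<le> l" "l < i" "l < n - d" using qq 3 d by (auto simp: l_def)
          have "v ! (l + q w) = v ! l" "w ! (l + q w) = w ! l"
            using q[OF vw(1)] q[OF vw(2)] l qq by auto
          with less.IH[of l] less.prems l show ?thesis by simp
        qed
      qed
      then show "v = w" using len by (simp add: nth_equalityI)
    qed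
    moreover have "F ` Wd n \<subseteq> S"
    proof
      fix x assume "x \<in> F ` Wd n"
      then obtain w where w: "w \<in> Wd n" "x = F w" by blast
      then have "set w \<subseteq> {..<k}" "length w = n" using letters by (auto simp: Wd_def)
      moreover have "set (take (2 * d) w) \<subseteq> set w" "set (drop (n - d) w) \<subseteq> set w"
        by (rule set_take_subset, rule set_drop_subset)
      ultimately show "x \<in> S" using w q[of w] n unfolding S_def F_def X_def by auto
    qed
    ultimately show ?thesis using card_inj_on_le finS by blast
  qed
  moreover have "card (Wd n) \<le> (\<Sum>i<2*d. card (Wd i))" if "n < 2 * d" for n
    using that by (intro member_le_sum) auto
  ultimately have "card (Wd n) \<le> card S + (\<Sum>i<2*d. card (Wd i))" for n
    by (cases "n < 2 * d") (auto intro: trans_le_add1 trans_le_add2)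
  then show ?thesis unfolding Wd_def by blast
qed

section \<open>Finitely generated algebras of subquadratic growth\<close>

text \<open>A conformal algebra is associative under \<open>\<circ>\<^sub>0\<close> on its whole carrier, and its conformal identity
  is a left unit of everything. Only the right unit law and statements about the derivation are
  restricted to \<open>B\<close>.\<close>

locale unital_subalgebra = vector_space scale
  for scale :: "complex \<Rightarrow> 'a::ab_group_add \<Rightarrow> 'a"  (infixr \<open>\<cdot>\<close> 75) +
  fixes mul :: "'a \<Rightarrow> 'a \<Rightarrow> 'a"  (infixl \<open>\<odot>\<close> 70)
    and e :: 'a and B :: "'a set"
  assumes mul_add_left: "(a + b) \<odot> c = a \<odot> c + b \<odot> c"
    and mul_add_right: "a \<odot> (b + c) = a \<odot> b + a \<odot> c"
    and mul_scale_left [simp]: "(z \<cdot> a) \<odot> b = z \<cdot> (a \<odot> b)"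
    and mul_scale_right [simp]: "a \<odot> (z \<cdot> b) = z \<cdot> (a \<odot> b)"
    and mul_assoc: "a \<odot> b \<odot> c = a \<odot> (b \<odot> c)"
    and subspace_B: "subspace B"
    and mul_B: "a \<in> B \<Longrightarrow> b \<in> B \<Longrightarrow> a \<odot> b \<in> B"
    and unit_B: "e \<in> B"
    and unit_left [simp]: "e \<odot> a = a"
    and unit_right: "a \<in> B \<Longrightarrow> a \<odot> e = a"
    and unit_nonzero: "e \<noteq> 0"
begin

lemma mul_zero_left [simp]: "0 \<odot> a = 0" using mul_add_left[of 0 0 a] by simp
lemma mul_zero_right [simp]: "a \<odot> 0 = 0" using mul_add_right[of a 0 0] by simp
lemma mul_minus_left [simp]: "(- a) \<odot> b = - (a \<odot> b)"
  using mul_add_left[of "- a" a b] by (simp add: eq_neg_iff_add_eq_0)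
lemma mul_minus_right [simp]: "a \<odot> (- b) = - (a \<odot> b)"
  using mul_add_right[of a "- b" b] by (simp add: eq_neg_iff_add_eq_0)
lemma mul_diff_left: "(a - b) \<odot> c = a \<odot> c - b \<odot> c" using mul_add_left[of a "- b" c] by simp
lemma mul_diff_right: "a \<odot> (b - c) = a \<odot> b - a \<odot> c" using mul_add_right[of a b "- c"] by simp
lemma mul_sum_left: "sum f I \<odot> b = (\<Sum>i\<in>I. f i \<odot> b)"
  by (induction I rule: infinite_finite_induct) (simp_all add: mul_add_left)
lemma mul_sum_right: "b \<odot> sum f I = (\<Sum>i\<in>I. b \<odot> f i)"
  by (induction I rule: infinite_finite_induct) (simp_all add: mul_add_right)

lemmas B_add = subspace_add[OF subspace_B]
lemmas B_diff = subspace_diff[OF subspace_B]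
lemmas B_scale = subspace_scale[OF subspace_B]
lemmas B_sum = subspace_sum[OF subspace_B]

text \<open>Independence of a family in the quotient by \<open>L\<close>, expressed by
  representatives so that no quotient space has to be formed; \<open>L = {0}\<close> gives ordinary
  independence.\<close>

definition indep_mod :: "'a set \<Rightarrow> ('i \<Rightarrow> 'a) \<Rightarrow> 'i set \<Rightarrow> bool"
  where "indep_mod L x I \<longleftrightarrow> (\<forall>c. (\<Sum>i\<in>I. c i \<cdot> x i) \<in> L \<longrightarrow> (\<forall>i\<in>I. c i = 0))"

lemma indep_mod_card_le:
  assumes "finite I" "finite T" "subspace L" "indep_mod L x I"
    and "\<And>i. i \<in> I \<Longrightarrow> \<exists>y\<in>span T. x i - y \<in> L"
  shows "card I \<le> card T"
proof (rule ccontr)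
  assume "\<not> card I \<le> card T"
  have "\<forall>i\<in>I. \<exists>m. x i - (\<Sum>t\<in>T. m t \<cdot> t) \<in> L"
    using assms(5) \<open>finite T\<close> by (auto simp: span_finite)
  then obtain m where m: "\<And>i. i \<in> I \<Longrightarrow> x i - (\<Sum>t\<in>T. m i t \<cdot> t) \<in> L" by metis
  obtain c where c: "\<exists>i\<in>I. c i \<noteq> 0" "\<forall>t\<in>T. (\<Sum>i\<in>I. c i * m i t) = 0"
    using homogeneous_system_solvable[of T I m] assms \<open>\<not> card I \<le> card T\<close> by auto
  have "(\<Sum>i\<in>I. c i \<cdot> (x i - (\<Sum>t\<in>T. m i t \<cdot> t))) \<in> L"
    using m assms(3) by (intro subspace_sum subspace_scale) auto
  also have "(\<Sum>i\<in>I. c i \<cdot> (x i - (\<Sum>t\<in>T. m i t \<cdot> t))) =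
      (\<Sum>i\<in>I. c i \<cdot> x i) - (\<Sum>i\<in>I. \<Sum>t\<in>T. (c i * m i t) \<cdot> t)"
    by (simp add: scale_right_diff_distrib sum_subtractf scale_sum_right)
  also have "(\<Sum>i\<in>I. \<Sum>t\<in>T. (c i * m i t) \<cdot> t) = (\<Sum>t\<in>T. (\<Sum>i\<in>I. c i * m i t) \<cdot> t)"
    by (subst sum.swap) (simp add: scale_sum_left)
  also have "\<dots> = 0" using c by simp
  finally show False using assms(4) c(1) unfolding indep_mod_def by auto
qed

end

section \<open>Normal words and Bergman's gap theorem\<close>

locale generated_algebra = unital_subalgebra scale mul e B
  for scale :: "complex \<Rightarrow> 'a::ab_group_add \<Rightarrow> 'a"  (infixr \<open>\<cdot>\<close> 75)
    and mul (infixl \<open>\<odot>\<close> 70) and e B +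
  fixes v :: "nat \<Rightarrow> 'a" and k :: nat
  assumes generators: "i < k \<Longrightarrow> v i \<in> B"
begin

definition words :: "nat list set"
  where "words = {w. set w \<subseteq> {..<k}}"

definition word :: "nat list \<Rightarrow> 'a"
  where "word w = foldr (\<lambda>i x. v i \<odot> x) w e"

definition filt :: "nat \<Rightarrow> 'a set"
  where "filt n = span (word ` {w\<in>words. length w \<le> n})"

text \<open>The standard monomials of noncommutative Groebner basis theory. Since
  \<open>lenlex\<close> compares lengths first, reduction to them never lengthens a word, and they
  give bases compatible with \<open>filt\<close>.\<close>

definition normal_words :: "nat list set"
  where "normal_words = {w\<in>words. word w \<notin> span (word ` {u\<in>words. (u, w) \<in> lenlex less_than})}"

lemma word_Nil [simp]: "word [] = e" by (simp add: word_def)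
lemma word_Cons [simp]: "word (i # w) = v i \<odot> word w" by (simp add: word_def)
lemma word_append: "word (u @ w) = word u \<odot> word w"
  by (induction u) (simp_all add: mul_assoc)

lemma words_append [simp]: "u @ w \<in> words \<longleftrightarrow> u \<in> words \<and> w \<in> words"
  by (auto simp: words_def)

lemma word_B: "w \<in> words \<Longrightarrow> word w \<in> B"
  by (induction w) (auto simp: words_def unit_B mul_B generators)

lemma finite_words: "finite {w\<in>words. length w \<le> n}"
  unfolding words_def using finite_lists_length_le[of "{..<k}" n] by simp

lemma subspace_filt: "subspace (filt n)"
  by (simp add: filt_def)

lemma filt_mono: "m \<le> n \<Longrightarrow> filt m \<subseteq> filt n"
  unfolding filt_def by (intro span_mono image_mono) auto

lemma word_filt: "w \<in> words \<Longrightarrow> word w \<in> filt (length w)"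
  unfolding filt_def by (intro span_base) auto

lemma filt_B: "filt n \<subseteq> B"
  unfolding filt_def using word_B by (intro span_minimal subspace_B) auto

lemma unit_filt: "e \<in> filt n"
  using word_filt[of "[]"] filt_mono[of 0 n] by (auto simp: words_def)

lemma mul_filt:
  assumes "a \<in> filt m" "b \<in> filt n"
  shows "a \<odot> b \<in> filt (m + n)"
proof -
  have w: "word u \<odot> b \<in> filt (m + n)" if "u \<in> words" "length u \<le> m" for u
    using assms(2) unfolding filt_def
  proof (induction rule: span_induct)
    case (step x)
    then obtain w where "w \<in> words" "length w \<le> n" "x = word w" by auto
    then show ?case using that
      by (auto simp: word_append[symmetric] intro!: span_base imageI)
  next
    case base show ?case
      by (rule subspaceI) (auto simp: mul_add_right intro: span_add span_scale span_zero)
  qed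
  show ?thesis using assms(1) unfolding filt_def[of m]
  proof (induction rule: span_induct)
    case (step x)
    then show ?case using w by auto
  next
    case base show ?case using subspace_filt[of "m + n"]
      by (intro subspaceI) (auto simp: mul_add_left subspace_def)
  qed
qed

text \<open>If a factor reduces to smaller words, so does the whole word, because
  \<open>lenlex less_than\<close> is preserved by multiplication on either side.\<close>

lemma normal_words_factor_closed: "factor_closed normal_words"
  unfolding factor_closed_def
proof (intro allI impI)
  fix a u b assume aub: "a @ u @ b \<in> normal_words"
  show "u \<in> normal_words"
  proof (rule ccontr)
    assume "u \<notin> normal_words"
    moreover have w: "a \<in> words" "u \<in> words" "b \<in> words" using aub by (auto simp: normal_words_def)
    ultimately have "word u \<in> span (word ` {u'\<in>words. (u', u) \<in> lenlex less_than})"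
      by (simp add: normal_words_def)
    then have "word a \<odot> (word u \<odot> word b) \<in> span (word ` {w\<in>words. (w, a @ u @ b) \<in> lenlex less_than})"
    proof (induction rule: span_induct)
      case (step x)
      then obtain u' where u': "u' \<in> words" "(u', u) \<in> lenlex less_than" "x = word u'" by auto
      then have "(a @ u' @ b, a @ u @ b) \<in> lenlex less_than"
        by (auto intro: lenlex_append1 simp: irrefl_def)
      then show ?case using u' w by (auto simp: word_append[symmetric] intro!: span_base imageI)
    next
      case base show ?case
        by (rule subspaceI)
          (auto simp: mul_add_right mul_add_left intro: span_add span_scale span_zero)
    qed
    then show False using aub by (simp add: normal_words_def word_append)
  qed
qed

lemma word_in_span_normal:
  "w \<in> words \<Longrightarrow> word w \<in> span (word ` {u\<in>normal_words. length u \<le> length w})"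
proof (induction w rule: wf_induct_rule[OF wf_lenlex[OF wf_less_than]])
  case (1 w)
  show ?case
  proof (cases "w \<in> normal_words")
    case True
    then show ?thesis by (intro span_base) auto
  next
    case False
    then have w: "word w \<in> span (word ` {u\<in>words. (u, w) \<in> lenlex less_than})"
      using 1 by (simp add: normal_words_def)
    have "word ` {u\<in>words. (u, w) \<in> lenlex less_than} \<subseteq> span (word ` {u\<in>normal_words. length u \<le> length w})"
    proof
      fix x assume "x \<in> word ` {u\<in>words. (u, w) \<in> lenlex less_than}"
      then obtain u where u: "u \<in> words" "(u, w) \<in> lenlex less_than" "x = word u" by auto
      then have "x \<in> span (word ` {u'\<in>normal_words. length u' \<le> length u})" using 1 by simp
      also have "\<dots> \<subseteq> span (word ` {u\<in>normal_words. length u \<le> length w})"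
        using lenlex_length[OF u(2)] by (intro span_mono image_mono) auto
      finally show "x \<in> \<dots>" .
    qed
    then have "span (word ` {u\<in>words. (u, w) \<in> lenlex less_than}) \<subseteq>
        span (word ` {u\<in>normal_words. length u \<le> length w})"
      by (intro span_minimal) auto
    with w show ?thesis by blast
  qed
qed

lemma filt_eq_span_normal: "filt n = span (word ` {w\<in>normal_words. length w \<le> n})"
proof
  show "span (word ` {w\<in>normal_words. length w \<le> n}) \<subseteq> filt n"
    unfolding filt_def by (intro span_mono image_mono) (auto simp: normal_words_def)
  have "word w \<in> span (word ` {w\<in>normal_words. length w \<le> n})" if "w \<in> words" "length w \<le> n" for w
    using word_in_span_normal[OF that(1)] that(2)
      span_mono[of "word ` {u\<in>normal_words. length u \<le> length w}" "word ` {w\<in>normal_words. length w \<le> n}"]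
    by force
  then show "filt n \<subseteq> span (word ` {w\<in>normal_words. length w \<le> n})"
    unfolding filt_def by (intro span_minimal) auto
qed

lemma normal_words_relation_trivial:
  assumes "finite X" "X \<subseteq> normal_words" "(\<Sum>w\<in>X. c w \<cdot> word w) = 0"
  shows "\<forall>w\<in>X. c w = 0"
proof (rule ccontr)
  define Y where "Y = {w\<in>X. c w \<noteq> 0}"
  assume "\<not> (\<forall>w\<in>X. c w = 0)"
  then obtain y where "y \<in> Y" by (auto simp: Y_def)
  define R where "R = lenlex less_than \<inter> Y \<times> Y"
  have "finite Y" using assms by (simp add: Y_def)
  then have "finite R" by (simp add: R_def)
  moreover have "acyclic R"
    using wf_acyclic[OF wf_lenlex[OF wf_less_than]] by (rule acyclic_subset) (auto simp: R_def)
  ultimately have "wf (R\<inverse>)" by (rule finite_acyclic_wf_converse)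
  then obtain m where m: "m \<in> Y" "\<And>y. (y, m) \<in> R\<inverse> \<Longrightarrow> y \<notin> Y" using \<open>y \<in> Y\<close> by (metis wfE_min)
  have less: "(u, m) \<in> lenlex less_than" if "u \<in> Y" "u \<noteq> m" for u
  proof -
    have "(u, m) \<in> lenlex less_than \<or> (m, u) \<in> lenlex less_than"
      using total_lenlex[OF total_less_than] that(2) by (simp add: total_on_def)
    moreover have "(m, u) \<notin> lenlex less_than"
    proof
      assume "(m, u) \<in> lenlex less_than"
      then have "(u, m) \<in> R\<inverse>" using m(1) that(1) by (simp add: R_def)
      then show False using m(2) that(1) by blast
    qed
    ultimately show ?thesis by blast
  qed
  have "(\<Sum>w\<in>Y. c w \<cdot> word w) = 0"
    using assms(1,3) sum.mono_neutral_right[OF assms(1), of Y "\<lambda>w. c w \<cdot> word w"] by (auto simp: Y_def)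
  then have "c m \<cdot> word m = - (\<Sum>w\<in>Y-{m}. c w \<cdot> word w)"
    using m(1) \<open>finite Y\<close> by (simp add: sum.remove eq_neg_iff_add_eq_0)
  then have "(1 / c m) \<cdot> (c m \<cdot> word m) = (1 / c m) \<cdot> - (\<Sum>w\<in>Y-{m}. c w \<cdot> word w)"
    by (rule arg_cong)
  moreover have "c m \<noteq> 0" using m(1) by (simp add: Y_def)
  ultimately have "word m = - (\<Sum>w\<in>Y-{m}. (c w / c m) \<cdot> word w)"
    by (simp add: scale_sum_right scale_scale)
  also have "\<dots> \<in> span (word ` {u\<in>words. (u, m) \<in> lenlex less_than})"
    using less assms(2) by (intro span_neg span_sum span_scale span_base) (auto simp: Y_def normal_words_def)
  finally show False using m(1) assms(2) by (auto simp: Y_def normal_words_def)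
qed

lemma normal_words_independent:
  assumes "finite X" "X \<subseteq> normal_words"
  shows "inj_on word X" "independent (word ` X)"
proof -
  show inj: "inj_on word X"
  proof (rule inj_onI, rule ccontr)
    fix x y assume xy: "x \<in> X" "y \<in> X" "word x = word y" "x \<noteq> y"
    have "(\<Sum>w\<in>{x,y}. (if w = x then 1 else - 1) \<cdot> word w) = 0" using xy by simp
    then have "\<forall>w\<in>{x,y}. (if w = x then 1 else - 1 :: complex) = 0"
      using xy assms by (intro normal_words_relation_trivial) auto
    then show False by simp
  qed
  show "independent (word ` X)"
  proof
    assume "dependent (word ` X)"
    then obtain u where u: "\<exists>v\<in>word ` X. u v \<noteq> 0" "(\<Sum>v\<in>word ` X. u v \<cdot> v) = 0"
      using assms(1) by (auto simp: dependent_finite)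
    have "(\<Sum>w\<in>X. u (word w) \<cdot> word w) = 0" using u(2) by (simp add: sum.reindex[OF inj])
    then show False using normal_words_relation_trivial[OF assms, of "\<lambda>w. u (word w)"] u(1) by auto
  qed
qed

lemma finite_normal_words: "finite {w\<in>normal_words. length w = d}" "finite {w\<in>normal_words. length w \<le> d}"
  by (rule finite_subset[OF _ finite_words[of d]], force simp: normal_words_def)+

lemma card_normal_words_le:
  "card {w\<in>normal_words. length w \<le> n} = (\<Sum>d\<le>n. card {w\<in>normal_words. length w = d})"
proof -
  have "{w\<in>normal_words. length w \<le> n} = (\<Union>d\<in>{..n}. {w\<in>normal_words. length w = d})" by auto
  then show ?thesis using finite_normal_words by (simp add: card_UN_disjoint disjoint_iff)
qed

text \<open>With more than \<open>d\<close> normal words in each positive length \<open>d\<close>,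
  those of length at most \<open>n\<close> would number at least n(n+1)/2. So some length has few,
  and \<open>card_words_bounded\<close> then bounds all lengths. The hypothesis concerns a single
  \<open>n\<close>, the conclusion every \<open>n\<close>.\<close>

lemma subquadratic_growth_linear:
  assumes "\<And>X. finite X \<Longrightarrow> X \<subseteq> filt n \<Longrightarrow> independent X \<Longrightarrow> 2 * card X < n * n"
  shows "\<exists>K. \<forall>n (I :: 'i set) x L. finite I \<and> subspace L \<and> indep_mod L x I \<and>
    (\<forall>i\<in>I. x i \<in> filt n) \<longrightarrow> card I \<le> K * (n + 1)"
proof -
  define p where "p = (\<lambda>d. card {w\<in>normal_words. length w = d})"
  define X where "X = {w\<in>normal_words. length w \<le> n}"
  have X: "finite X" "X \<subseteq> normal_words" using finite_normal_words by (auto simp: X_def)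
  have "card (word ` X) = card X" using normal_words_independent(1)[OF X] by (rule card_image)
  moreover have "2 * card (word ` X) < n * n"
    using assms X normal_words_independent(2)[OF X] by (auto simp: filt_eq_span_normal X_def intro: span_base)
  ultimately have less: "2 * (\<Sum>d\<le>n. p d) < n * n"
    by (simp add: X_def p_def card_normal_words_le)
  have "\<exists>d>0. p d \<le> d"
  proof (rule ccontr)
    assume "\<not> (\<exists>d>0. p d \<le> d)"
    then have dp: "d \<le> p d" for d
      by (metis le0 less_imp_le linorder_not_le neq0_conv)
    then have "(\<Sum>d\<le>n. d) \<le> (\<Sum>d\<le>n. p d)" by (intro sum_mono dp)
    moreover have "2 * (\<Sum>d\<le>n. d) = n * (n + 1)"
      by (induction n) auto
    ultimately show False using less by (simp add: algebra_simps)
  qed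
  then obtain d where d: "0 < d" "p d \<le> d" by blast
  obtain K where K: "\<And>n. p n \<le> K"
    using card_words_bounded[OF normal_words_factor_closed, of k d] d
    unfolding p_def by (auto simp: normal_words_def words_def)
  show ?thesis
  proof (intro exI allI impI)
    fix n and I :: "'i set" and x L
    assume I: "finite I \<and> subspace L \<and> indep_mod L x I \<and> (\<forall>i\<in>I. x i \<in> filt n)"
    have "card I \<le> card (word ` {w\<in>normal_words. length w \<le> n})"
    proof (rule indep_mod_card_le)
      fix i assume "i \<in> I"
      then show "\<exists>y\<in>span (word ` {w\<in>normal_words. length w \<le> n}). x i - y \<in> L"
        using I subspace_0[of L] by (intro bexI[of _ "x i"]) (simp_all add: filt_eq_span_normal)
    qed (use I finite_normal_words in simp_all)
    also have "\<dots> \<le> card {w\<in>normal_words. length w \<le> n}" by (intro card_image_le finite_normal_words)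
    also have "\<dots> \<le> (\<Sum>d\<le>n. K)" unfolding card_normal_words_le using K by (intro sum_mono) (simp add: p_def)
    finally show "card I \<le> K * (n + 1)" by (simp add: algebra_simps)
  qed
qed

end

section \<open>Simple modules\<close>

context unital_subalgebra begin

definition left_ideal :: "'a set \<Rightarrow> bool"
  where "left_ideal L \<longleftrightarrow> subspace L \<and> L \<subseteq> B \<and> (\<forall>b\<in>B. \<forall>l\<in>L. b \<odot> l \<in> L)"

text \<open>Zorn's lemma. Maximality is recorded as solvability of a b = e modulo \<open>L\<close>
  for every \<open>b\<close> outside \<open>L\<close>, which is simplicity of B/L in terms of
  elements.\<close>

lemma maximal_left_ideal_exists:
  "\<exists>L. left_ideal L \<and> e \<notin> L \<and> (\<forall>b\<in>B - L. \<exists>a\<in>B. a \<odot> b - e \<in> L)"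
proof -
  define A where "A = {L. left_ideal L \<and> e \<notin> L}"
  have "{0} \<in> A" using subspace_0[OF subspace_B] unit_nonzero by (auto simp: A_def left_ideal_def subspace_def)
  have "\<Union>C \<in> A" if C: "C \<noteq> {}" "subset.chain A C" for C
  proof -
    have CA: "L \<in> A" if "L \<in> C" for L using C that by (auto simp: subset.chain_def)
    have chain: "L \<subseteq> M \<or> M \<subseteq> L" if "L \<in> C" "M \<in> C" for L M
      using C(2) that by (auto simp: subset.chain_def)
    have "subspace (\<Union>C)"
    proof (rule subspaceI)
      show "0 \<in> \<Union>C" using C CA by (fastforce simp: A_def left_ideal_def subspace_def)
    next
      fix x y assume "x \<in> \<Union>C" "y \<in> \<Union>C"
      then obtain L M where LM: "L \<in> C" "M \<in> C" "x \<in> L" "y \<in> M" by blast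
      obtain N where "N \<in> C" "x \<in> N" "y \<in> N" using chain[OF LM(1,2)] LM by blast
      moreover have "subspace N" using CA[OF \<open>N \<in> C\<close>] by (simp add: A_def left_ideal_def)
      ultimately show "x + y \<in> \<Union>C" using subspace_add by blast
    next
      fix c x assume "x \<in> \<Union>C"
      then show "c \<cdot> x \<in> \<Union>C" using CA by (fastforce simp: A_def left_ideal_def subspace_def)
    qed
    then show ?thesis using CA by (fastforce simp: A_def left_ideal_def)
  qed
  then obtain L where L: "L \<in> A" "\<And>X. X \<in> A \<Longrightarrow> L \<subseteq> X \<Longrightarrow> X = L"
    using subset_Zorn_nonempty[of A] \<open>{0} \<in> A\<close> by (metis empty_iff)
  then have sub: "subspace L" and LB: "L \<subseteq> B" and Lm: "\<And>b l. b \<in> B \<Longrightarrow> l \<in> L \<Longrightarrow> b \<odot> l \<in> L" and "e \<notin> L"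
    by (auto simp: A_def left_ideal_def)
  have "\<exists>a\<in>B. a \<odot> b - e \<in> L" if b: "b \<in> B" "b \<notin> L" for b
  proof -
    define X where "X = {a \<odot> b + l | a l. a \<in> B \<and> l \<in> L}"
    have XI: "a \<odot> b + l \<in> X" if "a \<in> B" "l \<in> L" for a l using that by (auto simp: X_def)
    have bX: "b \<in> X" using XI[OF unit_B subspace_0[OF sub]] by simp
    have LX: "L \<subseteq> X"
    proof
      fix l assume "l \<in> L"
      then show "l \<in> X" using XI[OF subspace_0[OF subspace_B]] by force
    qed
    have "left_ideal X"
      unfolding left_ideal_def
    proof (intro conjI ballI)
      show "subspace X"
      proof (rule subspaceI)
        show "0 \<in> X" using LX subspace_0[OF sub] by blast
      next
        fix x y assume "x \<in> X" "y \<in> X"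
        then obtain a l a' l' where "a \<in> B" "l \<in> L" "x = a \<odot> b + l" "a' \<in> B" "l' \<in> L" "y = a' \<odot> b + l'"
          unfolding X_def by blast
        then show "x + y \<in> X" using XI[of "a + a'" "l + l'"] B_add subspace_add[OF sub]
          by (simp add: mul_add_left algebra_simps)
      next
        fix c x assume "x \<in> X"
        then obtain a l where "a \<in> B" "l \<in> L" "x = a \<odot> b + l" unfolding X_def by blast
        then show "c \<cdot> x \<in> X" using XI[of "c \<cdot> a" "c \<cdot> l"] B_scale subspace_scale[OF sub]
          by (simp add: scale_right_distrib)
      qed
      show "X \<subseteq> B" unfolding X_def using LB b mul_B B_add by blast
      fix c x assume "c \<in> B" "x \<in> X"
      then obtain a l where "a \<in> B" "l \<in> L" "x = a \<odot> b + l" unfolding X_def by blast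
      with \<open>c \<in> B\<close> show "c \<odot> x \<in> X" using XI[of "c \<odot> a" "c \<odot> l"] mul_B Lm
        by (simp add: mul_add_right mul_assoc)
    qed
    moreover have "X \<noteq> L" using bX b by blast
    ultimately have "e \<in> X" using L(2)[OF _ LX] by (auto simp: A_def)
    then obtain a l where al: "a \<in> B" "l \<in> L" "e = a \<odot> b + l" unfolding X_def by blast
    then have "a \<odot> b - e = - l" by simp
    then show ?thesis using al subspace_neg[OF sub] by (metis)
  qed
  then show ?thesis using L(1) by (auto simp: A_def)
qed

end

section \<open>Schur's lemma for the simple module B/L\<close>

locale maximal_left_ideal = unital_subalgebra scale mul e B
  for scale :: "complex \<Rightarrow> 'a::ab_group_add \<Rightarrow> 'a"  (infixr \<open>\<cdot>\<close> 75)
    and mul (infixl \<open>\<odot>\<close> 70) and e B +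
  fixes L :: "'a set"
  assumes left_ideal_L: "left_ideal L" and proper: "e \<notin> L"
    and maximal: "b \<in> B \<Longrightarrow> b \<notin> L \<Longrightarrow> \<exists>a\<in>B. a \<odot> b - e \<in> L"
begin

lemma subspace_L: "subspace L" and L_B: "l \<in> L \<Longrightarrow> l \<in> B"
  and L_mul: "b \<in> B \<Longrightarrow> l \<in> L \<Longrightarrow> b \<odot> l \<in> L"
  using left_ideal_L by (auto simp: left_ideal_def)

lemmas L_add = subspace_add[OF subspace_L]
lemmas L_diff = subspace_diff[OF subspace_L]
lemmas L_scale = subspace_scale[OF subspace_L]
lemmas L_sum = subspace_sum[OF subspace_L]
lemmas L_0 = subspace_0[OF subspace_L]
lemmas L_neg = subspace_neg[OF subspace_L]

context
  fixes u :: 'a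
  assumes u: "u \<in> B" and idealizer: "\<And>l. l \<in> L \<Longrightarrow> l \<odot> u \<in> L"
begin

text \<open>As \<open>u\<close> idealizes \<open>L\<close>, right multiplication by it is an
  endomorphism of B/L; \<open>shift c\<close> represents that endomorphism minus the scalar
  \<open>c\<close>.\<close>

definition shift :: "complex \<Rightarrow> 'a" where "shift c = u - c \<cdot> e"

lemma shift_B: "shift c \<in> B"
  unfolding shift_def using u unit_B by (intro B_diff B_scale)

lemma L_mul_shift: "l \<in> L \<Longrightarrow> l \<odot> shift c \<in> L"
  unfolding shift_def using idealizer L_B
  by (auto simp: mul_diff_right unit_right intro!: L_diff L_scale)

text \<open>A nonzero endomorphism of a simple module is injective: if \<open>b\<close> were outside
  \<open>L\<close>, inverting it modulo \<open>L\<close> would bring \<open>shift c\<close> itself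
  into \<open>L\<close>.\<close>

lemma shift_cancel:
  assumes "shift c \<notin> L" "b \<in> B" "b \<odot> shift c \<in> L"
  shows "b \<in> L"
proof (rule ccontr)
  assume "b \<notin> L"
  then obtain a where a: "a \<in> B" "a \<odot> b - e \<in> L" using maximal assms by blast
  have "a \<odot> (b \<odot> shift c) - (a \<odot> b - e) \<odot> shift c \<in> L"
    using L_diff[OF L_mul[OF a(1) assms(3)] L_mul_shift[OF a(2)]] .
  also have "a \<odot> (b \<odot> shift c) - (a \<odot> b - e) \<odot> shift c = shift c"
    by (simp add: mul_diff_left mul_assoc)
  finally show False using assms(1) by simp
qed

definition peval :: "complex poly \<Rightarrow> 'a"
  where "peval p = fold_coeffs (\<lambda>a r. a \<cdot> e + r \<odot> u) p 0"

lemma peval_0 [simp]: "peval 0 = 0"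
  by (simp add: peval_def)

lemma peval_pCons [simp]: "peval (pCons a p) = a \<cdot> e + peval p \<odot> u"
  by (cases "a = 0 \<and> p = 0") (auto simp: peval_def)

lemma peval_B: "peval p \<in> B"
  by (induction p) (auto intro!: B_add B_scale mul_B unit_B u subspace_0[OF subspace_B])

lemma peval_add: "peval (p + q) = peval p + peval q"
proof (induction p arbitrary: q)
  case (pCons a p)
  obtain b q' where q: "q = pCons b q'" using pCons_cases by metis
  show ?case by (simp add: q pCons.IH mul_add_left scale_left_distrib)
qed simp

lemma peval_smult: "peval (smult c p) = c \<cdot> peval p"
  by (induction p) (simp_all add: scale_right_distrib)

lemma peval_sum: "peval (sum f I) = (\<Sum>i\<in>I. peval (f i))"
  by (induction I rule: infinite_finite_induct) (simp_all add: peval_add)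

lemma peval_commute: "u \<odot> peval p = peval p \<odot> u"
proof (induction p)
  case (pCons a p)
  have "u \<odot> (peval p \<odot> u) = peval p \<odot> u \<odot> u" using pCons.IH by (metis mul_assoc)
  then show ?case using u by (simp add: mul_add_left mul_add_right unit_right)
qed simp

lemma peval_linear_factor:
  "peval ([:- c, 1:] * p) = peval p \<odot> shift c" "peval ([:- c, 1:] * p) = shift c \<odot> peval p"
proof -
  have "peval ([:- c, 1:] * p) = peval p \<odot> u - c \<cdot> peval p"
  proof -
    have "[:- c, 1:] * p = pCons 0 p + smult (- c) p" by simp
    then show ?thesis by (simp only: peval_add peval_smult) simp
  qed
  then show "peval ([:- c, 1:] * p) = peval p \<odot> shift c" "peval ([:- c, 1:] * p) = shift c \<odot> peval p"
    by (simp_all add: shift_def mul_diff_right mul_diff_left unit_right[OF peval_B] peval_commute)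
qed

text \<open>Over \<complex> the polynomial splits; its linear factors cancel one at a time by
  \<open>shift_cancel\<close> until a nonzero multiple of \<open>e\<close> remains.\<close>

lemma peval_not_in_L:
  assumes "\<And>c. shift c \<notin> L" "q \<noteq> 0"
  shows "peval q \<notin> L"
  using assms(2)
proof (induction "degree q" arbitrary: q rule: less_induct)
  case less
  show ?case
  proof (cases "degree q = 0")
    case True
    then obtain a where "q = [:a:]" by (metis degree_0_id degree_eq_zeroE)
    with less.prems have a: "a \<noteq> 0" "peval q = a \<cdot> e" by auto
    show ?thesis
    proof
      assume "peval q \<in> L"
      then have "(1 / a) \<cdot> (a \<cdot> e) \<in> L" using a L_scale by metis
      with a proper show False by simp
    qed
  next
    case False
    then obtain r where "poly q r = 0"
      using fundamental_theorem_of_algebra[of q] constant_degree[of q] by auto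
    then obtain q' where q': "q = [:- r, 1:] * q'" by (metis dvdE poly_eq_0_iff_dvd)
    then have "q' \<noteq> 0" using less.prems by auto
    then have "degree q' < degree q" unfolding q' by (subst degree_mult_eq) auto
    then have "peval q' \<notin> L" using less.hyps \<open>q' \<noteq> 0\<close> by blast
    then show ?thesis
      using shift_cancel[OF assms(1) peval_B] unfolding q' peval_linear_factor(1) by blast
  qed
qed

text \<open>Partial fractions: \<open>a c\<close> plays the role of 1/(u - c). Multiplying a
  relation by the product \<open>P S\<close> of all factors leaves the value at \<open>u\<close> of
  a polynomial \<open>q\<close>, which must be zero, and evaluating \<open>q\<close> at
  \<open>c\<close> isolates \<open>\<gamma> c\<close>.\<close>

lemma resolvents_independent:
  assumes sh: "\<And>c. shift c \<notin> L" and a: "\<And>c. a c \<in> B" "\<And>c. a c \<odot> shift c - e \<in> L" and "finite S"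
  shows "indep_mod L a S"
  unfolding indep_mod_def
proof (intro allI impI ballI)
  fix \<gamma> c assume rel: "(\<Sum>i\<in>S. \<gamma> i \<cdot> a i) \<in> L" and "c \<in> S"
  define P where "P = (\<lambda>T. \<Prod>i\<in>T. [:- i, 1 :: complex:])"
  have P: "P S = [:- i, 1:] * P (S - {i})" if "i \<in> S" for i
    unfolding P_def using \<open>finite S\<close> that by (rule prod.remove)
  define q where "q = (\<Sum>i\<in>S. smult (\<gamma> i) (P (S - {i})))"
  have Lp: "l \<odot> peval p \<in> L" if "l \<in> L" for l p
    using that
    by (induction p)
      (auto simp: mul_add_right unit_right L_B L_0 mul_assoc[symmetric] intro!: L_add L_scale idealizer)
  have "a i \<odot> peval (P S) - peval (P (S - {i})) \<in> L" if "i \<in> S" for i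
  proof -
    have "a i \<odot> peval (P S) - peval (P (S - {i})) = (a i \<odot> shift i - e) \<odot> peval (P (S - {i}))"
      unfolding P[OF that] peval_linear_factor(2) by (simp add: mul_diff_left mul_assoc)
    then show ?thesis using Lp a by simp
  qed
  then have "(\<Sum>i\<in>S. \<gamma> i \<cdot> (a i \<odot> peval (P S) - peval (P (S - {i})))) \<in> L"
    by (auto intro!: L_sum L_scale)
  also have "(\<Sum>i\<in>S. \<gamma> i \<cdot> (a i \<odot> peval (P S) - peval (P (S - {i})))) =
      (\<Sum>i\<in>S. \<gamma> i \<cdot> a i) \<odot> peval (P S) - peval q"
    by (simp add: q_def peval_sum peval_smult scale_right_diff_distrib sum_subtractf mul_sum_left)
  finally have "(\<Sum>i\<in>S. \<gamma> i \<cdot> a i) \<odot> peval (P S) - ((\<Sum>i\<in>S. \<gamma> i \<cdot> a i) \<odot> peval (P S) - peval q) \<in> L"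
    by (rule L_diff[OF Lp[OF rel]])
  then have "peval q \<in> L" by simp
  then have "q = 0" using peval_not_in_L[OF sh] by blast
  have "poly (P (S - {i})) c = 0" if "i \<in> S" "i \<noteq> c" for i
    unfolding P_def poly_prod using \<open>finite S\<close> \<open>c \<in> S\<close> that by auto
  then have "poly q c = \<gamma> c * poly (P (S - {c})) c"
    unfolding q_def poly_sum using \<open>finite S\<close> \<open>c \<in> S\<close> by (subst sum.remove) auto
  moreover have "poly (P (S - {c})) c \<noteq> 0"
    unfolding P_def poly_prod using \<open>finite S\<close> by auto
  ultimately show "\<gamma> c = 0" using \<open>q = 0\<close> by simp
qed

text \<open>Dixmier's version of Schur's lemma: right multiplication by \<open>u\<close> is an endomorphism of the
  simple module \<open>B/L\<close>. If it were not scalar, the vectors \<open>(u - c)\<^sup>-\<^sup>1 e\<close> would be uncountably many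
  independent ones in a space of countable dimension.\<close>

lemma idealizer_scalar:
  assumes cover: "B \<subseteq> (\<Union>n. F n)" and F: "\<And>n::nat. \<exists>T. finite T \<and> F n \<subseteq> span T"
  shows "\<exists>c. u - c \<cdot> e \<in> L"
proof (rule ccontr)
  assume "\<nexists>c. u - c \<cdot> e \<in> L"
  then have sh: "\<And>c. shift c \<notin> L" by (simp add: shift_def)
  then have "\<forall>c. \<exists>a\<in>B. a \<odot> shift c - e \<in> L" using maximal shift_B by blast
  then obtain a where a: "\<And>c. a c \<in> B" "\<And>c. a c \<odot> shift c - e \<in> L" by metis
  have "(UNIV :: complex set) = (\<Union>n. {c. a c \<in> F n})" using cover a(1) by blast
  then have "\<exists>n. infinite {c. a c \<in> F n}"
  proof (rule contrapos_pp)
    assume "\<not> (\<exists>n. infinite {c. a c \<in> F n})"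
    then have "countable (\<Union>n. {c. a c \<in> F n})" by (auto intro: countable_UN countable_finite)
    then show "(UNIV :: complex set) \<noteq> (\<Union>n. {c. a c \<in> F n})" using uncountable_UNIV_complex by metis
  qed
  then obtain n where n: "infinite {c. a c \<in> F n}" by blast
  obtain T where T: "finite T" "F n \<subseteq> span T" using F by blast
  obtain S where S: "S \<subseteq> {c. a c \<in> F n}" "finite S" "card S = Suc (card T)"
    using infinite_arbitrarily_large[OF n] by metis
  have "card S \<le> card T"
  proof (rule indep_mod_card_le[OF S(2) T(1) subspace_L])
    show "indep_mod L a S" using resolvents_independent[OF sh a S(2)] by simp
    fix i assume "i \<in> S"
    then show "\<exists>y\<in>span T. a i - y \<in> L" using S T L_0 by (intro bexI[of _ "a i"]) auto
  qed
  then show False using S by simp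
qed

end

end

section \<open>The density theorem\<close>

locale countable_maximal_left_ideal = maximal_left_ideal scale mul e B L
  for scale :: "complex \<Rightarrow> 'a::ab_group_add \<Rightarrow> 'a"  (infixr \<open>\<cdot>\<close> 75)
    and mul (infixl \<open>\<odot>\<close> 70) and e B L +
  fixes F :: "nat \<Rightarrow> 'a set"
  assumes cover: "B \<subseteq> (\<Union>n. F n)" and F_finite_dim: "\<exists>T. finite T \<and> F n \<subseteq> span T"
begin

text \<open>Jacobson density. If every \<open>b\<close> killing the \<open>u j\<close> with
  \<open>j\<close> in \<open>insert i' I\<close> also killed \<open>u i\<close>, then sending
  \<open>b \<odot> u i'\<close> to \<open>b \<odot> u i\<close>, for \<open>b\<close> killing
  \<open>I\<close>, would define an endomorphism of B/L. It is a scalar \<open>c\<close>, so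
  \<open>u i - c \<cdot> u i'\<close> is killed by everything that kills \<open>I\<close>, against
  the induction hypothesis.\<close>

lemma density:
  assumes "finite I" "i \<notin> I" "\<And>j. j \<in> insert i I \<Longrightarrow> u j \<in> B" "indep_mod L u (insert i I)"
  shows "\<exists>b\<in>B. (\<forall>j\<in>I. b \<odot> u j \<in> L) \<and> b \<odot> u i - e \<in> L"
proof -
  have "\<exists>b\<in>B. (\<forall>j\<in>I. b \<odot> u j \<in> L) \<and> b \<odot> u i \<notin> L"
    using assms
  proof (induction I arbitrary: i u rule: finite_induct)
    case empty
    have "u i \<notin> L" using empty.prems(3) unfolding indep_mod_def
      by (auto dest!: spec[of _ "\<lambda>_. 1"])
    then show ?case using unit_B by (intro bexI[of _ e]) auto
  next
    case (insert i' I)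
    show ?case
    proof (rule ccontr)
      assume "\<not> ?case"
      then have contra: "b \<odot> u i \<in> L" if "b \<in> B" "\<And>j. j \<in> insert i' I \<Longrightarrow> b \<odot> u j \<in> L" for b
        using that by blast
      have uB: "u i \<in> B" "u i' \<in> B" "\<And>j. j \<in> I \<Longrightarrow> u j \<in> B" using insert.prems by auto
      have ind: "indep_mod L u (insert i' I)"
        unfolding indep_mod_def
      proof (intro allI impI ballI)
        fix c j assume c: "(\<Sum>j\<in>insert i' I. c j \<cdot> u j) \<in> L" "j \<in> insert i' I"
        define c' where "c' = (\<lambda>j. if j = i then 0 else c j)"
        have "(\<Sum>j\<in>insert i (insert i' I). c' j \<cdot> u j) = (\<Sum>j\<in>insert i' I. c j \<cdot> u j)"
          using insert.hyps insert.prems(1) by (subst sum.insert) (auto simp: c'_def intro!: sum.cong)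
        then have "\<forall>j\<in>insert i (insert i' I). c' j = 0"
          using c(1) insert.prems(3) unfolding indep_mod_def by metis
        then show "c j = 0" using c(2) insert.prems(1) by (auto simp: c'_def split: if_splits)
      qed
      obtain b' where b': "b' \<in> B" "\<And>j. j \<in> I \<Longrightarrow> b' \<odot> u j \<in> L" "b' \<odot> u i' \<notin> L"
        using insert.IH[of i' u] insert.hyps uB ind by blast
      obtain a where a: "a \<in> B" "a \<odot> (b' \<odot> u i') - e \<in> L" using maximal b' uB mul_B by blast
      define b0 where "b0 = a \<odot> b'"
      have b0: "b0 \<in> B" "\<And>j. j \<in> I \<Longrightarrow> b0 \<odot> u j \<in> L" "b0 \<odot> u i' - e \<in> L"
        using a b' by (auto simp: b0_def mul_assoc intro: mul_B L_mul)
      \<comment> \<open>The image of \<open>e\<close> under that endomorphism, since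
        \<open>b0 \<odot> u i'\<close> is \<open>e\<close> modulo \<open>L\<close>.\<close>
      define u' where "u' = b0 \<odot> u i"
      have u'B: "u' \<in> B" using b0 uB by (simp add: u'_def mul_B)
      have ideal: "l \<odot> u' \<in> L" if "l \<in> L" for l
      proof -
        have lB: "l \<in> B" using that L_B by blast
        have "l \<odot> b0 \<odot> u i = l \<odot> u'" by (simp add: u'_def mul_assoc)
        moreover have "l \<odot> b0 \<odot> u i' \<in> L"
        proof -
          have "l \<odot> (b0 \<odot> u i' - e) + l \<in> L" using that lB b0 by (intro L_add L_mul)
          then show ?thesis using lB by (simp add: mul_diff_right unit_right mul_assoc)
        qed
        moreover have "l \<odot> b0 \<odot> u j \<in> L" if "j \<in> I" for j
          using that lB b0 by (simp add: mul_assoc L_mul)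
        ultimately show ?thesis using contra[of "l \<odot> b0"] lB b0 mul_B by (metis insert_iff)
      qed
      obtain c where c: "u' - c \<cdot> e \<in> L" using idealizer_scalar[OF u'B ideal cover F_finite_dim] by blast
      define w where "w = u(i := u i - c \<cdot> u i')"
      have ni: "i \<noteq> i'" "i \<notin> I" using insert.prems(1) by auto
      have kill: "b \<odot> w i \<in> L" if b: "b \<in> B" "\<And>j. j \<in> I \<Longrightarrow> b \<odot> u j \<in> L" for b
      proof -
        define y where "y = b \<odot> u i'"
        have yB: "y \<in> B" using b uB mul_B by (simp add: y_def)
        have "(b - y \<odot> b0) \<odot> u i \<in> L"
        proof (rule contra)
          show "b - y \<odot> b0 \<in> B" using b yB b0 by (intro B_diff mul_B)
          fix j assume "j \<in> insert i' I"
          then consider "j = i'" | "j \<in> I" by blast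
          then show "(b - y \<odot> b0) \<odot> u j \<in> L"
          proof cases
            case 1
            have "(b - y \<odot> b0) \<odot> u i' = - (y \<odot> (b0 \<odot> u i' - e))"
              using yB by (simp add: mul_diff_left mul_diff_right unit_right mul_assoc y_def[symmetric])
            then show ?thesis using 1 b0 yB by (simp add: L_neg L_mul)
          next
            case 2
            then show ?thesis using b b0 yB by (simp add: mul_diff_left mul_assoc L_diff L_mul)
          qed
        qed
        moreover have "y \<odot> (u' - c \<cdot> e) \<in> L" using c yB L_mul by blast
        ultimately have "(b - y \<odot> b0) \<odot> u i + y \<odot> (u' - c \<cdot> e) \<in> L" by (rule L_add)
        also have "(b - y \<odot> b0) \<odot> u i + y \<odot> (u' - c \<cdot> e) = b \<odot> w i"
          using ni by (simp add: w_def mul_diff_left mul_diff_right unit_right[OF uB(2)] u'_def mul_assoc y_def)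
        finally show ?thesis .
      qed
      have indw: "indep_mod L w (insert i I)"
        unfolding indep_mod_def
      proof (intro allI impI)
        fix d assume d: "(\<Sum>j\<in>insert i I. d j \<cdot> w j) \<in> L"
        define d' where "d' = d(i' := - (d i * c))"
        have "(\<Sum>j\<in>I. d j \<cdot> w j) = (\<Sum>j\<in>I. d' j \<cdot> u j)"
          using ni insert.hyps by (intro sum.cong) (auto simp: w_def d'_def)
        then have "(\<Sum>j\<in>insert i I. d j \<cdot> w j) = (\<Sum>j\<in>insert i (insert i' I). d' j \<cdot> u j)"
          using insert.hyps ni by (simp add: w_def d'_def scale_right_diff_distrib scale_minus_left)
        then have "\<forall>j\<in>insert i (insert i' I). d' j = 0"
          using d insert.prems(3) unfolding indep_mod_def by metis
        then show "\<forall>j\<in>insert i I. d j = 0" using insert.hyps ni by (auto simp: d'_def split: if_splits)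
      qed
      have "w j \<in> B" if "j \<in> insert i I" for j
        using that uB by (auto simp: w_def intro!: B_diff B_scale)
      then obtain b where b: "b \<in> B" "\<forall>j\<in>I. b \<odot> w j \<in> L" "b \<odot> w i \<notin> L"
        using insert.IH[of i w] indw ni by blast
      have "b \<odot> u j \<in> L" if "j \<in> I" for j
      proof -
        have "j \<noteq> i" using that ni by blast
        then show ?thesis using b(2) that by (auto simp: w_def)
      qed
      then show False using kill b by blast
    qed
  qed
  then obtain b where b: "b \<in> B" "\<And>j. j \<in> I \<Longrightarrow> b \<odot> u j \<in> L" "b \<odot> u i \<notin> L" by blast
  have "b \<odot> u i \<in> B" using b(1) assms(3)[of i] mul_B by blast
  then obtain a where a: "a \<in> B" "a \<odot> (b \<odot> u i) - e \<in> L" using maximal b(3) by blast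
  then show ?thesis using b by (intro bexI[of _ "a \<odot> b"]) (auto simp: mul_assoc intro: mul_B L_mul)
qed

lemma dual_family:
  assumes "finite I" "\<And>j. j \<in> I \<Longrightarrow> u j \<in> B" "indep_mod L u I"
  shows "\<exists>b. (\<forall>i\<in>I. b i \<in> B) \<and> (\<forall>i\<in>I. \<forall>j\<in>I. b i \<odot> u j - (if i = j then e else 0) \<in> L)"
proof -
  have "\<exists>b\<in>B. \<forall>j\<in>I. b \<odot> u j - (if i = j then e else 0) \<in> L" if "i \<in> I" for i
  proof -
    have "insert i (I - {i}) = I" using that by blast
    then obtain b where "b \<in> B" "\<forall>j\<in>I-{i}. b \<odot> u j \<in> L" "b \<odot> u i - e \<in> L"
      using density[of "I - {i}" i u] assms by auto
    then show ?thesis by (intro bexI[of _ b]) auto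
  qed
  then show ?thesis by metis
qed

end

context unital_subalgebra begin

text \<open>Entries outside the block are zero, so that the lift to polynomials lands in
  \<open>poly_matrices N\<close>.\<close>

definition matrix_rep :: "nat \<Rightarrow> ('a \<Rightarrow> nat \<Rightarrow> nat \<Rightarrow> complex) \<Rightarrow> bool"
  where "matrix_rep N \<rho> \<longleftrightarrow>
    (\<forall>a\<in>B. \<forall>b\<in>B. \<forall>i j. \<rho> (a + b) i j = \<rho> a i j + \<rho> b i j) \<and>
    (\<forall>a\<in>B. \<forall>c i j. \<rho> (c \<cdot> a) i j = c * \<rho> a i j) \<and>
    (\<forall>a\<in>B. \<forall>b\<in>B. \<forall>i j. \<rho> (a \<odot> b) i j = (\<Sum>l<N. \<rho> a i l * \<rho> b l j)) \<and>
    (\<forall>i j. \<rho> e i j = (if i = j \<and> i < N then 1 else 0)) \<and>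
    (\<forall>a\<in>B. \<forall>i j. \<not> (i < N \<and> j < N) \<longrightarrow> \<rho> a i j = 0)"

lemma indep_mod_subset:
  assumes "indep_mod L x I" "J \<subseteq> I" "finite I"
  shows "indep_mod L x J"
  unfolding indep_mod_def
proof (intro allI impI ballI)
  fix c j assume c: "(\<Sum>i\<in>J. c i \<cdot> x i) \<in> L" "j \<in> J"
  have "(\<Sum>i\<in>I. (if i \<in> J then c i else 0) \<cdot> x i) = (\<Sum>i\<in>J. (if i \<in> J then c i else 0) \<cdot> x i)"
    using assms by (intro sum.mono_neutral_right) auto
  also have "\<dots> = (\<Sum>i\<in>J. c i \<cdot> x i)" by simp
  finally have "\<forall>i\<in>I. (if i \<in> J then c i else 0) = 0"
    using assms(1)[unfolded indep_mod_def, rule_format, of "\<lambda>i. if i \<in> J then c i else 0"] c(1) by simp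
  then show "c j = 0" using c(2) assms(2) by (metis subsetD)
qed

end

context countable_maximal_left_ideal begin

text \<open>\<open>N\<close> is the dimension of B/L and \<open>\<rho> a\<close> the matrix of left
  multiplication by \<open>a\<close> in a basis \<open>u\<close>. Uniqueness of coordinates gives
  the homomorphism laws; a dual family gives surjectivity.\<close>

lemma finite_dim_quotient_rep:
  assumes bounded: "\<And>m u. (\<And>i. i < m \<Longrightarrow> u i \<in> B) \<Longrightarrow> indep_mod L u {..<m::nat} \<Longrightarrow> m \<le> M"
  shows "\<exists>N\<ge>1. \<exists>\<rho>. matrix_rep N \<rho> \<and> (\<forall>A. \<exists>b\<in>B. \<forall>i<N. \<forall>j<N. \<rho> b i j = A i j)"
proof -
  define P where "P = (\<lambda>m. \<exists>u. (\<forall>i<m. u i \<in> B) \<and> indep_mod L u {..<m::nat})"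
  define N where "N = (GREATEST m. P m)"
  have bd: "m \<le> M" if "P m" for m using that bounded unfolding P_def by blast
  have "P 1"
    unfolding P_def
  proof (intro exI[of _ "\<lambda>_. e"] conjI)
    show "indep_mod L (\<lambda>_. e) {..<1::nat}"
      unfolding indep_mod_def
    proof (intro allI impI ballI)
      fix c :: "nat \<Rightarrow> complex" and i :: nat assume "(\<Sum>i<1. c i \<cdot> e) \<in> L" and "i \<in> {..<1}"
      then have c: "c 0 \<cdot> e \<in> L" and "i = 0" by auto
      have "(1 / c 0) \<cdot> (c 0 \<cdot> e) \<in> L" using c by (rule L_scale)
      then show "c i = 0" using proper \<open>i = 0\<close> by (cases "c 0 = 0") auto
    qed
  qed (use unit_B in auto)
  then have "P N" and "1 \<le> N" unfolding N_def
    using GreatestI_nat[of P 1 M] Greatest_le_nat[of P 1 M] bd by auto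
  have maxN: "\<not> P (Suc N)" using Greatest_le_nat[of P "Suc N" M] bd unfolding N_def by force
  obtain u where u: "\<And>i. i < N \<Longrightarrow> u i \<in> B" "indep_mod L u {..<N}" using \<open>P N\<close> unfolding P_def by blast
  obtain b where "\<forall>i\<in>{..<N}. b i \<in> B"
    "\<forall>i\<in>{..<N}. \<forall>j\<in>{..<N}. b i \<odot> u j - (if i = j then e else 0) \<in> L"
    using dual_family[OF finite_lessThan _ u(2)] u(1) by blast
  then have b: "\<And>i. i < N \<Longrightarrow> b i \<in> B"
    "\<And>i j. i < N \<Longrightarrow> j < N \<Longrightarrow> b i \<odot> u j - (if i = j then e else 0) \<in> L" by auto
  have span: "\<exists>c. x - (\<Sum>i<N. c i \<cdot> u i) \<in> L" if "x \<in> B" for x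
  proof -
    have "\<not> indep_mod L (u(N := x)) {..<Suc N}"
      using maxN u(1) that unfolding P_def by (metis fun_upd_apply less_SucE)
    then obtain c i where c: "(\<Sum>i<Suc N. c i \<cdot> (u(N := x)) i) \<in> L" "i < Suc N" "c i \<noteq> 0"
      unfolding indep_mod_def by auto
    have s: "(\<Sum>i<N. c i \<cdot> u i) + c N \<cdot> x \<in> L" using c(1) by simp
    have "c N \<noteq> 0"
    proof
      assume "c N = 0"
      then have "\<forall>i\<in>{..<N}. c i = 0" using s u(2) unfolding indep_mod_def by simp
      then show False using c \<open>c N = 0\<close> by (metis lessThan_iff less_SucE)
    qed
    have "(1 / c N) \<cdot> ((\<Sum>i<N. c i \<cdot> u i) + c N \<cdot> x) \<in> L" using s by (rule L_scale)
    also have "(1 / c N) \<cdot> ((\<Sum>i<N. c i \<cdot> u i) + c N \<cdot> x) = x - (\<Sum>i<N. (- c i / c N) \<cdot> u i)"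
      using \<open>c N \<noteq> 0\<close> by (simp add: scale_right_distrib scale_sum_right scale_minus_left sum_negf)
    finally show ?thesis by (intro exI[of _ "\<lambda>i. - c i / c N"])
  qed
  define co where "co = (\<lambda>x. SOME c. x - (\<Sum>i<N. c i \<cdot> u i) \<in> L)"
  have co: "x - (\<Sum>i<N. co x i \<cdot> u i) \<in> L" if "x \<in> B" for x
    unfolding co_def using span[OF that] by (rule someI_ex)
  have coI: "co x i = c i" if "x \<in> B" "x - (\<Sum>i<N. c i \<cdot> u i) \<in> L" "i < N" for x c i
  proof -
    have "(x - (\<Sum>i<N. c i \<cdot> u i)) - (x - (\<Sum>i<N. co x i \<cdot> u i)) \<in> L"
      using that(2) co[OF that(1)] by (rule L_diff)
    then have "(\<Sum>i<N. (co x i - c i) \<cdot> u i) \<in> L"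
      by (simp add: scale_left_diff_distrib sum_subtractf)
    then have "\<forall>i\<in>{..<N}. co x i - c i = 0" using u(2)[unfolded indep_mod_def, rule_format, of "\<lambda>i. co x i - c i"] by blast
    then show ?thesis using that(3) by simp
  qed
  define \<rho> where "\<rho> = (\<lambda>a i j. if i < N \<and> j < N then co (a \<odot> u j) i else 0)"
  have rep: "a \<odot> u j - (\<Sum>i<N. \<rho> a i j \<cdot> u i) \<in> L" if "a \<in> B" "j < N" for a j
  proof -
    have "(\<Sum>i<N. \<rho> a i j \<cdot> u i) = (\<Sum>i<N. co (a \<odot> u j) i \<cdot> u i)" using that by (simp add: \<rho>_def)
    then show ?thesis using co[of "a \<odot> u j"] that u(1) mul_B by simp
  qed
  have repI: "\<rho> a i j = c i" if "a \<in> B" "j < N" "i < N" "a \<odot> u j - (\<Sum>i<N. c i \<cdot> u i) \<in> L" for a i j c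
    using coI[of "a \<odot> u j" c i] that u(1) mul_B by (simp add: \<rho>_def)
  have "matrix_rep N \<rho>"
    unfolding matrix_rep_def
  proof (intro conjI ballI allI impI)
    fix a i j assume "a \<in> B" "\<not> (i < N \<and> j < N)" then show "\<rho> a i j = 0" by (auto simp: \<rho>_def)
  next
    fix a a' i j assume a: "a \<in> B" "a' \<in> B"
    show "\<rho> (a + a') i j = \<rho> a i j + \<rho> a' i j"
    proof (cases "i < N \<and> j < N")
      case True
      have "(a \<odot> u j - (\<Sum>i<N. \<rho> a i j \<cdot> u i)) + (a' \<odot> u j - (\<Sum>i<N. \<rho> a' i j \<cdot> u i)) \<in> L"
        using a True by (intro L_add rep) auto
      then have "(a + a') \<odot> u j - (\<Sum>i<N. (\<rho> a i j + \<rho> a' i j) \<cdot> u i) \<in> L"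
        by (simp add: mul_add_left scale_left_distrib sum.distrib algebra_simps)
      then show ?thesis using repI[of "a + a'" j i "\<lambda>i. \<rho> a i j + \<rho> a' i j"] True a B_add by blast
    qed (auto simp: \<rho>_def)
  next
    fix a c i j assume a: "a \<in> B"
    show "\<rho> (c \<cdot> a) i j = c * \<rho> a i j"
    proof (cases "i < N \<and> j < N")
      case True
      have "c \<cdot> (a \<odot> u j - (\<Sum>i<N. \<rho> a i j \<cdot> u i)) \<in> L"
        using a True by (intro L_scale rep) auto
      then have "(c \<cdot> a) \<odot> u j - (\<Sum>i<N. (c * \<rho> a i j) \<cdot> u i) \<in> L"
        by (simp add: scale_right_diff_distrib scale_sum_right)
      then show ?thesis using repI[of "c \<cdot> a" j i "\<lambda>i. c * \<rho> a i j"] True a B_scale by blast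
    qed (auto simp: \<rho>_def)
  next
    fix i j
    show "\<rho> e i j = (if i = j \<and> i < N then 1 else 0)"
    proof (cases "i < N \<and> j < N")
      case True
      have "(\<Sum>i<N. (if i = j then 1 else 0) \<cdot> u i) = (\<Sum>i<N. if i = j then u i else 0)"
        by (intro sum.cong) auto
      then have "e \<odot> u j - (\<Sum>i<N. (if i = j then 1 else 0) \<cdot> u i) \<in> L"
        using True L_0 by simp
      then show ?thesis using repI[of e j i "\<lambda>i. if i = j then 1 else 0"] True unit_B by auto
    qed (auto simp: \<rho>_def)
  next
    fix a a' i j assume a: "a \<in> B" "a' \<in> B"
    show "\<rho> (a \<odot> a') i j = (\<Sum>l<N. \<rho> a i l * \<rho> a' l j)"
    proof (cases "i < N \<and> j < N")
      case True
      have 1: "a \<odot> (a' \<odot> u j - (\<Sum>l<N. \<rho> a' l j \<cdot> u l)) \<in> L"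
        using a True by (intro L_mul rep) auto
      have 2: "(\<Sum>l<N. \<rho> a' l j \<cdot> (a \<odot> u l - (\<Sum>i<N. \<rho> a i l \<cdot> u i))) \<in> L"
        using a by (auto intro!: L_sum L_scale rep)
      have "(\<Sum>l<N. \<Sum>i<N. (\<rho> a' l j * \<rho> a i l) \<cdot> u i) = (\<Sum>i<N. (\<Sum>l<N. \<rho> a i l * \<rho> a' l j) \<cdot> u i)"
        by (subst sum.swap) (simp add: scale_sum_left mult.commute)
      then have "a \<odot> (a' \<odot> u j - (\<Sum>l<N. \<rho> a' l j \<cdot> u l)) +
          (\<Sum>l<N. \<rho> a' l j \<cdot> (a \<odot> u l - (\<Sum>i<N. \<rho> a i l \<cdot> u i))) =
          (a \<odot> a') \<odot> u j - (\<Sum>i<N. (\<Sum>l<N. \<rho> a i l * \<rho> a' l j) \<cdot> u i)"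
        by (simp add: mul_diff_right mul_sum_right scale_right_diff_distrib sum_subtractf scale_sum_right mul_assoc)
      then have "(a \<odot> a') \<odot> u j - (\<Sum>i<N. (\<Sum>l<N. \<rho> a i l * \<rho> a' l j) \<cdot> u i) \<in> L"
        using L_add[OF 1 2] by simp
      then show ?thesis using repI[of "a \<odot> a'" j i "\<lambda>i. \<Sum>l<N. \<rho> a i l * \<rho> a' l j"] True a mul_B by blast
    qed (auto simp: \<rho>_def)
  qed
  moreover have "\<exists>x\<in>B. \<forall>i<N. \<forall>j<N. \<rho> x i j = A i j" for A
  proof -
    \<comment> \<open>Modulo \<open>L\<close>, left multiplication by \<open>u i \<odot> b j\<close>
      is a matrix unit: it sends \<open>u j\<close> to \<open>u i\<close> and the other basis
      vectors to 0.\<close>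
    define x where "x = (\<Sum>i<N. \<Sum>j<N. A i j \<cdot> (u i \<odot> b j))"
    have xB: "x \<in> B" unfolding x_def using u b by (auto intro!: B_sum B_scale mul_B)
    have "\<rho> x i m = A i m" if im: "i < N" "m < N" for i m
    proof (rule repI[OF xB im(2,1)])
      have "(\<Sum>i<N. \<Sum>j<N. A i j \<cdot> (u i \<odot> (b j \<odot> u m - (if j = m then e else 0)))) \<in> L"
        using u b im by (intro L_sum L_scale L_mul) auto
      also have "(\<Sum>i<N. \<Sum>j<N. A i j \<cdot> (u i \<odot> (b j \<odot> u m - (if j = m then e else 0)))) =
          x \<odot> u m - (\<Sum>i<N. \<Sum>j<N. A i j \<cdot> (u i \<odot> (if j = m then e else 0)))"
        by (simp add: x_def mul_sum_left mul_assoc mul_diff_right scale_right_diff_distrib sum_subtractf)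
      also have "(\<Sum>i<N. \<Sum>j<N. A i j \<cdot> (u i \<odot> (if j = m then e else 0))) = (\<Sum>i<N. A i m \<cdot> u i)"
      proof (rule sum.cong)
        fix i assume "i \<in> {..<N}"
        have "(\<Sum>j<N. A i j \<cdot> (u i \<odot> (if j = m then e else 0))) = (\<Sum>j<N. if j = m then A i m \<cdot> u i else 0)"
          using \<open>i \<in> {..<N}\<close> u unit_right by (intro sum.cong) auto
        then show "(\<Sum>j<N. A i j \<cdot> (u i \<odot> (if j = m then e else 0))) = A i m \<cdot> u i" using im by simp
      qed simp
      finally show "x \<odot> u m - (\<Sum>i<N. A i m \<cdot> u i) \<in> L" .
    qed
    with xB show ?thesis by blast
  qed
  ultimately show ?thesis using \<open>1 \<le> N\<close> by blast
qed

end

context generated_algebra begin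

text \<open>If the simple module \<open>B/L\<close> had more than \<open>K\<close> independent vectors, density would provide \<open>K + 1\<close>
  elements whose left multiples are independent of each other and grow at least linearly, against the
  growth bound \<open>K * n\<close>.\<close>

lemma simple_module_dim_bounded:
  assumes "countable_maximal_left_ideal scale mul e B L filt"
    and growth: "\<forall>n (I :: (nat \<times> nat) set) x L. finite I \<and> subspace L \<and> indep_mod L x I \<and>
      (\<forall>i\<in>I. x i \<in> filt n) \<longrightarrow> card I \<le> K * (n + 1)"
  shows "\<exists>M. \<forall>m u. (\<forall>i<m. u i \<in> B) \<and> indep_mod L u {..<m::nat} \<longrightarrow> m \<le> M"
proof (rule ccontr)
  interpret countable_maximal_left_ideal scale mul e B L filt by fact
  assume "\<nexists>M. \<forall>m u. (\<forall>i<m. u i \<in> B) \<and> indep_mod L u {..<m::nat} \<longrightarrow> m \<le> M"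
  then have unbounded: "\<exists>m u. (\<forall>i<m. u i \<in> B) \<and> indep_mod L u {..<m::nat} \<and> M < m" for M
    by (meson not_le)
  \<comment> \<open>If \<open>filt (Suc r)\<close> added nothing modulo \<open>L\<close>, then
    \<open>filt r\<close> would already span B/L, whose dimension is unbounded by
    assumption.\<close>
  have step: "\<exists>x\<in>filt (Suc r). \<forall>y\<in>filt r. x - y \<notin> L" for r
  proof (rule ccontr)
    assume "\<not> ?thesis"
    then have red: "\<exists>y\<in>filt r. x - y \<in> L" if "x \<in> filt (Suc r)" for x using that by blast
    have w: "\<exists>y\<in>filt r. word w - y \<in> L" if "w \<in> words" for w using that
    proof (induction w)
      case Nil
      show ?case using unit_filt L_0 by (intro bexI[of _ e]) auto
    next
      case (Cons i w)
      then have i: "i < k" "w \<in> words" by (auto simp: words_def)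
      then obtain y where y: "y \<in> filt r" "word w - y \<in> L" using Cons by blast
      have "v i \<in> filt 1" using word_filt[of "[i]"] i generators by (simp add: words_def unit_right)
      then have "v i \<odot> y \<in> filt (Suc r)" using mul_filt[of "v i" 1 y r] y by simp
      then obtain y' where y': "y' \<in> filt r" "v i \<odot> y - y' \<in> L" using red by blast
      have "v i \<odot> (word w - y) + (v i \<odot> y - y') \<in> L" using y y' i generators by (intro L_add L_mul) auto
      then show ?case using y' by (auto simp: mul_diff_right)
    qed
    have all: "\<exists>y\<in>filt r. x - y \<in> L" if xB: "x \<in> B" for x
    proof -
      obtain n where "x \<in> filt n" using cover xB by blast
      then show ?thesis unfolding filt_def[of n]
      proof (induction rule: span_induct)
        case (step x)
        then show ?case using w by auto
      next
        case base
        show ?case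
        proof (rule subspaceI)
          show "0 \<in> {x. \<exists>y\<in>filt r. x - y \<in> L}" using subspace_0[OF subspace_filt] L_0 by force
        next
          fix x x' assume "x \<in> {x. \<exists>y\<in>filt r. x - y \<in> L}" "x' \<in> {x. \<exists>y\<in>filt r. x - y \<in> L}"
          then obtain y y' where y: "y \<in> filt r" "x - y \<in> L" "y' \<in> filt r" "x' - y' \<in> L" by blast
          then have "(x - y) + (x' - y') \<in> L" by (intro L_add)
          then have "(x + x') - (y + y') \<in> L" by (simp add: algebra_simps)
          then show "x + x' \<in> {x. \<exists>y\<in>filt r. x - y \<in> L}" using y subspace_add[OF subspace_filt] by blast
        next
          fix c x assume "x \<in> {x. \<exists>y\<in>filt r. x - y \<in> L}"
          then obtain y where y: "y \<in> filt r" "x - y \<in> L" by blast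
          then have "c \<cdot> x - c \<cdot> y \<in> L" using L_scale[OF y(2), of c] by (simp add: scale_right_diff_distrib)
          then show "c \<cdot> x \<in> {x. \<exists>y\<in>filt r. x - y \<in> L}" using y subspace_scale[OF subspace_filt] by blast
        qed
      qed
    qed
    obtain T where T: "finite T" "filt r \<subseteq> span T" using F_finite_dim by blast
    obtain m u where mu: "\<And>i. i < m \<Longrightarrow> u i \<in> B" "indep_mod L u {..<m::nat}" "card T < m" using unbounded by blast
    have "card {..<m} \<le> card T"
    proof (rule indep_mod_card_le[OF _ T(1) subspace_L mu(2)])
      fix i assume "i \<in> {..<m}"
      then show "\<exists>y\<in>span T. u i - y \<in> L" using mu(1)[of i] all[of "u i"] T(2) by blast
    qed simp
    with mu(3) show False by simp
  qed
  obtain f where f: "\<And>r. f r \<in> filt (Suc r)" "\<And>r y. y \<in> filt r \<Longrightarrow> f r - y \<notin> L"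
    using step by metis
  \<comment> \<open>One vector in each filtration degree, independent modulo \<open>L\<close> of
    those of lower degree.\<close>
  define w where "w = (\<lambda>p. case p of 0 \<Rightarrow> e | Suc r \<Rightarrow> f r)"
  have w_filt: "w p \<in> filt p" for p
    using f unit_filt by (auto simp: w_def split: nat.split)
  have w_indep: "\<forall>p\<le>r. c p = 0" if "(\<Sum>p\<le>r. c p \<cdot> w p) \<in> L" for r c
    using that
  proof (induction r)
    case 0
    then have "c 0 \<cdot> e \<in> L" by (simp add: w_def)
    then have "(1 / c 0) \<cdot> (c 0 \<cdot> e) \<in> L" by (rule L_scale)
    then show ?case using proper by (cases "c 0 = 0") auto
  next
    case (Suc r)
    have "c (Suc r) = 0"
    proof (rule ccontr)
      assume nz: "c (Suc r) \<noteq> 0"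
      define y where "y = - (\<Sum>p\<le>r. (c p / c (Suc r)) \<cdot> w p)"
      have "y \<in> filt r" unfolding y_def
        using w_filt filt_mono by (intro subspace_neg subspace_sum subspace_scale subspace_filt) auto
      moreover have "(1 / c (Suc r)) \<cdot> (\<Sum>p\<le>Suc r. c p \<cdot> w p) \<in> L" using Suc.prems by (rule L_scale)
      moreover have "(1 / c (Suc r)) \<cdot> (\<Sum>p\<le>Suc r. c p \<cdot> w p) = f r - y"
        using nz by (simp add: y_def scale_right_distrib scale_sum_right w_def add.commute)
      ultimately show False using f(2) by simp
    qed
    then show ?case using Suc by (auto simp: le_Suc_eq)
  qed
  obtain m u where mu: "\<And>i. i < m \<Longrightarrow> u i \<in> B" "indep_mod L u {..<m::nat}" "K < m" using unbounded by blast
  have ind: "indep_mod L u {..<Suc K}" using mu by (intro indep_mod_subset[OF mu(2)]) auto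
  have "u i \<in> B" if "i \<in> {..<Suc K}" for i using mu(1,3) that by simp
  then obtain b where "\<forall>i\<in>{..<Suc K}. b i \<in> B"
    "\<forall>i\<in>{..<Suc K}. \<forall>j\<in>{..<Suc K}. b i \<odot> u j - (if i = j then e else 0) \<in> L"
    using dual_family[OF finite_lessThan _ ind] by blast
  then have b: "\<And>i. i < Suc K \<Longrightarrow> b i \<in> B"
    "\<And>i j. i < Suc K \<Longrightarrow> j < Suc K \<Longrightarrow> b i \<odot> u j - (if i = j then e else 0) \<in> L" by auto
  have "\<exists>d. \<forall>i<Suc K. b i \<in> filt d"
  proof -
    have "\<forall>i. \<exists>d. i < Suc K \<longrightarrow> b i \<in> filt d" using b(1) cover by blast
    then obtain D where D: "\<And>i. i < Suc K \<Longrightarrow> b i \<in> filt (D i)" by metis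
    have "D i \<le> (\<Sum>i<Suc K. D i)" if "i < Suc K" for i using that by (intro member_le_sum) auto
    then show ?thesis using D filt_mono by blast
  qed
  then obtain d where d: "\<And>i. i < Suc K \<Longrightarrow> b i \<in> filt d" by blast
  \<comment> \<open>The products \<open>w p \<odot> b i\<close> number (r+1)(K+1) and lie in
    \<open>filt (r + d)\<close>; for r = K d this exceeds the bound K (r + d + 1) by exactly
    one.\<close>
  define r where "r = K * d"
  define I where "I = {..r} \<times> {..<Suc K}"
  define x where "x = (\<lambda>(p, i). w p \<odot> b i)"
  have "card I \<le> K * (r + d + 1)"
  proof (rule growth[THEN spec, THEN spec, THEN spec, THEN spec, THEN mp], intro conjI ballI)
    show "finite I" by (simp add: I_def)
    show "subspace {0}" by (rule subspace_single_0)
    show "x q \<in> filt (r + d)" if qI: "q \<in> I" for q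
    proof -
      obtain p i where q: "q = (p, i)" "p \<le> r" "i < Suc K" using qI by (auto simp: I_def)
      then have "w p \<in> filt r" using w_filt filt_mono by blast
      then show ?thesis using q d mul_filt by (simp add: x_def)
    qed
    show "indep_mod {0} x I"
      unfolding indep_mod_def
    proof (intro allI impI ballI)
      fix c q assume c: "(\<Sum>q\<in>I. c q \<cdot> x q) \<in> {0}" and "q \<in> I"
      then obtain p j where q: "q = (p, j)" "p \<le> r" "j < Suc K" by (auto simp: I_def)
      have sum: "(\<Sum>p\<le>r. \<Sum>i<Suc K. c (p, i) \<cdot> (w p \<odot> b i)) = 0"
        using c by (simp add: I_def x_def sum.cartesian_product case_prod_unfold del: sum.lessThan_Suc)
      have wB: "w p \<in> B" for p using w_filt filt_B by blast
      \<comment> \<open>Right multiplication by \<open>u j\<close> turns \<open>b i\<close> into a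
        Kronecker delta modulo \<open>L\<close>, leaving a relation among the
        \<open>w p\<close>.\<close>
      have "(\<Sum>p\<le>r. \<Sum>i<Suc K. c (p, i) \<cdot> (w p \<odot> (b i \<odot> u j - (if i = j then e else 0)))) \<in> L"
        using b(2) q(3) wB by (intro L_sum L_scale L_mul) auto
      also have "(\<Sum>p\<le>r. \<Sum>i<Suc K. c (p, i) \<cdot> (w p \<odot> (b i \<odot> u j - (if i = j then e else 0)))) =
          (\<Sum>p\<le>r. \<Sum>i<Suc K. c (p, i) \<cdot> (w p \<odot> b i)) \<odot> u j -
          (\<Sum>p\<le>r. \<Sum>i<Suc K. c (p, i) \<cdot> (w p \<odot> (if i = j then e else 0)))"
        by (simp add: mul_sum_left mul_assoc mul_diff_right scale_right_diff_distrib sum_subtractf del: sum.lessThan_Suc)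
      also have "(\<Sum>p\<le>r. \<Sum>i<Suc K. c (p, i) \<cdot> (w p \<odot> (if i = j then e else 0))) = (\<Sum>p\<le>r. c (p, j) \<cdot> w p)"
      proof (rule sum.cong)
        fix p assume "p \<in> {..r}"
        have "(\<Sum>i<Suc K. c (p, i) \<cdot> (w p \<odot> (if i = j then e else 0))) =
            (\<Sum>i<Suc K. if i = j then c (p, j) \<cdot> w p else 0)"
          using wB unit_right by (intro sum.cong) auto
        then show "(\<Sum>i<Suc K. c (p, i) \<cdot> (w p \<odot> (if i = j then e else 0))) = c (p, j) \<cdot> w p"
          using q(3) by (simp del: sum.lessThan_Suc)
      qed simp
      finally have "- (\<Sum>p\<le>r. c (p, j) \<cdot> w p) \<in> L" unfolding sum by simp
      then have "- (- (\<Sum>p\<le>r. c (p, j) \<cdot> w p)) \<in> L" by (rule L_neg)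
      then show "c q = 0" using w_indep[of "\<lambda>p. c (p, j)" r] q by simp
    qed
  qed
  moreover have "card I = Suc r * Suc K" by (simp add: I_def)
  ultimately show False by (simp add: r_def algebra_simps)
qed

theorem matrix_rep_exists:
  assumes gen: "B \<subseteq> (\<Union>n. filt n)"
    and growth: "\<And>X. finite X \<Longrightarrow> X \<subseteq> filt n \<Longrightarrow> independent X \<Longrightarrow> 2 * card X < n * n"
  shows "\<exists>N\<ge>1. \<exists>\<rho>. matrix_rep N \<rho> \<and> (\<forall>A. \<exists>b\<in>B. \<forall>i<N. \<forall>j<N. \<rho> b i j = A i j)"
proof -
  obtain L where L: "left_ideal L" "e \<notin> L" "\<forall>b\<in>B - L. \<exists>a\<in>B. a \<odot> b - e \<in> L"
    using maximal_left_ideal_exists by blast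
  have fin: "\<exists>T. finite T \<and> filt n \<subseteq> span T" for n
    using finite_words unfolding filt_def by blast
  interpret countable_maximal_left_ideal scale mul e B L filt
    by unfold_locales (use L gen fin in auto)
  obtain K where K: "\<forall>n (I :: (nat \<times> nat) set) x L. finite I \<and> subspace L \<and> indep_mod L x I \<and>
      (\<forall>i\<in>I. x i \<in> filt n) \<longrightarrow> card I \<le> K * (n + 1)"
    using subquadratic_growth_linear[OF growth] by blast
  obtain M where "\<forall>m u. (\<forall>i<m. u i \<in> B) \<and> indep_mod L u {..<m::nat} \<longrightarrow> m \<le> M"
    using simple_module_dim_bounded[OF countable_maximal_left_ideal_axioms K] by blast
  then show ?thesis by (intro finite_dim_quotient_rep[of M]) blast
qed

end

section \<open>Differentially simple algebras\<close>

locale diff_algebra = unital_subalgebra scale mul e B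
  for scale :: "complex \<Rightarrow> 'a::ab_group_add \<Rightarrow> 'a"  (infixr \<open>\<cdot>\<close> 75)
    and mul (infixl \<open>\<odot>\<close> 70) and e B +
  fixes D :: "'a \<Rightarrow> 'a"
  assumes D_add: "D (a + b) = D a + D b"
    and D_scale: "D (c \<cdot> a) = c \<cdot> D a"
    and D_B: "a \<in> B \<Longrightarrow> D a \<in> B"
    and D_mul: "a \<in> B \<Longrightarrow> b \<in> B \<Longrightarrow> D (a \<odot> b) = D a \<odot> b + a \<odot> D b"
    and D_nilpotent: "a \<in> B \<Longrightarrow> \<exists>n. (D ^^ n) a = 0"
    and D_simple: "subspace J \<Longrightarrow> J \<subseteq> B \<Longrightarrow> (\<And>a j. a \<in> B \<Longrightarrow> j \<in> J \<Longrightarrow> a \<odot> j \<in> J \<and> j \<odot> a \<in> J) \<Longrightarrow>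
      (\<And>j. j \<in> J \<Longrightarrow> D j \<in> J) \<Longrightarrow> J = {0} \<or> J = B"
begin

lemma D_0 [simp]: "D 0 = 0" using D_add[of 0 0] by simp

lemma D_unit [simp]: "D e = 0"
  using D_mul[OF unit_B unit_B] unit_right[OF D_B[OF unit_B]] by simp

lemma D_diff: "D (a - b) = D a - D b" using D_add[of "a - b" b] by simp

lemma D_pow_0 [simp]: "(D ^^ n) 0 = 0" by (induction n) simp_all

lemma D_pow_B: "a \<in> B \<Longrightarrow> (D ^^ n) a \<in> B" by (induction n) (simp_all add: D_B)

lemma D_pow_add: "(D ^^ n) (a + b) = (D ^^ n) a + (D ^^ n) b"
  by (induction n) (simp_all add: D_add)

lemma D_pow_scale: "(D ^^ n) (c \<cdot> a) = c \<cdot> (D ^^ n) a"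
  by (induction n) (simp_all add: D_scale)

lemma D_sum: "D (sum f I) = (\<Sum>i\<in>I. D (f i))"
  by (induction I rule: infinite_finite_induct) (simp_all add: D_add)

lemma D_nilpotent_above: "a \<in> B \<Longrightarrow> \<exists>n. \<forall>k\<ge>n. (D ^^ k) a = 0"
proof -
  assume "a \<in> B"
  then obtain n where n: "(D ^^ n) a = 0" using D_nilpotent by blast
  have "(D ^^ k) a = 0" if "n \<le> k" for k
  proof -
    have "(D ^^ k) a = (D ^^ (k - n)) ((D ^^ n) a)" using that by (simp flip: funpow_add[unfolded comp_def, THEN fun_cong])
    then show ?thesis using n by simp
  qed
  then show ?thesis by blast
qed

lemma D_Leibniz:
  assumes "a \<in> B" "b \<in> B"
  shows "(D ^^ k) (a \<odot> b) = (\<Sum>m\<le>k. of_nat (k choose m) \<cdot> ((D ^^ m) a \<odot> (D ^^ (k - m)) b))"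
proof (induction k)
  case (Suc k)
  define g where "g = (\<lambda>m l. (D ^^ m) a \<odot> (D ^^ l) b)"
  have Dg: "D ((D ^^ m) a \<odot> (D ^^ l) b) = g (Suc m) l + g m (Suc l)" for m l
    using assms by (simp add: g_def D_mul D_pow_B)
  have "(D ^^ Suc k) (a \<odot> b) = (\<Sum>m\<le>k. of_nat (k choose m) \<cdot> D ((D ^^ m) a \<odot> (D ^^ (k - m)) b))"
    by (simp add: Suc D_sum D_scale)
  also have "\<dots> = (\<Sum>m\<le>k. of_nat (k choose m) \<cdot> (g (Suc m) (k - m) + g m (Suc k - m)))"
    by (intro sum.cong refl) (simp add: Dg Suc_diff_le)
  also have "\<dots> = (\<Sum>m\<le>k. of_nat (k choose m) \<cdot> g (Suc m) (k - m)) + (\<Sum>m\<le>k. of_nat (k choose m) \<cdot> g m (Suc k - m))"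
    by (simp add: scale_right_distrib sum.distrib)
  also have "(\<Sum>m\<le>k. of_nat (k choose m) \<cdot> g m (Suc k - m)) =
      (\<Sum>m\<le>Suc k. of_nat (k choose m) \<cdot> g m (Suc k - m))" by simp
  also have "\<dots> = g 0 (Suc k) + (\<Sum>m\<le>k. of_nat (k choose Suc m) \<cdot> g (Suc m) (k - m))"
    by (subst sum.atMost_Suc_shift) simp
  also have "(\<Sum>m\<le>k. of_nat (k choose m) \<cdot> g (Suc m) (k - m)) +
      (g 0 (Suc k) + (\<Sum>m\<le>k. of_nat (k choose Suc m) \<cdot> g (Suc m) (k - m))) =
      g 0 (Suc k) + (\<Sum>m\<le>k. of_nat (Suc k choose Suc m) \<cdot> g (Suc m) (k - m))"
    by (simp add: scale_left_distrib sum.distrib add_ac)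
  also have "\<dots> = (\<Sum>m\<le>Suc k. of_nat (Suc k choose m) \<cdot> g m (Suc k - m))"
    unfolding sum.atMost_Suc_shift[of "\<lambda>m. of_nat (Suc k choose m) \<cdot> g m (Suc k - m)" k] by simp
  finally show ?case by (simp only: g_def)
qed simp

end

section \<open>Matrices over \<complex>[x] by Taylor expansion\<close>

locale diff_algebra_rep = diff_algebra scale mul e B D
  for scale :: "complex \<Rightarrow> 'a::ab_group_add \<Rightarrow> 'a"  (infixr \<open>\<cdot>\<close> 75)
    and mul (infixl \<open>\<odot>\<close> 70) and e B D +
  fixes N :: nat and \<rho> :: "'a \<Rightarrow> nat \<Rightarrow> nat \<Rightarrow> complex"
  assumes rep: "matrix_rep N \<rho>" and N_pos: "1 \<le> N"
    and rep_onto: "\<exists>b\<in>B. \<forall>i<N. \<forall>j<N. \<rho> b i j = A i j"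
begin

lemma rep_add: "a \<in> B \<Longrightarrow> b \<in> B \<Longrightarrow> \<rho> (a + b) i j = \<rho> a i j + \<rho> b i j"
  using rep unfolding matrix_rep_def by blast

lemma rep_scale: "a \<in> B \<Longrightarrow> \<rho> (c \<cdot> a) i j = c * \<rho> a i j"
  using rep unfolding matrix_rep_def by blast

lemma rep_mul: "a \<in> B \<Longrightarrow> b \<in> B \<Longrightarrow> \<rho> (a \<odot> b) i j = (\<Sum>l<N. \<rho> a i l * \<rho> b l j)"
  using rep unfolding matrix_rep_def by blast

lemma rep_unit: "\<rho> e i j = (if i = j \<and> i < N then 1 else 0)"
  using rep unfolding matrix_rep_def by blast

lemma rep_outside: "a \<in> B \<Longrightarrow> \<not> (i < N \<and> j < N) \<Longrightarrow> \<rho> a i j = 0"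
  using rep unfolding matrix_rep_def by blast

lemma B_0: "0 \<in> B" using subspace_0[OF subspace_B] .

lemma rep_0: "\<rho> 0 i j = 0"
  using rep_scale[OF B_0, of 0 i j] by simp

lemma rep_sum: "(\<And>x. x \<in> I \<Longrightarrow> f x \<in> B) \<Longrightarrow> \<rho> (sum f I) i j = (\<Sum>x\<in>I. \<rho> (f x) i j)"
proof (induction I rule: infinite_finite_induct)
  case (insert x I)
  then show ?case by (simp add: rep_add B_sum)
qed (simp_all add: rep_0)

text \<open>The Taylor expansion in \<open>x\<close> of \<open>\<rho> (exp (x D) a)\<close>.\<close>

definition \<Phi> :: "'a \<Rightarrow> nat \<Rightarrow> nat \<Rightarrow> complex poly"
  where "\<Phi> a i j = Abs_poly (\<lambda>k. \<rho> ((D ^^ k) a) i j / fact k)"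

lemma coeff_\<Phi>: "a \<in> B \<Longrightarrow> coeff (\<Phi> a i j) k = \<rho> ((D ^^ k) a) i j / fact k"
proof -
  assume "a \<in> B"
  then obtain n where "\<forall>k\<ge>n. (D ^^ k) a = 0" using D_nilpotent_above by blast
  then have "coeff (\<Phi> a i j) = (\<lambda>k. \<rho> ((D ^^ k) a) i j / fact k)"
    unfolding \<Phi>_def by (intro coeff_Abs_poly[of n]) (simp add: rep_0)
  then show ?thesis by simp
qed

lemma \<Phi>_add: "a \<in> B \<Longrightarrow> b \<in> B \<Longrightarrow> \<Phi> (a + b) i j = \<Phi> a i j + \<Phi> b i j"
  by (rule poly_eqI) (simp add: coeff_\<Phi> B_add D_pow_add rep_add D_pow_B add_divide_distrib)

lemma \<Phi>_scale: "a \<in> B \<Longrightarrow> \<Phi> (c \<cdot> a) i j = smult c (\<Phi> a i j)"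
  by (rule poly_eqI) (simp add: coeff_\<Phi> B_scale D_pow_scale rep_scale D_pow_B)

lemma \<Phi>_0: "\<Phi> 0 i j = 0"
  by (rule poly_eqI) (simp add: coeff_\<Phi> B_0 rep_0)

lemma \<Phi>_diff: "a \<in> B \<Longrightarrow> b \<in> B \<Longrightarrow> \<Phi> (a - b) i j = \<Phi> a i j - \<Phi> b i j"
  using \<Phi>_add[of "a - b" b i j] B_diff[of a b] by simp

lemma \<Phi>_sum: "(\<And>x. x \<in> I \<Longrightarrow> f x \<in> B) \<Longrightarrow> \<Phi> (sum f I) i j = (\<Sum>x\<in>I. \<Phi> (f x) i j)"
proof (induction I rule: infinite_finite_induct)
  case (insert x I)
  then show ?case by (simp add: \<Phi>_add B_sum)
qed (simp_all add: \<Phi>_0)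

lemma \<Phi>_unit: "\<Phi> e i j = (if i = j \<and> i < N then 1 else 0)"
proof (rule poly_eqI)
  fix k
  show "coeff (\<Phi> e i j) k = coeff (if i = j \<and> i < N then 1 else 0) k"
  proof (cases k)
    case 0
    then show ?thesis by (simp add: coeff_\<Phi> unit_B rep_unit)
  next
    case (Suc n)
    then have "(D ^^ k) e = 0" by (simp only: funpow_Suc_right comp_def D_unit D_pow_0)
    then show ?thesis using Suc by (simp add: coeff_\<Phi> unit_B rep_0 del: funpow.simps)
  qed
qed

lemma \<Phi>_outside: "a \<in> B \<Longrightarrow> \<not> (i < N \<and> j < N) \<Longrightarrow> \<Phi> a i j = 0"
  by (rule poly_eqI) (simp add: coeff_\<Phi> rep_outside D_pow_B)

lemma \<Phi>_D: "a \<in> B \<Longrightarrow> \<Phi> (D a) i j = pderiv (\<Phi> a i j)"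
  by (rule poly_eqI)
    (simp add: coeff_\<Phi> D_B coeff_pderiv funpow_swap1 field_simps del: of_nat_Suc)

text \<open>Dividing by factorials turns the Leibniz rule into the Cauchy product of Taylor
  series.\<close>

lemma \<Phi>_mul:
  assumes "a \<in> B" "b \<in> B"
  shows "\<Phi> (a \<odot> b) i j = (\<Sum>l<N. \<Phi> a i l * \<Phi> b l j)"
proof (rule poly_eqI)
  fix k
  have "coeff (\<Phi> (a \<odot> b) i j) k =
      (\<Sum>m\<le>k. of_nat (k choose m) * (\<Sum>l<N. \<rho> ((D ^^ m) a) i l * \<rho> ((D ^^ (k - m)) b) l j)) / fact k"
    using assms by (simp add: coeff_\<Phi> mul_B D_Leibniz rep_sum B_scale D_pow_B rep_scale rep_mul)
  also have "\<dots> = (\<Sum>m\<le>k. \<Sum>l<N. (\<rho> ((D ^^ m) a) i l / fact m) * (\<rho> ((D ^^ (k - m)) b) l j / fact (k - m)))"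
    unfolding sum_divide_distrib sum_distrib_left
    by (intro sum.cong refl) (simp add: binomial_fact field_simps)
  also have "\<dots> = (\<Sum>l<N. \<Sum>m\<le>k. coeff (\<Phi> a i l) m * coeff (\<Phi> b l j) (k - m))"
    using assms by (subst sum.swap) (simp add: coeff_\<Phi>)
  also have "\<dots> = coeff (\<Sum>l<N. \<Phi> a i l * \<Phi> b l j) k"
    by (simp add: coeff_sum coeff_mult)
  finally show "coeff (\<Phi> (a \<odot> b) i j) k = coeff (\<Sum>l<N. \<Phi> a i l * \<Phi> b l j) k" .
qed

lemma \<Phi>_eq_0:
  assumes "a \<in> B" "\<And>i j. \<Phi> a i j = 0"
  shows "a = 0"
proof -
  define J where "J = {a\<in>B. \<forall>i j. \<Phi> a i j = 0}"
  have "J = {0} \<or> J = B"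
  proof (rule D_simple)
    show "subspace J"
      by (rule subspaceI) (auto simp: J_def B_0 \<Phi>_0 B_add \<Phi>_add B_scale \<Phi>_scale)
    show "D j \<in> J" if "j \<in> J" for j using that by (simp add: J_def D_B \<Phi>_D)
    show "a \<odot> j \<in> J \<and> j \<odot> a \<in> J" if "a \<in> B" "j \<in> J" for a j using that by (simp add: J_def mul_B \<Phi>_mul)
  qed (auto simp: J_def)
  moreover have "e \<notin> J"
  proof
    assume "e \<in> J"
    then have "\<Phi> e 0 0 = 0" by (simp add: J_def)
    then show False using N_pos by (simp add: \<Phi>_unit)
  qed
  ultimately have "J = {0}" using unit_B by blast
  then show ?thesis using assms unfolding J_def by blast
qed

text \<open>Here x is a central indeterminate added to the matrices, not the image of an element of
  \<open>B\<close>. Values \<open>b s\<close> with \<open>s > m\<close> only have to lie in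
  \<open>B\<close>, so that lowering \<open>m\<close> needs no truncation.\<close>

definition rel :: "nat \<Rightarrow> (nat \<Rightarrow> 'a) \<Rightarrow> bool"
  where "rel m b \<longleftrightarrow> (\<forall>s. b s \<in> B) \<and> (\<forall>i l. (\<Sum>s\<le>m. monom 1 s * \<Phi> (b s) i l) = 0)"

lemma rel_add: "rel m b \<Longrightarrow> rel m b' \<Longrightarrow> rel m (\<lambda>s. b s + b' s)"
  by (simp add: rel_def B_add \<Phi>_add distrib_left sum.distrib)

lemma rel_scale:
  assumes "rel m b"
  shows "rel m (\<lambda>s. c \<cdot> b s)"
proof -
  have "(\<Sum>s\<le>m. monom 1 s * \<Phi> (c \<cdot> b s) i l) = [:c:] * (\<Sum>s\<le>m. monom 1 s * \<Phi> (b s) i l)" for i l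
    using assms unfolding rel_def sum_distrib_left by (simp add: \<Phi>_scale)
  then show ?thesis using assms by (simp add: rel_def B_scale)
qed

lemma rel_0: "rel m (\<lambda>s. 0)"
  by (simp add: rel_def B_0 \<Phi>_0)

lemma rel_mul_left:
  assumes "rel m b" "a \<in> B"
  shows "rel m (\<lambda>s. a \<odot> b s)"
proof -
  have "(\<Sum>s\<le>m. monom 1 s * \<Phi> (a \<odot> b s) i l) = (\<Sum>p<N. \<Phi> a i p * (\<Sum>s\<le>m. monom 1 s * \<Phi> (b s) p l))" for i l
    using assms unfolding rel_def sum_distrib_left
    by (subst sum.swap) (simp add: \<Phi>_mul sum_distrib_left mult.left_commute)
  then show ?thesis using assms by (simp add: rel_def mul_B)
qed

lemma rel_mul_right:
  assumes "rel m b" "a \<in> B"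
  shows "rel m (\<lambda>s. b s \<odot> a)"
proof -
  have "(\<Sum>s\<le>m. monom 1 s * \<Phi> (b s \<odot> a) i l) = (\<Sum>p<N. (\<Sum>s\<le>m. monom 1 s * \<Phi> (b s) i p) * \<Phi> a p l)" for i l
    using assms unfolding rel_def sum_distrib_right
    by (subst sum.swap) (simp add: \<Phi>_mul sum_distrib_left mult.assoc)
  then show ?thesis using assms by (simp add: rel_def mul_B)
qed

text \<open>The derivative of the relation with respect to x: the coefficients are differentiated
  through \<open>D\<close>, and the powers of x shift the index. The cutoff keeps out
  \<open>b (Suc m)\<close>, which is not part of the relation.\<close>

lemma rel_D:
  assumes "rel m b"
  shows "rel m (\<lambda>s. D (b s) + (if s < m then of_nat (Suc s) \<cdot> b (Suc s) else 0))"
proof -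
  have bB: "b s \<in> B" for s using assms by (simp add: rel_def)
  define T where "T = (\<lambda>s. D (b s) + (if s < m then of_nat (Suc s) \<cdot> b (Suc s) else 0))"
  have TB: "T s \<in> B" for s unfolding T_def using bB by (auto intro!: B_add D_B B_scale B_0)
  have "(\<Sum>s\<le>m. monom 1 s * \<Phi> (T s) i l) = pderiv (\<Sum>s\<le>m. monom 1 s * \<Phi> (b s) i l)" for i l
  proof -
    have "(\<Sum>s\<le>m. monom 1 s * \<Phi> (T s) i l) =
        (\<Sum>s\<le>m. monom 1 s * pderiv (\<Phi> (b s) i l)) +
        (\<Sum>s\<le>m. if s < m then monom (of_nat (Suc s)) s * \<Phi> (b (Suc s)) i l else 0)"
      unfolding sum.distrib[symmetric] T_def using bB
      by (intro sum.cong refl)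
        (simp add: \<Phi>_add \<Phi>_D \<Phi>_scale D_B B_scale B_0 distrib_left mult_smult_right smult_monom \<Phi>_0
          flip: mult_smult_left)
    also have "(\<Sum>s\<le>m. if s < m then monom (of_nat (Suc s)) s * \<Phi> (b (Suc s)) i l else 0) =
        (\<Sum>s\<le>m. pderiv (monom 1 s) * \<Phi> (b s) i l)"
    proof (cases m)
      case (Suc m')
      have "(\<Sum>s\<le>m. if s < m then monom (of_nat (Suc s)) s * \<Phi> (b (Suc s)) i l else 0) =
          (\<Sum>s\<le>m'. monom (of_nat (Suc s)) s * \<Phi> (b (Suc s)) i l)"
        unfolding Suc by (simp del: of_nat_Suc)
      also have "\<dots> = (\<Sum>s\<le>m. pderiv (monom 1 s) * \<Phi> (b s) i l)"
        unfolding Suc by (subst sum.atMost_Suc_shift) (simp add: pderiv_monom del: of_nat_Suc)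
      finally show ?thesis .
    qed (simp add: pderiv_monom)
    finally show ?thesis by (simp add: higher_pderiv_sum[where n = 1, simplified] pderiv_mult sum.distrib mult.commute add.commute)
  qed
  then show ?thesis using assms TB unfolding T_def[symmetric] by (simp add: rel_def)
qed

text \<open>More than \<open>N\<^sup>2\<close> independent elements of \<open>B\<close> are linearly dependent over \<open>\<complex>[x]\<close> as matrices.\<close>

lemma rel_exists:
  assumes x: "\<And>j. x j \<in> B" "indep_mod {0} x {..<Suc (N * N)}"
  shows "\<exists>m b. rel m b \<and> (\<exists>s\<le>m. b s \<noteq> 0)"
proof -
  obtain c where c: "\<exists>j\<in>{..<Suc (N * N)}. c j \<noteq> 0"
      "\<forall>q\<in>{..<N}\<times>{..<N}. (\<Sum>j<Suc (N * N). c j * \<Phi> (x j) (fst q) (snd q)) = 0"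
    using homogeneous_system_solvable[of "{..<N}\<times>{..<N}" "{..<Suc (N * N)}" "\<lambda>j q. \<Phi> (x j) (fst q) (snd q)"]
    by auto
  have c0: "(\<Sum>j<Suc (N * N). c j * \<Phi> (x j) i l) = 0" for i l
  proof (cases "i < N \<and> l < N")
    case True
    then show ?thesis using c(2) by force
  next
    case False
    then have "\<Phi> (x j) i l = 0" for j using \<Phi>_outside x(1) by blast
    then show ?thesis by simp
  qed
  define m where "m = (\<Sum>j<Suc (N * N). degree (c j))"
  have deg: "degree (c j) \<le> m" if "j < Suc (N * N)" for j
    unfolding m_def using that by (intro member_le_sum) auto
  \<comment> \<open>Regroups the combination of the \<open>x j\<close> by powers of x; independence
    of the \<open>x j\<close> over \<complex> keeps it nontrivial.\<close>
  define b where "b = (\<lambda>s. \<Sum>j<Suc (N * N). coeff (c j) s \<cdot> x j)"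
  have bB: "b s \<in> B" for s unfolding b_def by (intro B_sum B_scale x(1))
  have "(\<Sum>s\<le>m. monom 1 s * \<Phi> (b s) i l) = 0" for i l
  proof -
    have "(\<Sum>s\<le>m. monom 1 s * \<Phi> (b s) i l) =
        (\<Sum>s\<le>m. \<Sum>j<Suc (N * N). monom (coeff (c j) s) s * \<Phi> (x j) i l)"
      unfolding b_def using x(1)
      by (simp add: \<Phi>_sum \<Phi>_scale B_scale sum_distrib_left smult_monom distrib_left B_sum \<Phi>_add
          mult_smult_right flip: mult_smult_left)
    also have "\<dots> = (\<Sum>j<Suc (N * N). (\<Sum>s\<le>m. monom (coeff (c j) s) s) * \<Phi> (x j) i l)"
      by (subst sum.swap) (simp add: sum_distrib_right)
    also have "\<dots> = (\<Sum>j<Suc (N * N). c j * \<Phi> (x j) i l)"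
      using deg by (intro sum.cong refl) (simp add: poly_as_sum_of_monoms')
    finally show ?thesis using c0 by simp
  qed
  then have "rel m b" using bB by (simp add: rel_def)
  moreover obtain j where j: "j < Suc (N * N)" "c j \<noteq> 0" using c(1) by blast
  have "b (degree (c j)) \<noteq> 0"
  proof
    assume "b (degree (c j)) = 0"
    then have "\<forall>j'\<in>{..<Suc (N * N)}. coeff (c j') (degree (c j)) = 0"
      using x(2)[unfolded indep_mod_def, rule_format, of "\<lambda>j'. coeff (c j') (degree (c j))"]
      unfolding b_def by blast
    then have "lead_coeff (c j) = 0" using j(1) by blast
    then show False using j(2) by simp
  qed
  ultimately show ?thesis using deg[OF j(1)] by blast
qed

text \<open>In a relation \<open>\<Sum> x\<^sup>s \<Phi> (b s) = 0\<close> of least degree \<open>m\<close> the leading coefficients form a \<open>D\<close>-stable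
  ideal, so \<open>b m\<close> may be taken to be the unit. Commutators with \<open>b\<close> and its derivative are shorter
  relations, hence trivial.\<close>

lemma central_antiderivative_exists:
  assumes "rel m0 b0" "\<exists>s\<le>m0. b0 s \<noteq> 0"
  shows "\<exists>z\<in>B. D z = e \<and> (\<forall>a\<in>B. a \<odot> z = z \<odot> a)"
proof -
  define P where "P = (\<lambda>m. \<exists>b. rel m b \<and> (\<exists>s\<le>m. b s \<noteq> 0))"
  define m where "m = (LEAST m. P m)"
  have "P m0" using assms unfolding P_def by blast
  then have "P m" unfolding m_def by (rule LeastI)
  \<comment> \<open>With leading coefficient 0 the degree drops below the least one possible for a
    nontrivial relation.\<close>
  have short: "b s = 0" if rel: "rel m b" "b m = 0" and sm: "s \<le> m" for b s
  proof (rule ccontr)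
    assume "b s \<noteq> 0"
    then have "s \<noteq> m" using rel by metis
    then obtain m' where m': "m = Suc m'" "s \<le> m'" using sm by (metis le_SucE not0_implies_Suc le_zero_eq)
    have "rel m' b" using rel unfolding rel_def m' by (simp add: \<Phi>_0)
    then have "P m'" using m' \<open>b s \<noteq> 0\<close> unfolding P_def by blast
    then show False using not_less_Least[of m' P] m' unfolding m_def by simp
  qed
  define J where "J = {b m | b. rel m b}"
  have JI: "x \<in> J" if "rel m b" "x = b m" for x b using that unfolding J_def by blast
  have "J = {0} \<or> J = B"
  proof (rule D_simple)
    show "subspace J"
    proof (rule subspaceI)
      show "0 \<in> J" using JI[OF rel_0] by simp
    next
      fix x y assume "x \<in> J" "y \<in> J"
      then obtain b b' where "rel m b" "x = b m" "rel m b'" "y = b' m" unfolding J_def by blast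
      then show "x + y \<in> J" using JI[OF rel_add[of m b b']] by simp
    next
      fix c x assume "x \<in> J"
      then obtain b where "rel m b" "x = b m" unfolding J_def by blast
      then show "c \<cdot> x \<in> J" using JI[OF rel_scale[of m b c]] by simp
    qed
    show "J \<subseteq> B" unfolding J_def by (auto simp: rel_def)
  next
    fix a j assume a: "a \<in> B" "j \<in> J"
    then obtain b where "rel m b" "j = b m" unfolding J_def by blast
    then show "a \<odot> j \<in> J \<and> j \<odot> a \<in> J"
      using a JI[OF rel_mul_left[of m b a]] JI[OF rel_mul_right[of m b a]] by simp
  next
    fix j assume "j \<in> J"
    then obtain b where "rel m b" "j = b m" unfolding J_def by blast
    then show "D j \<in> J" using JI[OF rel_D[of m b]] by simp
  qed
  moreover have "J \<noteq> {0}"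
  proof -
    obtain b s where b: "rel m b" "s \<le> m" "b s \<noteq> 0" using \<open>P m\<close> unfolding P_def by blast
    then have "b m \<noteq> 0" using short by blast
    then show ?thesis using b unfolding J_def by blast
  qed
  ultimately have "e \<in> J" using unit_B by blast
  then obtain u where u: "rel m u" "u m = e" unfolding J_def by auto
  have uB: "u s \<in> B" for s using u(1) by (simp add: rel_def)
  have "m \<noteq> 0"
  proof
    assume "m = 0"
    then have "\<Phi> e 0 0 = 0" using u unfolding rel_def by auto
    then show False using N_pos by (simp add: \<Phi>_unit)
  qed
  then obtain m' where m': "m = Suc m'" by (cases m) auto
  have "D (u m') + of_nat m \<cdot> e = 0"
    using short[OF rel_D[OF u(1)], of m'] u(2) by (simp add: m' del: of_nat_Suc)
  then have Du: "D (u m') = - of_nat m \<cdot> e" by (simp add: scale_minus_left eq_neg_iff_add_eq_0)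
  have comm: "a \<odot> u m' = u m' \<odot> a" if "a \<in> B" for a
  proof -
    have "rel m (\<lambda>s. a \<odot> u s + (- 1) \<cdot> (u s \<odot> a))"
      using that by (intro rel_add rel_scale rel_mul_left rel_mul_right u)
    from short[OF this, of m'] show ?thesis
      using u(2) that by (simp add: m' unit_right scale_minus_left)
  qed
  define z where "z = (- 1 / of_nat m) \<cdot> u m'"
  have "z \<in> B" unfolding z_def by (intro B_scale uB)
  moreover have "D z = e" unfolding z_def D_scale Du using \<open>m \<noteq> 0\<close> by (simp add: scale_minus_left scale_minus_right)
  moreover have "a \<odot> z = z \<odot> a" if "a \<in> B" for a unfolding z_def using comm[OF that] by simp
  ultimately show ?thesis by blast
qed

text \<open>Since \<open>\<rho>\<close> is onto, \<open>\<rho> z\<close> commutes with every matrix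
  and is scalar; subtracting that scalar from \<open>z\<close> does not affect its
  derivative.\<close>

lemma coordinate_exists:
  assumes z: "z \<in> B" "D z = e" "\<And>a. a \<in> B \<Longrightarrow> a \<odot> z = z \<odot> a"
  shows "\<exists>z\<in>B. D z = e \<and> (\<forall>i j. \<rho> z i j = 0)"
proof -
  define c where "c = \<rho> z 0 0"
  have key: "\<rho> z i p = (if i = p then \<rho> z q q else 0)" if "i < N" "p < N" "q < N" for i p q
  proof -
    \<comment> \<open>A preimage of the matrix unit at (p, q); the entries (i, q) of its two
      products with \<open>z\<close> are compared.\<close>
    obtain a where a: "a \<in> B" "\<And>i j. i < N \<Longrightarrow> j < N \<Longrightarrow> \<rho> a i j = (if i = p \<and> j = q then 1 else 0)"
      using rep_onto[of "\<lambda>i j. if i = p \<and> j = q then 1 else 0"] by blast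
    have "\<rho> (z \<odot> a) i q = (\<Sum>l<N. if l = p then \<rho> z i p else 0)"
      unfolding rep_mul[OF z(1) a(1)] using a(2) that by (intro sum.cong) auto
    moreover have "\<rho> (a \<odot> z) i q = (\<Sum>l<N. if l = q then (if i = p then \<rho> z q q else 0) else 0)"
      unfolding rep_mul[OF a(1) z(1)] using a(2) that by (intro sum.cong) auto
    ultimately show ?thesis using z(3)[OF a(1)] that by simp
  qed
  have "\<rho> (z + (- c) \<cdot> e) i j = 0" for i j
  proof (cases "i < N \<and> j < N")
    case True
    then show ?thesis using key[of i j 0] z N_pos
      by (simp add: rep_add B_scale unit_B rep_scale rep_unit c_def del: scale_minus_left)
  next
    case False
    then show ?thesis using z by (intro rep_outside B_add B_scale unit_B)
  qed
  moreover have "D (z + (- c) \<cdot> e) = e" using z by (simp add: D_diff D_scale)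
  moreover have "z + (- c) \<cdot> e \<in> B" using z by (intro B_add B_scale unit_B)
  ultimately show ?thesis by blast
qed

context
  fixes z assumes z: "z \<in> B" "D z = e" "\<And>i j. \<rho> z i j = 0"
begin

lemma \<Phi>_coordinate: "\<Phi> z i j = (if i = j \<and> i < N then [:0, 1:] else 0)"
proof (rule poly_eqI)
  fix k
  consider "k = 0" | "k = 1" | n where "k = Suc (Suc n)" by (metis One_nat_def not0_implies_Suc)
  then show "coeff (\<Phi> z i j) k = coeff (if i = j \<and> i < N then [:0, 1:] else 0) k"
  proof cases
    case 3
    then have "(D ^^ k) z = 0" using z by (simp only: funpow_Suc_right comp_def D_unit D_pow_0)
    then show ?thesis using 3 z by (simp add: coeff_\<Phi> rep_0 del: funpow.simps)
  qed (use z in \<open>simp_all add: coeff_\<Phi> rep_unit\<close>)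
qed

text \<open>The sum \<Sum> (-z)^k D^k(b) / k! is killed by \<open>D\<close> because
  \<open>D z = e\<close>, and has the same image under \<open>\<rho>\<close> as \<open>b\<close>
  because \<open>\<rho> z\<close> is 0. Its Taylor expansion is therefore a constant matrix.\<close>

lemma constant_lift: "\<exists>b\<in>B. \<forall>i<N. \<forall>j<N. \<Phi> b i j = [:A i j:]"
proof -
  define g where "g = (\<lambda>k. ((\<odot>) z) ^^ k)"
  have gB: "g k a \<in> B" if "a \<in> B" for k a
    using that z(1) by (induction k) (simp_all add: g_def mul_B)
  have Dg: "D (g (Suc k) a) = of_nat (Suc k) \<cdot> g k a + g (Suc k) (D a)" if "a \<in> B" for k a
  proof (induction k)
    case 0
    then show ?case using D_mul[OF z(1) that] z by (simp add: g_def)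
  next
    case (Suc k)
    have "D (g (Suc (Suc k)) a) = g (Suc k) a + z \<odot> D (g (Suc k) a)"
      using D_mul[OF z(1) gB[OF that, of "Suc k"]] z by (simp add: g_def)
    also have "z \<odot> D (g (Suc k) a) = of_nat (Suc k) \<cdot> g (Suc k) a + g (Suc (Suc k)) (D a)"
      unfolding Suc by (simp add: mul_add_right g_def del: of_nat_Suc)
    finally have "D (g (Suc (Suc k)) a) =
        g (Suc k) a + (of_nat (Suc k) \<cdot> g (Suc k) a + g (Suc (Suc k)) (D a))" .
    moreover have "of_nat (Suc (Suc k)) \<cdot> g (Suc k) a = g (Suc k) a + of_nat (Suc k) \<cdot> g (Suc k) a"
      using scale_left_distrib[of 1 "of_nat (Suc k)" "g (Suc k) a"] by simp
    ultimately show ?case by (simp only: add.assoc)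
  qed
  obtain b where b: "b \<in> B" "\<And>i j. i < N \<Longrightarrow> j < N \<Longrightarrow> \<rho> b i j = A i j" using rep_onto[of A] by blast
  define S where "S = (\<lambda>n. \<Sum>k\<le>n. ((- 1) ^ k / fact k) \<cdot> g k ((D ^^ k) b))"
  \<comment> \<open>The partial sums telescope under \<open>D\<close>, and the surviving last term
    vanishes for large \<open>n\<close> by nilpotence.\<close>
  have DS: "D (S n) = ((- 1) ^ n / fact n) \<cdot> g n ((D ^^ Suc n) b)" for n
  proof (induction n)
    case 0
    show ?case by (simp add: S_def g_def)
  next
    case (Suc n)
    have "(- 1) ^ Suc n / fact (Suc n) * of_nat (Suc n) = - ((- 1) ^ n / fact n :: complex)"
      by (simp add: field_simps del: of_nat_Suc)
    then have "((- 1) ^ Suc n / fact (Suc n)) \<cdot> (of_nat (Suc n) \<cdot> g n ((D ^^ Suc n) b)) =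
        - (((- 1) ^ n / fact n) \<cdot> g n ((D ^^ Suc n) b))"
      by (simp only: scale_scale scale_minus_left)
    moreover have "S (Suc n) = S n + ((- 1) ^ Suc n / fact (Suc n)) \<cdot> g (Suc n) ((D ^^ Suc n) b)"
      by (simp add: S_def)
    ultimately show ?case
      using Dg[OF D_pow_B[OF b(1)], of n "Suc n"] Suc
      by (simp only: D_add D_scale scale_right_distrib funpow.simps comp_def) simp
  qed
  have SB: "S n \<in> B" for n unfolding S_def using b gB D_pow_B by (intro B_sum B_scale) auto
  have \<rho>S: "\<rho> (S n) i j = \<rho> b i j" for n i j
  proof (induction n)
    case 0
    show ?case by (simp add: S_def g_def)
  next
    case (Suc n)
    have "\<rho> (g (Suc n) ((D ^^ Suc n) b)) i j = 0"
      using rep_mul[OF z(1) gB[OF D_pow_B[OF b(1)]], of n "Suc n" i j] z(3) by (simp add: g_def)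
    moreover have "S (Suc n) = S n + ((- 1) ^ Suc n / fact (Suc n)) \<cdot> g (Suc n) ((D ^^ Suc n) b)"
      by (simp add: S_def)
    ultimately show ?case
      using Suc by (simp only: rep_add[OF SB B_scale[OF gB[OF D_pow_B[OF b(1)]]]]
          rep_scale[OF gB[OF D_pow_B[OF b(1)]]]) simp
  qed
  obtain n where n: "\<And>k. n \<le> k \<Longrightarrow> (D ^^ k) b = 0" using D_nilpotent_above[OF b(1)] by blast
  have g0: "g k 0 = 0" for k by (induction k) (simp_all add: g_def)
  have "D (S n) = 0" unfolding DS using n[of "Suc n"] g0 by (simp del: funpow.simps)
  have "\<Phi> (S n) i j = [:A i j:]" if "i < N" "j < N" for i j
  proof (rule poly_eqI)
    fix k
    show "coeff (\<Phi> (S n) i j) k = coeff [:A i j:] k"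
    proof (cases k)
      case 0
      then show ?thesis using SB b(2) that by (simp add: coeff_\<Phi> \<rho>S)
    next
      case (Suc k')
      then have "(D ^^ k) (S n) = 0" using \<open>D (S n) = 0\<close> by (simp only: funpow_Suc_right comp_def D_pow_0)
      then show ?thesis using SB Suc by (simp add: coeff_\<Phi> rep_0 del: funpow.simps)
    qed
  qed
  with SB show ?thesis by blast
qed

text \<open>Horner's scheme with \<open>z\<close> in place of x and \<open>constant_lift\<close> for
  the constant terms.\<close>

lemma \<Phi>_onto:
  assumes "\<And>i j k. n \<le> k \<Longrightarrow> coeff (M i j) k = 0"
  shows "\<exists>a\<in>B. \<forall>i<N. \<forall>j<N. \<Phi> a i j = M i j"
  using assms
proof (induction n arbitrary: M)
  case 0
  then have "M i j = 0" for i j by (intro poly_eqI) simp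
  then show ?case using B_0 \<Phi>_0 by (intro bexI[of _ 0]) auto
next
  case (Suc n)
  have "\<forall>i j. \<exists>a q. M i j = pCons a q" by (metis pCons_cases)
  then obtain A M' where M: "\<And>i j. M i j = pCons (A i j) (M' i j)" by metis
  have "coeff (M' i j) k = 0" if "n \<le> k" for i j k
    using Suc.prems[of "Suc k" i j] that by (simp add: M)
  then obtain a where a: "a \<in> B" "\<And>i j. i < N \<Longrightarrow> j < N \<Longrightarrow> \<Phi> a i j = M' i j" using Suc.IH by blast
  obtain b where b: "b \<in> B" "\<And>i j. i < N \<Longrightarrow> j < N \<Longrightarrow> \<Phi> b i j = [:A i j:]" using constant_lift[of A] by blast
  have "\<Phi> (b + z \<odot> a) i j = M i j" if "i < N" "j < N" for i j
  proof -
    have "\<Phi> (z \<odot> a) i j = (\<Sum>l<N. if l = i then [:0, 1:] * \<Phi> a i j else 0)"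
      unfolding \<Phi>_mul[OF z(1) a(1)] using that by (intro sum.cong) (auto simp: \<Phi>_coordinate)
    then show ?thesis using a b that z by (simp add: \<Phi>_add mul_B M)
  qed
  moreover have "b + z \<odot> a \<in> B" using a b z by (intro B_add mul_B)
  ultimately show ?case by blast
qed

end

theorem \<Phi>_bij:
  assumes x: "\<And>j. x j \<in> B" "indep_mod {0} x {..<Suc (N * N)}"
  shows "bij_betw \<Phi> B (poly_matrices N)"
proof (rule bij_betwI')
  fix a b assume ab: "a \<in> B" "b \<in> B"
  show "\<Phi> a = \<Phi> b \<longleftrightarrow> a = b"
  proof
    assume "\<Phi> a = \<Phi> b"
    then have "a - b = 0" using ab by (intro \<Phi>_eq_0 B_diff) (simp_all add: \<Phi>_diff)
    then show "a = b" by simp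
  qed simp
next
  fix a assume "a \<in> B"
  then show "\<Phi> a \<in> poly_matrices N" using \<Phi>_outside by (auto simp: poly_matrices_def)
next
  fix M assume M: "M \<in> poly_matrices N"
  obtain m b where "rel m b" "\<exists>s\<le>m. b s \<noteq> 0" using rel_exists[OF x] by blast
  then obtain z0 where "z0 \<in> B" "D z0 = e" "\<And>a. a \<in> B \<Longrightarrow> a \<odot> z0 = z0 \<odot> a"
    using central_antiderivative_exists by blast
  then obtain z where z: "z \<in> B" "D z = e" "\<And>i j. \<rho> z i j = 0" using coordinate_exists by blast
  define n where "n = Suc (\<Sum>i<N. \<Sum>j<N. degree (M i j))"
  have "coeff (M i j) k = 0" if "n \<le> k" for i j k
  proof (cases "i < N \<and> j < N")
    case True
    have "degree (M i j) \<le> (\<Sum>j<N. degree (M i j))" using True by (intro member_le_sum) auto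
    also have "\<dots> \<le> (\<Sum>i<N. \<Sum>j<N. degree (M i j))" using True by (intro member_le_sum) auto
    finally show ?thesis using that by (intro coeff_eq_0) (simp add: n_def)
  next
    case False
    then have "M i j = 0" using M by (simp add: poly_matrices_def)
    then show ?thesis by simp
  qed
  then obtain a where a: "a \<in> B" "\<forall>i<N. \<forall>j<N. \<Phi> a i j = M i j" using \<Phi>_onto[OF z, of n M] by blast
  have "\<Phi> a i j = M i j" for i j
  proof (cases "i < N \<and> j < N")
    case False
    then show ?thesis using \<Phi>_outside[OF a(1)] M by (simp add: poly_matrices_def)
  qed (use a in simp)
  then show "\<exists>a\<in>B. M = \<Phi> a" using a by (intro bexI[of _ a]) (auto simp: fun_eq_iff)
qed

end

section \<open>The associativity identity of a conformal algebra\<close>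

text \<open>The operations on C[t, t^-1] are sums over the supports of their arguments. This makes
  them additive even though supports may shrink in a sum; \<open>additive_eqI\<close> then reduces
  identities to monomials.\<close>

lemma additive_sum_over_keys:
  fixes F :: "'k \<Rightarrow> 'v::ab_group_add \<Rightarrow> 'w::ab_group_add"
  assumes "\<And>k a b. F k (a + b) = F k a + F k b"
  shows "(\<Sum>k\<in>Poly_Mapping.keys (u + v). F k (Poly_Mapping.lookup (u + v) k)) =
    (\<Sum>k\<in>Poly_Mapping.keys u. F k (Poly_Mapping.lookup u k)) +
    (\<Sum>k\<in>Poly_Mapping.keys v. F k (Poly_Mapping.lookup v k))"
proof (rule setsum_keys_plus_distrib)
  show "F k 0 = 0" for k using assms[of k 0 0] by simp
qed (rule assms)

lemma sum_over_keys_single: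
  fixes F :: "'k \<Rightarrow> 'v::ab_group_add \<Rightarrow> 'w::ab_group_add"
  assumes "\<And>k. F k 0 = 0"
  shows "(\<Sum>k\<in>Poly_Mapping.keys (Poly_Mapping.single l a). F k (Poly_Mapping.lookup (Poly_Mapping.single l a) k)) = F l a"
  using assms by (cases "a = 0") auto

lemma additive_eqI:
  fixes G H :: "('k \<Rightarrow>\<^sub>0 'v::ab_group_add) \<Rightarrow> 'w::ab_group_add"
  assumes "\<And>u v. G (u + v) = G u + G v" "\<And>u v. H (u + v) = H u + H v"
    and "\<And>k a. G (Poly_Mapping.single k a) = H (Poly_Mapping.single k a)"
  shows "G u = H u"
proof (induction u rule: update_induct)
  case const
  show ?case using assms(1)[of 0 0] assms(2)[of 0 0] by simp
next
  case (update f a b)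
  have "Poly_Mapping.update a b f = f + Poly_Mapping.single a b"
    by (rule poly_mapping_eqI)
      (use update in \<open>auto simp: lookup_update lookup_add lookup_single in_keys_iff when_def\<close>)
  then show ?case using assms update by simp
qed

context conformal_algebra
begin

abbreviation cscale :: "complex \<Rightarrow> 'a \<Rightarrow> 'a"  (infixr \<open>\<cdot>\<close> 75)
  where "c \<cdot> a \<equiv> scale [:c:] a"

lemma vector_space_cscale: "vector_space cscale"
  by unfold_locales (simp_all add: scale_right_distrib mult.commute flip: scale_left_distrib one_pCons)

sublocale cs: vector_space cscale
  by (rule vector_space_cscale)

lemma cprod_zero_left [simp]: "cprod n 0 b = 0" using cprod_add_left[of n 0 0 b] by simp
lemma cprod_zero_right [simp]: "cprod n a 0 = 0" using cprod_add_right[of n a 0 0] by simp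
lemma cprod_minus_left [simp]: "cprod n (- a) b = - cprod n a b"
  using cprod_add_left[of n "- a" a b] by (simp add: eq_neg_iff_add_eq_0)
lemma cprod_minus_right [simp]: "cprod n a (- b) = - cprod n a b"
  using cprod_add_right[of n a "- b" b] by (simp add: eq_neg_iff_add_eq_0)
lemma cprod_sum_left: "cprod n (sum f I) b = (\<Sum>i\<in>I. cprod n (f i) b)"
  by (induction I rule: infinite_finite_induct) (simp_all add: cprod_add_left)

lemma der_add: "der (a + b) = der a + der b" by (simp add: der_def scale_right_distrib)
lemma der_0 [simp]: "der 0 = 0" by (simp add: der_def)
lemma der_const: "der (c \<cdot> a) = c \<cdot> der a" by (simp add: der_def)
lemma der_prod: "der (cprod n a b) = cprod n (der a) b + cprod n a (der b)"
  using der_cprod by (simp add: der_def)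
text \<open>At \<open>n = 0\<close> the truncated \<open>n - 1\<close> is harmless, its coefficient
  being 0.\<close>

lemma cprod_der: "cprod n (der a) b = - (of_nat n \<cdot> cprod (n - 1) a b)"
proof (cases n)
  case 0
  then show ?thesis using cprod_der_zero by (simp add: der_def)
next
  case (Suc m)
  then show ?thesis using cprod_der_Suc[of m a b] cs.scale_minus_left[of "of_nat n"] by (simp add: der_def)
qed
lemma cprod_der_right: "cprod n a (der b) = der (cprod n a b) + (of_nat n) \<cdot> cprod (n - 1) a b"
  using der_prod[of n a b] cprod_der[of n a b] by simp
lemma pCons_scale: "scale (pCons c p) a = c \<cdot> a + der (scale p a)"
proof -
  have "pCons c p = [:c:] + [:0, 1:] * p" by simp
  then show ?thesis by (simp only: scale_left_distrib der_def scale_scale)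
qed

text \<open>The axioms control products only against constants and \<partial>, so
  \<complex>[\<partial>]-submodules are tested on these two kinds of scalars.\<close>

lemma subspaceI_der:
  fixes S :: "'a set"
  assumes "0 \<in> S" "\<And>x y. x \<in> S \<Longrightarrow> y \<in> S \<Longrightarrow> x + y \<in> S"
    and "\<And>c x. x \<in> S \<Longrightarrow> c \<cdot> x \<in> S" "\<And>x. x \<in> S \<Longrightarrow> der x \<in> S"
  shows "subspace S"
proof (rule subspaceI)
  fix p x assume "x \<in> S"
  then show "scale p x \<in> S"
  proof (induction p)
    case (pCons c p)
    then show ?case using assms(2-4) by (simp only: pCons_scale[of c p x])
  qed (simp add: assms(1))
qed (use assms in auto)

definition mono_prod :: "int \<Rightarrow> 'a \<Rightarrow> int \<Rightarrow> 'a \<Rightarrow> (int \<Rightarrow>\<^sub>0 'a)"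
  where "mono_prod l a m b = (\<Sum>j | cprod j a b \<noteq> 0.
    Poly_Mapping.single (l + m - int j) (((of_int l :: complex) gchoose j) \<cdot> cprod j a b))"

text \<open>The index set in \<open>mono_prod\<close> depends on \<open>a\<close> and
  \<open>b\<close>; a common range is needed to compare products. Asking only for the weighted terms
  to vanish admits the cutoff \<open>Suc m\<close> when \<open>l = int m\<close>.\<close>

lemma mono_prod_eq:
  assumes "\<And>j. n \<le> j \<Longrightarrow> ((of_int l :: complex) gchoose j) \<cdot> cprod j a b = 0"
  shows "mono_prod l a m b =
    (\<Sum>j<n. Poly_Mapping.single (l + m - int j) (((of_int l :: complex) gchoose j) \<cdot> cprod j a b))"
proof -
  obtain n0 where n0: "\<And>j. n0 \<le> j \<Longrightarrow> cprod j a b = 0" using locality by blast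
  define f where "f = (\<lambda>j. Poly_Mapping.single (l + m - int j) (((of_int l :: complex) gchoose j) \<cdot> cprod j a b))"
  have "mono_prod l a m b = sum f {..<max n n0}"
    unfolding mono_prod_def f_def[symmetric]
  proof (rule sum.mono_neutral_left)
    show "{j. cprod j a b \<noteq> 0} \<subseteq> {..<max n n0}"
    proof
      fix j assume "j \<in> {j. cprod j a b \<noteq> 0}"
      then have "\<not> n0 \<le> j" using n0 by blast
      then show "j \<in> {..<max n n0}" by simp
    qed
  qed (auto simp: f_def)
  also have "\<dots> = sum f {..<n}"
  proof (rule sum.mono_neutral_right)
    show "\<forall>j\<in>{..<max n n0} - {..<n}. f j = 0"
      unfolding f_def using assms by (metis DiffD2 lessThan_iff not_le single_zero)
  qed auto
  finally show ?thesis by (simp add: f_def)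
qed

lemma mono_prod_add_left: "mono_prod l (a + a') m b = mono_prod l a m b + mono_prod l a' m b"
proof -
  obtain n n' where n: "\<And>j. n \<le> j \<Longrightarrow> cprod j a b = 0" "\<And>j. n' \<le> j \<Longrightarrow> cprod j a' b = 0"
    using locality by meson
  show ?thesis
    using n by (subst (1 2 3) mono_prod_eq[where n = "max n n'"])
      (auto simp: cprod_add_left scale_right_distrib single_add sum.distrib)
qed

lemma mono_prod_add_right: "mono_prod l a m (b + b') = mono_prod l a m b + mono_prod l a m b'"
proof -
  obtain n n' where n: "\<And>j. n \<le> j \<Longrightarrow> cprod j a b = 0" "\<And>j. n' \<le> j \<Longrightarrow> cprod j a b' = 0"
    using locality by meson
  show ?thesis
    using n by (subst (1 2 3) mono_prod_eq[where n = "max n n'"])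
      (auto simp: cprod_add_right scale_right_distrib single_add sum.distrib)
qed

lemma mono_prod_0 [simp]: "mono_prod l 0 m b = 0" "mono_prod l a m 0 = 0"
  by (simp_all add: mono_prod_def)

lemma affine_prod_eq: "affine_prod u v = (\<Sum>l\<in>Poly_Mapping.keys u. \<Sum>m\<in>Poly_Mapping.keys v.
    mono_prod l (Poly_Mapping.lookup u l) m (Poly_Mapping.lookup v m))"
  by (simp add: affine_prod_def mono_prod_def)

lemma affine_prod_add_left: "affine_prod (u + u') v = affine_prod u v + affine_prod u' v"
  unfolding affine_prod_eq
  by (rule additive_sum_over_keys[of "\<lambda>l a. \<Sum>m\<in>Poly_Mapping.keys v. mono_prod l a m (Poly_Mapping.lookup v m)"])
    (simp add: mono_prod_add_left sum.distrib)

lemma affine_prod_add_right: "affine_prod u (v + v') = affine_prod u v + affine_prod u v'"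
  unfolding affine_prod_eq sum.distrib[symmetric]
  by (intro sum.cong refl additive_sum_over_keys mono_prod_add_right)

lemma affine_prod_single: "affine_prod (Poly_Mapping.single l a) (Poly_Mapping.single m b) = mono_prod l a m b"
  unfolding affine_prod_eq
  by (simp only: sum_over_keys_single[of "\<lambda>m b. mono_prod _ _ m b"] mono_prod_0)
    (rule sum_over_keys_single[of "\<lambda>l a. mono_prod l a m b"], simp)

lemma affine_der_add: "affine_der (u + v) = affine_der u + affine_der v"
  unfolding affine_der_def
  by (rule additive_sum_over_keys[of "\<lambda>l a. Poly_Mapping.single l (der a) + Poly_Mapping.single (l - 1) ((of_int l) \<cdot> a)"])
    (simp add: der_add single_add scale_right_distrib)

lemma affine_der_single: "affine_der (Poly_Mapping.single l a) =
    Poly_Mapping.single l (der a) + Poly_Mapping.single (l - 1) ((of_int l) \<cdot> a)"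
  unfolding affine_der_def
  by (rule sum_over_keys_single[of "\<lambda>l a. Poly_Mapping.single l (der a) + Poly_Mapping.single (l - 1) ((of_int l) \<cdot> a)"]) simp

lemma affine_der_0: "affine_der 0 = 0" by (simp add: affine_der_def)

lemma affine_der_sum: "affine_der (sum f I) = (\<Sum>i\<in>I. affine_der (f i))"
  by (induction I rule: infinite_finite_induct) (simp_all add: affine_der_0 affine_der_add)

lemma of_nat_gbinomial_Suc: "of_nat (Suc j) * (z gchoose Suc j) = (z - of_nat j) * (z gchoose j)" for z :: complex
  using gbinomial_mult_1[of z j] by (simp add: algebra_simps)

lemma shift_index: "l + m - int (Suc j) = l + m - 1 - int j" by simp

text \<open>The two terms of \<partial> + d/dt cancel after the index shift in
  \<open>cprod_der\<close>, through the absorption rule (j+1) binom(l, j+1) = l binom(l-1,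
  j).\<close>

lemma affine_prod_der_left_single:
  "affine_prod (affine_der (Poly_Mapping.single l a)) (Poly_Mapping.single m b) = 0"
proof -
  obtain n where n: "\<And>j. n \<le> j \<Longrightarrow> cprod j a b = 0" using locality by blast
  define c where "c = (\<lambda>j. (of_int l :: complex) gchoose j)"
  have "affine_prod (Poly_Mapping.single l (der a)) (Poly_Mapping.single m b) =
      (\<Sum>j<Suc n. Poly_Mapping.single (l + m - int j) ((c j) \<cdot> cprod j (der a) b))"
    unfolding affine_prod_single c_def using n by (intro mono_prod_eq) (simp add: cprod_der)
  also have "\<dots> = (\<Sum>j<n. Poly_Mapping.single (l + m - 1 - int j) ((c (Suc j)) \<cdot> (- of_nat (Suc j)) \<cdot> cprod j a b))"
    using cs.scale_minus_left
    by (subst sum.lessThan_Suc_shift) (simp add: cprod_der shift_index del: of_nat_Suc)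
  finally have 1: "affine_prod (Poly_Mapping.single l (der a)) (Poly_Mapping.single m b) = \<dots>" .
  have 2: "affine_prod (Poly_Mapping.single (l - 1) ((of_int l) \<cdot> a)) (Poly_Mapping.single m b) =
      (\<Sum>j<n. Poly_Mapping.single (l + m - 1 - int j) (((of_int l - 1) gchoose j) \<cdot> (of_int l) \<cdot> cprod j a b))"
    unfolding affine_prod_single using n
    by (subst mono_prod_eq[of n]) (simp_all add: cprod_scale_left algebra_simps)
  have "of_nat (Suc j) * c (Suc j) = of_int l * ((of_int l - 1) gchoose j)" for j
    unfolding c_def by (rule gbinomial_absorption)
  then have "- (c (Suc j) * of_nat (Suc j)) + of_int l * ((of_int l - 1) gchoose j) = 0" for j
    by (simp only: mult.commute) simp
  then have 3: "(c (Suc j)) \<cdot> (- of_nat (Suc j)) \<cdot> x + ((of_int l - 1) gchoose j) \<cdot> (of_int l) \<cdot> x = 0"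
    for j and x :: 'a
    by (simp only: cs.scale_scale mult_minus_right mult.commute[of _ "of_int l"] flip: cs.scale_left_distrib) simp
  show ?thesis
    unfolding affine_der_single affine_prod_add_left 1 2 sum.distrib[symmetric] single_add[symmetric] 3 by simp
qed

text \<open>Moving \<partial> out of the right factor by \<open>cprod_der_right\<close> leaves the
  identity (j+1) binom(l, j+1) + m binom(l, j) = (l + m - j) binom(l, j).\<close>

lemma affine_prod_der_right_single:
  "affine_prod (Poly_Mapping.single l a) (affine_der (Poly_Mapping.single m b)) =
    affine_der (affine_prod (Poly_Mapping.single l a) (Poly_Mapping.single m b))"
proof -
  obtain n where n: "\<And>j. n \<le> j \<Longrightarrow> cprod j a b = 0" using locality by blast
  define c where "c = (\<lambda>j. (of_int l :: complex) gchoose j)"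
  have "affine_prod (Poly_Mapping.single l a) (Poly_Mapping.single m (der b)) =
      (\<Sum>j<Suc n. Poly_Mapping.single (l + m - int j) ((c j) \<cdot> cprod j a (der b)))"
    unfolding affine_prod_single c_def using n by (intro mono_prod_eq) (simp add: cprod_der_right)
  also have "\<dots> = (\<Sum>j<Suc n. Poly_Mapping.single (l + m - int j) ((c j) \<cdot> der (cprod j a b))) +
      (\<Sum>j<Suc n. Poly_Mapping.single (l + m - int j) ((c j) \<cdot> (of_nat j) \<cdot> cprod (j - 1) a b))"
    by (simp only: cprod_der_right scale_right_distrib single_add sum.distrib)
  also have "(\<Sum>j<Suc n. Poly_Mapping.single (l + m - int j) ((c j) \<cdot> der (cprod j a b))) =
      (\<Sum>j<n. Poly_Mapping.single (l + m - int j) ((c j) \<cdot> der (cprod j a b)))"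
    using n by simp
  also have "(\<Sum>j<Suc n. Poly_Mapping.single (l + m - int j) ((c j) \<cdot> (of_nat j) \<cdot> cprod (j - 1) a b)) =
      (\<Sum>j<n. Poly_Mapping.single (l + m - 1 - int j) ((c (Suc j)) \<cdot> (of_nat (Suc j)) \<cdot> cprod j a b))"
    by (subst sum.lessThan_Suc_shift) (simp add: shift_index del: of_nat_Suc)
  finally have 1: "affine_prod (Poly_Mapping.single l a) (Poly_Mapping.single m (der b)) =
      (\<Sum>j<n. Poly_Mapping.single (l + m - int j) ((c j) \<cdot> der (cprod j a b))) +
      (\<Sum>j<n. Poly_Mapping.single (l + m - 1 - int j) ((c (Suc j)) \<cdot> (of_nat (Suc j)) \<cdot> cprod j a b))" .
  have 2: "affine_prod (Poly_Mapping.single l a) (Poly_Mapping.single (m - 1) ((of_int m) \<cdot> b)) =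
      (\<Sum>j<n. Poly_Mapping.single (l + m - 1 - int j) ((c j) \<cdot> (of_int m) \<cdot> cprod j a b))"
    unfolding affine_prod_single using n
    by (subst mono_prod_eq[of n]) (simp_all add: cprod_scale_right algebra_simps c_def)
  have 3: "affine_der (affine_prod (Poly_Mapping.single l a) (Poly_Mapping.single m b)) =
      (\<Sum>j<n. Poly_Mapping.single (l + m - int j) ((c j) \<cdot> der (cprod j a b))) +
      (\<Sum>j<n. Poly_Mapping.single (l + m - 1 - int j) ((of_int (l + m - int j)) \<cdot> (c j) \<cdot> cprod j a b))"
    unfolding affine_prod_single using n
    by (subst mono_prod_eq[of n])
      (simp_all add: affine_der_sum affine_der_single der_const sum.distrib c_def algebra_simps)
  have "c (Suc j) * of_nat (Suc j) + c j * of_int m = of_int (l + m - int j) * c j" for j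
    using of_nat_gbinomial_Suc[of j "of_int l"] by (simp add: c_def algebra_simps)
  then have 4: "(c (Suc j)) \<cdot> (of_nat (Suc j)) \<cdot> x + (c j) \<cdot> (of_int m) \<cdot> x =
      (of_int (l + m - int j)) \<cdot> (c j) \<cdot> x" for j and x :: 'a
    by (simp only: cs.scale_scale flip: cs.scale_left_distrib)
  show ?thesis
    unfolding affine_der_single[of m] affine_prod_add_right 1 2 3 add.assoc sum.distrib[symmetric]
      single_add[symmetric] 4 by simp
qed

lemma affine_prod_der_left: "affine_prod (affine_der u) v = 0"
proof -
  have "affine_prod (affine_der (Poly_Mapping.single l a)) v = 0" for l a
    by (rule additive_eqI[of "\<lambda>v. affine_prod (affine_der (Poly_Mapping.single l a)) v" "\<lambda>_. 0"]) (simp_all add: affine_prod_add_right affine_prod_der_left_single)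
  note singles = this
  show ?thesis
    by (rule additive_eqI[of "\<lambda>u. affine_prod (affine_der u) v" "\<lambda>_. 0"])
      (simp_all add: affine_prod_add_left affine_der_add singles)
qed

lemma affine_prod_der_right: "affine_prod u (affine_der v) = affine_der (affine_prod u v)"
proof -
  have "affine_prod (Poly_Mapping.single l a) (affine_der v) = affine_der (affine_prod (Poly_Mapping.single l a) v)" for l a
    by (rule additive_eqI[of "\<lambda>v. affine_prod (Poly_Mapping.single l a) (affine_der v)"
          "\<lambda>v. affine_der (affine_prod (Poly_Mapping.single l a) v)"])
      (simp_all add: affine_prod_add_right affine_der_add affine_prod_der_right_single)
  note singles = this
  show ?thesis
    by (rule additive_eqI[of "\<lambda>u. affine_prod u (affine_der v)" "\<lambda>u. affine_der (affine_prod u v)"])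
      (simp_all add: affine_prod_add_left affine_der_add singles)
qed

text \<open>The image of \<open>a t\<^sup>k\<close> in the coefficient algebra, for \<open>k < 0\<close>, equals that of \<open>\<psi> (a t\<^sup>k) t\<^sup>-\<^sup>1\<close>. The
  monomials with \<open>k \<ge> 0\<close> may be discarded because \<open>\<partial> + d/dt\<close> respects the splitting by the sign
  of \<open>k\<close>.\<close>

definition psi_mono :: "int \<Rightarrow> 'a \<Rightarrow> 'a"
  where "psi_mono k a = (if k < 0 then (1 / fact (nat (- k - 1))) \<cdot> (der ^^ nat (- k - 1)) a else 0)"

definition psi :: "(int \<Rightarrow>\<^sub>0 'a) \<Rightarrow> 'a"
  where "psi u = (\<Sum>k\<in>Poly_Mapping.keys u. psi_mono k (Poly_Mapping.lookup u k))"

lemma der_pow_add: "(der ^^ n) (a + b) = (der ^^ n) a + (der ^^ n) b"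
  by (induction n) (simp_all add: der_add)

lemma der_pow_0 [simp]: "(der ^^ n) 0 = 0"
  by (induction n) simp_all

lemma der_pow_const: "(der ^^ n) (c \<cdot> a) = c \<cdot> (der ^^ n) a"
  by (induction n) (simp_all add: der_const)

lemma psi_mono_add: "psi_mono k (a + b) = psi_mono k a + psi_mono k b"
  by (simp add: psi_mono_def der_pow_add scale_right_distrib)

lemma psi_mono_0 [simp]: "psi_mono k 0 = 0"
  by (simp add: psi_mono_def)

lemma psi_mono_const: "psi_mono k (c \<cdot> a) = c \<cdot> psi_mono k a"
  by (simp add: psi_mono_def der_pow_const scale_left_commute)

lemma psi_add: "psi (u + v) = psi u + psi v"
  unfolding psi_def by (rule additive_sum_over_keys) (rule psi_mono_add)

lemma psi_single: "psi (Poly_Mapping.single k a) = psi_mono k a"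
  unfolding psi_def by (rule sum_over_keys_single) simp

lemma psi_sum: "psi (sum f I) = (\<Sum>i\<in>I. psi (f i))"
  by (induction I rule: infinite_finite_induct) (simp_all add: psi_add psi_def[of 0])

lemma psi_affine_der: "psi (affine_der u) = 0"
proof (rule additive_eqI[of "\<lambda>u. psi (affine_der u)" "\<lambda>_. 0"])
  fix k a
  show "psi (affine_der (Poly_Mapping.single k a)) = 0"
  proof (cases "k < 0")
    case True
    define n where "n = nat (- k - 1)"
    have k: "k = - int (Suc n)" using True by (simp add: n_def)
    have nat: "nat (- k - 1) = n" "nat (- (k - 1) - 1) = Suc n" by (simp_all add: k)
    have "psi_mono k (der a) = (1 / fact n) \<cdot> (der ^^ Suc n) a"
      unfolding psi_mono_def nat using True by (simp add: funpow_swap1)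
    moreover have "psi_mono (k - 1) a = (1 / fact (Suc n)) \<cdot> (der ^^ Suc n) a"
      unfolding psi_mono_def nat using True by (simp del: funpow.simps fact_Suc)
    ultimately have "psi (affine_der (Poly_Mapping.single k a)) =
        (1 / fact n) \<cdot> (der ^^ Suc n) a + (1 / fact (Suc n) * of_int k) \<cdot> (der ^^ Suc n) a"
      by (simp only: affine_der_single psi_add psi_single psi_mono_const cs.scale_scale mult.commute)
    also have "1 / fact (Suc n) * of_int k = (- (1 / fact n) :: complex)"
      by (simp add: k field_simps del: of_nat_Suc)
    finally show ?thesis by (simp only: cs.scale_minus_left right_minus)
  next
    case False
    \<comment> \<open>At \<open>k = 0\<close> the d/dt part carries the factor 0, so no nonnegative
      exponent leaks into the negative ones.\<close>
    then show ?thesis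
      by (cases "k = 0") (simp_all add: affine_der_single psi_add psi_single psi_mono_def)
  qed
qed (simp_all add: affine_der_add psi_add)

lemma mono_prod_nat:
  "mono_prod (int m) a l b = (\<Sum>j\<le>m. Poly_Mapping.single (int m + l - int j) ((of_nat (m choose j)) \<cdot> cprod j a b))"
  by (subst mono_prod_eq[of "Suc m"]) (auto simp: binomial_gbinomial[symmetric] lessThan_Suc_atMost)

text \<open>In the product of a t^m and b t^-1 only the term j = m has a negative exponent. This is
  how the products of C are read off the coefficient algebra.\<close>

lemma psi_mono_prod: "psi (mono_prod (int m) a (- 1) b) = cprod m a b"
proof -
  have "psi (mono_prod (int m) a (- 1) b) = (\<Sum>j\<le>m. if j = m then cprod m a b else 0)"
    unfolding mono_prod_nat psi_sum psi_single
    by (intro sum.cong refl) (auto simp: psi_mono_def)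
  then show ?thesis by simp
qed

lemma affine_prod_sum_left: "affine_prod (sum f I) v = (\<Sum>i\<in>I. affine_prod (f i) v)"
  by (induction I rule: infinite_finite_induct) (simp_all add: affine_prod_add_left affine_prod_eq[of 0])

lemma affine_prod_sum_right: "affine_prod v (sum f I) = (\<Sum>i\<in>I. affine_prod v (f i))"
  by (induction I rule: infinite_finite_induct) (simp_all add: affine_prod_add_right affine_prod_eq[of _ 0])

lemma coeff_rel_refl: "(u, u) \<in> coeff_rel"
  unfolding coeff_rel_def using affine_der_0 by (auto intro!: image_eqI[of _ _ 0])

lemma affine_prod_cong:
  assumes "(u, u') \<in> coeff_rel" "(v, v') \<in> coeff_rel"
  shows "psi (affine_prod u v) = psi (affine_prod u' v')" "psi (affine_prod w (affine_prod u v)) = psi (affine_prod w (affine_prod u' v'))"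
proof -
  obtain x y where "u - u' = affine_der x" "v - v' = affine_der y"
    using assms unfolding coeff_rel_def by blast
  then have "u = u' + affine_der x" "v = v' + affine_der y" by (simp_all add: algebra_simps)
  then have uv: "affine_prod u v = affine_prod u' v' + affine_der (affine_prod u' y)"
    by (simp add: affine_prod_add_left affine_prod_add_right affine_prod_der_left affine_prod_der_right)
  show "psi (affine_prod u v) = psi (affine_prod u' v')"
    unfolding uv by (simp add: psi_add psi_affine_der)
  show "psi (affine_prod w (affine_prod u v)) = psi (affine_prod w (affine_prod u' v'))"
    unfolding uv by (simp add: psi_add psi_affine_der affine_prod_add_right affine_prod_der_right)
qed

lemma psi_coeff_rel: "(u, v) \<in> coeff_rel \<Longrightarrow> psi u = psi v"
proof -
  assume "(u, v) \<in> coeff_rel"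
  then obtain x where "u - v = affine_der x" unfolding coeff_rel_def by blast
  then have "u = v + affine_der x" by (simp add: algebra_simps)
  then show ?thesis by (simp add: psi_add psi_affine_der)
qed

text \<open>\<open>associative\<close> equates sets obtained as unions over representatives. One
  triple product is a member of the left-hand set; its membership on the right yields other
  representatives, and \<open>psi\<close> does not see the change.\<close>

lemma associative_psi:
  assumes associative
  shows "psi (affine_prod (affine_prod u v) w) = psi (affine_prod u (affine_prod v w))"
proof -
  define cl where "cl = (\<lambda>u. coeff_rel `` {u})"
  have cl: "cl u \<in> Coeff" "u \<in> cl u" for u
    unfolding cl_def Coeff_def using coeff_rel_refl by (auto intro: quotientI)
  have mem: "affine_prod a b \<in> coeff_mult X Y" if "a \<in> X" "b \<in> Y" for a b X Y
    unfolding coeff_mult_def using that by (intro UN_I ImageI[OF coeff_rel_refl]) simp_all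
  have "affine_prod (affine_prod u v) w \<in> coeff_mult (coeff_mult (cl u) (cl v)) (cl w)"
    by (intro mem cl)
  also have "\<dots> = coeff_mult (cl u) (coeff_mult (cl v) (cl w))"
    using assms cl(1) unfolding associative_def by simp
  finally obtain u' v' where 1: "u' \<in> cl u" "v' \<in> coeff_mult (cl v) (cl w)"
      "affine_prod (affine_prod u v) w \<in> coeff_rel `` {affine_prod u' v'}"
    unfolding coeff_mult_def[of "cl u"] by blast
  then obtain v2 w2 where 2: "v2 \<in> cl v" "w2 \<in> cl w" "v' \<in> coeff_rel `` {affine_prod v2 w2}"
    unfolding coeff_mult_def by blast
  have *: "(u, u') \<in> coeff_rel" "(v, v2) \<in> coeff_rel" "(w, w2) \<in> coeff_rel"
      "(affine_prod v2 w2, v') \<in> coeff_rel" "(affine_prod u' v', affine_prod (affine_prod u v) w) \<in> coeff_rel"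
    using 1 2 by (simp_all add: cl_def)
  have "psi (affine_prod (affine_prod u v) w) = psi (affine_prod u' v')" using psi_coeff_rel[OF *(5)] by simp
  also have "\<dots> = psi (affine_prod u (affine_prod v2 w2))" using affine_prod_cong(1)[OF *(1,4)] by simp
  also have "\<dots> = psi (affine_prod u (affine_prod v w))" using affine_prod_cong(2)[OF *(2,3)] by simp
  finally show ?thesis .
qed

text \<open>Both bracketings of f t^m, g t^n, h t^-1 are compared under \<open>psi\<close>. When the
  last two are multiplied first, every term but one ends with a nonnegative exponent and disappears;
  the other bracketing gives the binomial sum.\<close>

theorem associative_identity:
  assumes associative
  shows "cprod m f (cprod n g h) = (\<Sum>j\<le>m. (of_nat (m choose j)) \<cdot> cprod (m + n - j) (cprod j f g) h)"
proof -
  define S where "S = (Poly_Mapping.single :: int \<Rightarrow> 'a \<Rightarrow> _)"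
  have "psi (affine_prod (affine_prod (S (int m) f) (S (int n) g)) (S (- 1) h)) =
      (\<Sum>j\<le>m. psi (mono_prod (int (m + n - j)) ((of_nat (m choose j)) \<cdot> cprod j f g) (- 1) h))"
    unfolding S_def affine_prod_single mono_prod_nat[of m] affine_prod_sum_left psi_sum
    by (intro sum.cong refl) (simp add: of_nat_diff algebra_simps)
  then have L: "psi (affine_prod (affine_prod (S (int m) f) (S (int n) g)) (S (- 1) h)) =
      (\<Sum>j\<le>m. (of_nat (m choose j)) \<cdot> cprod (m + n - j) (cprod j f g) h)"
    by (simp only: psi_mono_prod cprod_scale_left)
  have "psi (affine_prod (S (int m) f) (affine_prod (S (int n) g) (S (- 1) h))) =
      (\<Sum>i\<le>n. psi (mono_prod (int m) f (int n - 1 - int i) ((of_nat (n choose i)) \<cdot> cprod i g h)))"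
    unfolding S_def affine_prod_single mono_prod_nat[of n] affine_prod_sum_right psi_sum
    by (simp add: algebra_simps)
  also have "\<dots> = (\<Sum>i\<le>n. if i = n then cprod m f (cprod n g h) else 0)"
  proof (rule sum.cong)
    fix i assume i: "i \<in> {..n}"
    show "psi (mono_prod (int m) f (int n - 1 - int i) ((of_nat (n choose i)) \<cdot> cprod i g h)) =
        (if i = n then cprod m f (cprod n g h) else 0)"
    proof (cases "i = n")
      case True
      then show ?thesis by (simp add: psi_mono_prod)
    next
      case False
      then have "psi_mono (int m + (int n - 1 - int i) - int j) x = 0" if "j \<le> m" for j x
        using i that by (simp add: psi_mono_def)
      then show ?thesis using False unfolding mono_prod_nat psi_sum psi_single by simp
    qed
  qed simp
  finally show ?thesis using L associative_psi[OF assms] by simp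
qed

end

section \<open>Unital simple conformal algebras\<close>

locale unital_simple_conformal = conformal_algebra scale cprod
  for scale :: "complex poly \<Rightarrow> 'a::ab_group_add \<Rightarrow> 'a"  (infixr \<open>*s\<close> 75)
    and cprod :: "nat \<Rightarrow> 'a \<Rightarrow> 'a \<Rightarrow> 'a" +
  fixes e :: 'a
  assumes assoc: "associative" and simple: "simple" and identity: "conformal_identity e"
begin

lemma unit [simp]: "cprod 0 e f = f"
  using identity unfolding conformal_identity_def by blast

lemma unit_unit_Suc [simp]: "cprod (Suc n) e e = 0"
  using identity unfolding conformal_identity_def by (metis le_add1 plus_1_eq_Suc)

lemma unit_nonzero: "e \<noteq> 0"
  using identity unfolding conformal_identity_def by (metis cprod_zero_left)

lemmas ident = associative_identity[OF assoc]

lemma ident_0: "cprod 0 f (cprod n g h) = cprod n (cprod 0 f g) h"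
  using ident[of 0 f n g h] by simp

text \<open>Each \<open>(a \<circ>\<^sub>n b) \<circ>\<^sub>m h\<close> is \<open>a \<circ>\<^sub>n (b \<circ>\<^sub>m h)\<close> minus a combination of \<open>(a \<circ>\<^sub>j b) \<circ>\<^sub>k h\<close> with \<open>j < n\<close> and
  \<open>k > m\<close>.\<close>

lemma cprod_vanishing_above:
  assumes "\<And>k. m \<le> k \<Longrightarrow> cprod k b h = 0"
  shows "m \<le> k \<Longrightarrow> cprod k (cprod n a b) h = 0"
proof (induction n arbitrary: k rule: less_induct)
  case (less n)
  have "(\<Sum>j\<le>n. of_nat (n choose j) \<cdot> cprod (n + k - j) (cprod j a b) h) = 0"
    using ident[of n a k b h] assms less.prems by simp
  moreover have "(\<Sum>j<n. of_nat (n choose j) \<cdot> cprod (n + k - j) (cprod j a b) h) = 0"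
    using less by (intro sum.neutral) auto
  ultimately show ?case by (simp flip: lessThan_Suc_atMost)
qed

text \<open>The left annihilators form an ideal: left multiples are covered by
  \<open>cprod_vanishing_above\<close> with bound 0, right multiples are 0. It omits
  \<open>e\<close>, so simplicity makes it zero.\<close>

lemma left_annihilator_zero:
  assumes "\<And>n h. cprod n f h = 0"
  shows "f = 0"
proof -
  define I where "I = {f. \<forall>n h. cprod n f h = 0}"
  have "subspace I"
    by (rule subspaceI_der) (auto simp: I_def cprod_add_left cprod_scale_left cprod_der)
  moreover have "cprod n a b \<in> I" "cprod n b a \<in> I" if "b \<in> I" for n a b
    using that cprod_vanishing_above[of 0 b _ _ n a] subspace_0[OF \<open>subspace I\<close>] by (auto simp: I_def)
  ultimately have "ideal I" unfolding ideal_def subalgebra_def by blast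
  then have "I = {0} \<or> I = UNIV" using simple unfolding simple_def by blast
  moreover have "e \<notin> I" using unit[of e] unit_nonzero unfolding I_def by force
  ultimately show ?thesis using assms unfolding I_def by blast
qed

lemma cprod_der_pow:
  "cprod m ((der ^^ j) a) h = (if j \<le> m then ((- 1) ^ j * fact m / fact (m - j)) \<cdot> cprod (m - j) a h else 0)"
proof (induction j arbitrary: m)
  case (Suc j)
  have "cprod m ((der ^^ Suc j) a) h = - (of_nat m \<cdot> cprod (m - 1) ((der ^^ j) a) h)"
    by (simp add: cprod_der)
  also have "\<dots> = (if Suc j \<le> m then ((- 1) ^ Suc j * fact m / fact (m - Suc j)) \<cdot> cprod (m - Suc j) a h else 0)"
  proof (cases m)
    case 0
    then show ?thesis by simp
  next
    case (Suc m')
    have "of_nat m * ((- 1) ^ j * fact m' / fact (m' - j)) = - ((- 1) ^ Suc j * fact m / fact (m - Suc j) :: complex)"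
      by (simp add: Suc)
    then have "- (of_nat m \<cdot> ((- 1) ^ j * fact m' / fact (m' - j)) \<cdot> x) = ((- 1) ^ Suc j * fact m / fact (m - Suc j)) \<cdot> x"
      for x :: 'a
      by (simp only: cs.scale_scale cs.scale_minus_left minus_minus)
    then show ?thesis unfolding Suc.IH by (simp only: Suc diff_Suc_1 Suc_le_mono diff_Suc_Suc) simp
  qed
  finally show ?case .
qed simp

text \<open>Divided powers of - \<partial>, normalised so that on a left factor they lower the order
  with exactly the binomial coefficients of the associativity identity.\<close>

definition dpow :: "nat \<Rightarrow> 'a \<Rightarrow> 'a"
  where "dpow j a = ((- 1) ^ j / fact j) \<cdot> (der ^^ j) a"

lemma dpow_0 [simp]: "dpow j 0 = 0" "dpow 0 a = a"
  by (simp_all add: dpow_def)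

lemma cprod_dpow: "cprod m (dpow j a) h = of_nat (m choose j) \<cdot> cprod (m - j) a h"
proof (cases "j \<le> m")
  case True
  have "((- 1) ^ j / fact j) * ((- 1) ^ j * fact m / fact (m - j)) = (of_nat (m choose j) :: complex)"
  proof -
    have "(- 1) ^ j * (- 1) ^ j = (1 :: complex)" by (simp flip: power_mult_distrib)
    moreover have "((- 1) ^ j / fact j) * ((- 1) ^ j * fact m / fact (m - j)) =
        ((- 1) ^ j * (- 1) ^ j) * (fact m / (fact j * fact (m - j)) :: complex)" by (simp add: field_simps)
    ultimately show ?thesis using True by (simp add: binomial_fact)
  qed
  then show ?thesis
    unfolding dpow_def cprod_scale_left cprod_der_pow using True by (simp only: if_True cs.scale_scale)
qed (simp add: dpow_def cprod_scale_left cprod_der_pow binomial_eq_0)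

text \<open>The associativity identity with \<open>g = e\<close> and \<open>n = 0\<close> writes
  \<open>cprod m f h\<close> through the products of the \<open>cprod j f e\<close> with
  \<open>h\<close>, and \<open>cprod_dpow\<close> gives the same sum for the right-hand
  side.\<close>

lemma expansion:
  assumes "\<And>j. n \<le> j \<Longrightarrow> cprod j f e = 0"
  shows "f = (\<Sum>j<n. dpow j (cprod j f e))"
proof -
  have "f - (\<Sum>j<n. dpow j (cprod j f e)) = 0"
  proof (rule left_annihilator_zero)
    fix m h
    have "cprod m f h = (\<Sum>j\<le>m. of_nat (m choose j) \<cdot> cprod (m - j) (cprod j f e) h)"
      using ident[of m f 0 e h] by simp
    also have "\<dots> = (\<Sum>j<max n (Suc m). of_nat (m choose j) \<cdot> cprod (m - j) (cprod j f e) h)"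
      by (intro sum.mono_neutral_left) (auto simp: binomial_eq_0)
    also have "\<dots> = (\<Sum>j<n. of_nat (m choose j) \<cdot> cprod (m - j) (cprod j f e) h)"
      using assms by (intro sum.mono_neutral_right) auto
    finally show "cprod m (f - (\<Sum>j<n. dpow j (cprod j f e))) h = 0"
      using cprod_add_left[of m f "- (\<Sum>j<n. dpow j (cprod j f e))" h]
      by (simp add: cprod_sum_left cprod_dpow)
  qed
  then show ?thesis by simp
qed

section \<open>The algebra B and its derivation\<close>

definition B :: "'a set"
  where "B = {b. \<forall>n. cprod (Suc n) b e = 0}"

text \<open>The sign matches the factor (-1)^m in the products of the conformal Weyl algebra, so
  that \<open>D\<close> corresponds to d/dx.\<close>

definition D :: "'a \<Rightarrow> 'a"
  where "D a = - cprod 1 e a"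

lemma unit_right: "b \<in> B \<Longrightarrow> cprod 0 b e = b"
proof -
  assume "b \<in> B"
  then have "cprod j b e = 0" if "1 \<le> j" for j using that by (cases j) (simp_all add: B_def)
  from expansion[of 1, OF this] show ?thesis by simp
qed

lemma cprod_unit_B: "b \<in> B \<Longrightarrow> cprod n b e = (if n = 0 then b else 0)"
  using unit_right by (cases n) (auto simp: B_def)

lemma cprod_B: "b \<in> B \<Longrightarrow> cprod n a b \<in> B"
proof -
  assume "b \<in> B"
  then have "cprod j b e = 0" if "1 \<le> j" for j using that by (cases j) (simp_all add: B_def)
  from cprod_vanishing_above[of 1, OF this] show ?thesis by (simp add: B_def)
qed

lemma unit_B: "e \<in> B" by (simp add: B_def)

text \<open>Left products by \<open>e\<close> add their orders, since \<open>cprod 1 e e = 0\<close>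
  leaves one term of the associativity identity.\<close>

lemma D_pow: "(D ^^ n) a = (- 1) ^ n \<cdot> cprod n e a"
proof (induction n)
  case (Suc n)
  have "cprod 1 e (cprod n e a) = cprod (Suc n) e a"
    using ident[of 1 e n e a] by simp
  then have "D ((- 1) ^ n \<cdot> cprod n e a) = (- 1) ^ Suc n \<cdot> cprod (Suc n) e a"
    by (simp add: D_def cprod_scale_right)
  then show ?case by (simp add: Suc)
qed simp

lemma cprod_D: "a \<in> B \<Longrightarrow> cprod n a b = (- 1) ^ n \<cdot> cprod 0 a ((D ^^ n) b)"
  using ident_0[of a n e b] by (simp add: D_pow cprod_scale_right unit_right flip: power_mult_distrib)

text \<open>\<partial> moves out of either factor at the cost of products of lower order, so the
  claim for all orders at once passes from generating sets to their
  \<complex>[\<partial>]-spans.\<close>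

lemma cprod_cspan_induct:
  assumes V: "subspace V"
    and base: "\<And>n a b. a \<in> S \<Longrightarrow> b \<in> T \<Longrightarrow> cprod n a b \<in> V"
    and "a \<in> span S" "b \<in> span T"
  shows "cprod n a b \<in> V"
proof -
  have der: "der x \<in> V" if "x \<in> V" for x using subspace_scale[OF V that] by (simp add: der_def)
  have *: "cprod n a b \<in> V" if "b \<in> T" for n b
  proof -
    have "subspace {a. \<forall>n. cprod n a b \<in> V}"
      by (rule subspaceI_der)
        (simp_all add: cprod_add_left cprod_scale_left cprod_der subspace_0 subspace_add subspace_scale subspace_neg V)
    then have "span S \<subseteq> {a. \<forall>n. cprod n a b \<in> V}" using base that by (intro span_minimal) auto
    then show ?thesis using assms(3) by blast
  qed
  have "subspace {b. \<forall>n. cprod n a b \<in> V}"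
    by (rule subspaceI_der)
      (simp_all add: cprod_add_right cprod_scale_right cprod_der_right subspace_0 subspace_add subspace_scale der V)
  then have "span T \<subseteq> {b. \<forall>n. cprod n a b \<in> V}" using * by (intro span_minimal) auto
  then show ?thesis using assms(4) by blast
qed

lemma span_B: "span B = UNIV"
proof -
  have "f \<in> span B" for f
  proof -
    obtain n where "\<And>j. n \<le> j \<Longrightarrow> cprod j f e = 0" using locality by blast
    then have "f = (\<Sum>j<n. dpow j (cprod j f e))" by (rule expansion)
    moreover have "(der ^^ j) x \<in> span B" if "x \<in> span B" for j x
      using that by (induction j) (auto simp: der_def intro: span_scale)
    moreover have "(\<Sum>j<n. dpow j (cprod j f e)) \<in> span B"
      unfolding dpow_def using calculation(2) cprod_B[OF unit_B] by (intro span_sum span_scale) (blast intro: span_base)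
    ultimately show ?thesis by simp
  qed
  then show ?thesis by blast
qed

lemma csubspace_B: "cs.subspace B"
  by (rule cs.subspaceI) (auto simp: B_def cprod_add_left cprod_scale_left)

text \<open>By \<open>cprod_D\<close> the \<complex>[\<partial>]-span of \<open>J\<close> is an
  ideal of C. If it is everything, right products with \<open>e\<close>, which extract coefficients,
  bring every element of \<open>B\<close> back into \<open>J\<close>.\<close>

lemma differentially_simple:
  assumes J: "cs.subspace J" "J \<subseteq> B" "\<And>a j. a \<in> B \<Longrightarrow> j \<in> J \<Longrightarrow> cprod 0 a j \<in> J \<and> cprod 0 j a \<in> J"
    "\<And>j. j \<in> J \<Longrightarrow> D j \<in> J"
  shows "J = {0} \<or> J = B"
proof -
  have DJ: "(D ^^ n) j \<in> J" if "j \<in> J" for n j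
  proof (induction n)
    case (Suc n)
    then show ?case using J(4)[of "(D ^^ n) j"] by simp
  qed (simp add: that)
  have DB: "(D ^^ n) b \<in> B" if "b \<in> B" for n b
    unfolding D_pow using cprod_B[OF that] cs.subspace_scale[OF csubspace_B] by blast
  have "ideal (span J)"
  proof -
    have sp: "subspace (span J)" by simp
    have JJ: "cprod n b j \<in> span J" "cprod n j b \<in> span J" if "b \<in> B" "j \<in> J" for n b j
    proof -
      have jB: "j \<in> B" using that J(2) by blast
      have "cprod n b j \<in> J" unfolding cprod_D[OF that(1), of n j] using J(3)[OF that(1) DJ[OF that(2)]] by (simp add: cs.subspace_scale[OF J(1)])
      moreover have "cprod n j b \<in> J" unfolding cprod_D[OF jB, of n b] using J(3)[OF DB[OF that(1)] that(2)] by (simp add: cs.subspace_scale[OF J(1)])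
      ultimately show "cprod n b j \<in> span J" "cprod n j b \<in> span J" by (auto intro: span_base)
    qed
    have aB: "a \<in> span B" for a by (simp add: span_B)
    have left: "cprod n a x \<in> span J" if "x \<in> span J" for n a x
      by (rule cprod_cspan_induct[where S = B and T = J]) (rule sp aB that JJ(1) | assumption)+
    have right: "cprod n x a \<in> span J" if "x \<in> span J" for n a x
      by (rule cprod_cspan_induct[where S = J and T = B]) (rule sp aB that JJ(2) | assumption)+
    show ?thesis unfolding ideal_def subalgebra_def by (simp add: left right)
  qed
  then have "span J = {0} \<or> span J = UNIV" using simple unfolding simple_def by blast
  then show ?thesis
  proof
    assume "span J = {0}"
    then show ?thesis using span_superset[of J] cs.subspace_0[OF J(1)] by auto
  next
    assume U: "span J = UNIV"
    have "subspace {f. \<forall>m. cprod m f e \<in> J}"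
      by (rule subspaceI_der)
        (simp_all add: cprod_add_left cprod_scale_left cprod_der
          cs.subspace_0 cs.subspace_add cs.subspace_scale cs.subspace_neg J(1))
    moreover have "J \<subseteq> {f. \<forall>m. cprod m f e \<in> J}"
      using J(2) cs.subspace_0[OF J(1)] by (auto simp: cprod_unit_B)
    ultimately have "span J \<subseteq> {f. \<forall>m. cprod m f e \<in> J}" by (intro span_minimal)
    then have all: "cprod m f e \<in> J" for m f unfolding U by blast
    have "B \<subseteq> J"
    proof
      fix b assume "b \<in> B"
      then show "b \<in> J" using all[of 0 b] by (simp add: unit_right)
    qed
    then show ?thesis using J(2) by blast
  qed
qed

sublocale alg: diff_algebra cscale "cprod 0" e B D
proof (intro diff_algebra.intro unital_subalgebra.intro unital_subalgebra_axioms.intro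
    diff_algebra_axioms.intro vector_space_cscale)
  fix a b :: 'a and c
  show "D (a + b) = D a + D b" by (simp add: D_def cprod_add_right)
  show "D (c \<cdot> a) = c \<cdot> D a" by (simp add: D_def cprod_scale_right)
  show "a \<in> B \<Longrightarrow> D a \<in> B" using cprod_B[of a 1 e] cs.subspace_neg[OF csubspace_B] by (simp add: D_def)
  show "\<exists>n. (D ^^ n) a = 0" using locality[of e a] by (auto simp: D_pow)
  \<comment> \<open>The identity for orders 1 and 0 reads \<open>cprod 1 e (cprod 0 a b) = cprod 1 a
    b + cprod 0 (cprod 1 e a) b\<close>, and \<open>cprod_D\<close> rewrites the first term.\<close>
  show "D (cprod 0 a b) = cprod 0 (D a) b + cprod 0 a (D b)" if "a \<in> B" "b \<in> B"
    using ident[of 1 e 0 a b] cprod_D[OF that(1), of 1 b] by (simp add: D_def)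
  show "cprod 0 (cprod 0 a b) d = cprod 0 a (cprod 0 b d)" for d by (rule ident_0[symmetric])
qed (simp_all add: cprod_add_left cprod_add_right cprod_scale_left cprod_scale_right csubspace_B
    cprod_B unit_B unit_right unit_nonzero differentially_simple)

text \<open>Each \<partial> lowers the order by one, and \<open>b\<close> has no product of positive
  order with \<open>e\<close>, so exactly the term of degree \<open>m\<close> survives.\<close>

lemma coefficient_extraction:
  assumes "b \<in> B"
  shows "cprod m (scale p b) e = ((- 1) ^ m * fact m * poly.coeff p m) \<cdot> b"
proof (induction p arbitrary: m)
  case (pCons c p)
  have "cprod m (scale (pCons c p) b) e = c \<cdot> cprod m b e - of_nat m \<cdot> cprod (m - 1) (scale p b) e"
    by (simp only: pCons_scale[of c p b] cprod_add_left cprod_scale_left cprod_der) simp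
  then show ?case
    using assms by (cases m) (simp_all add: pCons.IH cprod_unit_B)
qed simp

text \<open>Turns dimension over \<complex> in \<open>B\<close> into rank over
  \<complex>[\<partial>] in C, which the growth hypothesis measures; coefficients are compared
  degree by degree.\<close>

lemma independent_over_poly:
  assumes "X \<subseteq> B" "cs.independent X"
  shows "independent X"
  unfolding dependent_explicit
proof (intro notI, elim exE conjE bexE)
  fix T p x assume T: "finite T" "T \<subseteq> X" "(\<Sum>v\<in>T. scale (p v) v) = 0" "x \<in> T" "p x \<noteq> 0"
  have "poly.coeff (p x) m = 0" for m
  proof -
    have "0 = cprod m (\<Sum>v\<in>T. scale (p v) v) e" using T by simp
    also have "\<dots> = (\<Sum>v\<in>T. ((- 1) ^ m * fact m * poly.coeff (p v) m) \<cdot> v)"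
      unfolding cprod_sum_left using T assms by (intro sum.cong refl coefficient_extraction) auto
    finally have "(- 1) ^ m * fact m * poly.coeff (p x) m = 0"
      using assms(2) T unfolding cs.independent_explicit_module by metis
    then show ?thesis by simp
  qed
  then have "p x = 0" by (intro poly_eqI) simp
  with T show False by simp
qed

end

section \<open>Ranks of the filtration\<close>

context conformal_algebra
begin

lemma is_product_pos: "is_product F k a \<Longrightarrow> 0 < k"
  by (induction rule: is_product.induct) auto

text \<open>Locality leaves finitely many products of two given factors, and both factors involve
  fewer generators than the product.\<close>

lemma finite_products:
  assumes "finite F"
  shows "finite {a. is_product F k a}"
proof (induction k rule: less_induct)
  case (less k)
  define T where "T = F \<union> (\<Union>r\<in>{1..<k}. \<Union>b\<in>{b. is_product F r b}. \<Union>c\<in>{c. is_product F (k - r) c}. range (\<lambda>n. cprod n b c))"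
  have "finite (range (\<lambda>n. cprod n b c))" for b c
  proof -
    obtain n0 where "\<And>n. n0 \<le> n \<Longrightarrow> cprod n b c = 0" using locality by blast
    then have "range (\<lambda>n. cprod n b c) \<subseteq> insert 0 ((\<lambda>n. cprod n b c) ` {..<n0})"
      by (auto simp: image_iff) (metis not_le lessThan_iff)
    then show ?thesis by (rule finite_subset) simp
  qed
  then have "finite T" unfolding T_def using assms less by auto
  moreover have "{a. is_product F k a} \<subseteq> T"
  proof
    fix a assume "a \<in> {a. is_product F k a}"
    then have "is_product F k a" by simp
    then show "a \<in> T"
    proof cases
      case (product r b s c n)
      then have "r \<in> {1..<k}" "k - r = s" using is_product_pos[of F r b] is_product_pos[of F s c] by auto
      then show ?thesis unfolding T_def using product by blast
    qed (simp add: T_def)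
  qed
  ultimately show ?case by (rule finite_subset[rotated])
qed

lemma filtration_finite:
  assumes "finite F"
  shows "\<exists>T. finite T \<and> filtration F r = span T"
proof -
  have "{a. \<exists>k\<le>r. is_product F k a} = (\<Union>k\<le>r. {a. is_product F k a})" by blast
  then have "finite {a. \<exists>k\<le>r. is_product F k a}" using finite_products[OF assms] by simp
  then show ?thesis unfolding filtration_def by blast
qed

lemma filtration_mono: "r \<le> s \<Longrightarrow> filtration F r \<subseteq> filtration F s"
  unfolding filtration_def by (intro span_mono) (auto intro: le_trans)

lemma card_le_rank:
  assumes "finite F" "finite X" "X \<subseteq> filtration F r" "independent X"
  shows "card X \<le> rank (filtration F r)"
proof -
  obtain T where T: "finite T" "filtration F r = span T" using filtration_finite[OF assms(1)] by blast
  have "bdd_above {card B | B. finite B \<and> B \<subseteq> filtration F r \<and> independent B}"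
    using independent_card_le_spanning[OF module_axioms T(1)] unfolding T(2)
    by (intro bdd_aboveI[of _ "card T"]) blast
  then show ?thesis unfolding rank_def using assms by (intro cSup_upper) auto
qed

lemma rank_le:
  assumes "finite T" "span T = UNIV"
  shows "rank S \<le> card T"
proof -
  have "{card B | B. finite B \<and> B \<subseteq> S \<and> independent B} \<noteq> {}"
    using independent_empty by (auto intro!: exI[of _ "{}"])
  then show ?thesis unfolding rank_def
    using independent_card_le_spanning[OF module_axioms assms(1)] assms(2)
    by (intro cSup_least) auto
qed

end

section \<open>Consequences of growth one\<close>

locale linear_growth_conformal = unital_simple_conformal scale cprod e
  for scale :: "complex poly \<Rightarrow> 'a::ab_group_add \<Rightarrow> 'a"
    and cprod :: "nat \<Rightarrow> 'a \<Rightarrow> 'a \<Rightarrow> 'a" and e :: 'a +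
  fixes F :: "'a set"
  assumes finite_F: "finite F" and generates: "generates F" and GKdim: "GKdim_wrt F = 1"
begin

lemma filtration_cprod:
  assumes "a \<in> filtration F r" "b \<in> filtration F s"
  shows "cprod n a b \<in> filtration F (r + s)"
proof (rule cprod_cspan_induct)
  show "a \<in> span {a. \<exists>k\<le>r. is_product F k a}" "b \<in> span {a. \<exists>k\<le>s. is_product F k a}"
    using assms by (simp_all add: filtration_def)
  fix n a b assume "a \<in> {a. \<exists>k\<le>r. is_product F k a}" "b \<in> {a. \<exists>k\<le>s. is_product F k a}"
  then obtain k l where "k \<le> r" "is_product F k a" "l \<le> s" "is_product F l b" by blast
  then have "k + l \<le> r + s" "is_product F (k + l) (cprod n a b)" by (auto intro: is_product.product)
  then show "cprod n a b \<in> filtration F (r + s)" unfolding filtration_def by (intro span_base) blast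
qed (simp add: filtration_def)

lemma filtration_exhausts: "\<exists>r. a \<in> filtration F r"
proof -
  define U where "U = (\<Union>r. filtration F r)"
  have sub: "subspace (filtration F r)" for r by (simp add: filtration_def)
  have join: "\<exists>t. x \<in> filtration F t \<and> y \<in> filtration F t" if xy: "x \<in> U" "y \<in> U" for x y
  proof -
    obtain r s where "x \<in> filtration F r" "y \<in> filtration F s" using xy by (auto simp: U_def)
    then show ?thesis using filtration_mono[of r "max r s" F] filtration_mono[of s "max r s" F]
      by (intro exI[of _ "max r s"]) auto
  qed
  have "subspace U"
  proof (rule subspaceI)
    show "0 \<in> U" using subspace_0[OF sub] by (auto simp: U_def)
  next
    fix x y assume "x \<in> U" "y \<in> U"
    then obtain t where "x \<in> filtration F t" "y \<in> filtration F t" using join by blast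
    then show "x + y \<in> U" using subspace_add[OF sub] by (auto simp: U_def)
  next
    fix c x assume "x \<in> U"
    then show "scale c x \<in> U" using subspace_scale[OF sub] by (auto simp: U_def)
  qed
  moreover have "cprod n x y \<in> U" if "x \<in> U" "y \<in> U" for n x y
    using join[OF that] filtration_cprod unfolding U_def by blast
  ultimately have "subalgebra U" by (simp add: subalgebra_def)
  moreover have "F \<subseteq> U"
  proof
    fix f assume "f \<in> F"
    then have "is_product F 1 f" by (rule is_product.generator)
    then have "f \<in> filtration F 1"
      unfolding filtration_def by (intro span_base) blast
    then show "f \<in> U" by (auto simp: U_def)
  qed
  ultimately have "subalgebra hull F \<subseteq> U" by (intro hull_minimal)
  then show ?thesis using generates by (auto simp: generates_def U_def)
qed

text \<open>The exponent 3/2 is a choice strictly between the dimension 1 and the exponent 2 of the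
  gap theorem.\<close>

lemma rank_growth:
  "eventually (\<lambda>r. real (rank (filtration F r)) < real r powr (3/2)) sequentially"
proof -
  have "limsup (\<lambda>r. ereal (ln (real (rank (filtration F r))) / ln (real r))) < ereal (3/2)"
    using GKdim by (simp add: GKdim_wrt_def one_ereal_def)
  then have "eventually (\<lambda>r. ereal (ln (real (rank (filtration F r))) / ln (real r)) < ereal (3/2)) sequentially"
    by (rule Limsup_lessD)
  moreover have "eventually (\<lambda>r::nat. 2 \<le> r) sequentially" by (rule eventually_ge_at_top)
  ultimately show ?thesis
  proof eventually_elim
    case (elim r)
    show ?case
    proof (cases "rank (filtration F r) = 0")
      case True
      then show ?thesis using elim by simp
    next
      case False
      have "0 < ln (real r)" using elim by simp
      then have "ln (real (rank (filtration F r))) < 3/2 * ln (real r)" using elim by (simp add: field_simps)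
      also have "\<dots> = ln (real r powr (3/2))" using elim by (simp add: ln_powr)
      finally have "ln (real (rank (filtration F r))) < ln (real r powr (3/2))" .
      then show ?thesis using False elim by (subst (asm) ln_less_cancel_iff) auto
    qed
  qed
qed

text \<open>A finite basis of \<open>B\<close> over \<complex> would span C over
  \<complex>[\<partial>], bound all ranks and force the dimension to be at most 0.\<close>

lemma infinite_dimensional: "\<exists>x. (\<forall>j. x j \<in> B) \<and> alg.indep_mod {0} x {..<M::nat}"
proof (rule ccontr)
  assume no: "\<not> ?thesis"
  obtain b where b: "b \<subseteq> B" "cs.independent b" "B \<subseteq> cs.span b"
    using cs.maximal_independent_subset[of B] by blast
  have "finite b"
  proof (rule ccontr)
    assume "infinite b"
    then obtain T where T: "finite T" "card T = M" "T \<subseteq> b" using infinite_arbitrarily_large by blast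
    obtain x where x: "bij_betw x {..<M} T"
      using ex_bij_betw_nat_finite[OF T(1)] T(2) by (auto simp: atLeast0LessThan)
    define y where "y = (\<lambda>j. if j < M then x j else 0)"
    have "y j \<in> B" for j
      using x T(3) b(1) cs.subspace_0[OF csubspace_B] by (auto simp: y_def bij_betw_def)
    moreover have "alg.indep_mod {0} y {..<M}"
      unfolding alg.indep_mod_def
    proof (intro allI impI ballI)
      fix c i assume c: "(\<Sum>i<M. c i \<cdot> y i) \<in> {0}" and i: "i \<in> {..<M}"
      define c' where "c' = (\<lambda>t. c (inv_into {..<M} x t))"
      have c': "c' (x i) = c i" if "i < M" for i
        using x that by (simp add: c'_def bij_betw_def)
      have "(\<Sum>t\<in>T. c' t \<cdot> t) = (\<Sum>i<M. c' (x i) \<cdot> x i)"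
        by (rule sum.reindex_bij_betw[OF x, symmetric])
      also have "\<dots> = (\<Sum>i<M. c i \<cdot> y i)" by (intro sum.cong) (auto simp: c' y_def)
      finally have "(\<Sum>t\<in>T. c' t \<cdot> t) = 0" using c by simp
      moreover have "x i \<in> T" using x i by (auto simp: bij_betw_def)
      ultimately have "c' (x i) = 0"
        using b(2) T unfolding cs.independent_explicit_module by blast
      then show "c i = 0" using c' i by simp
    qed
    ultimately show False using no by blast
  qed
  have "subspace (span b)" by simp
  then have "cs.subspace (span b)" by (auto intro!: cs.subspaceI subspace_0 subspace_add subspace_scale)
  then have "cs.span b \<subseteq> span b" by (intro cs.span_minimal) (auto intro: span_base)
  then have "span B \<subseteq> span b" using b(3) by (intro span_minimal) auto
  then have "span b = UNIV" using span_B by auto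
  then have R: "rank (filtration F r) \<le> card b" for r using rank_le[OF \<open>finite b\<close>] by blast
  have "eventually (\<lambda>r. ereal (ln (real (rank (filtration F r))) / ln (real r)) \<le>
      ereal (ln (real (Suc (card b))) / ln (real r))) sequentially"
    using eventually_ge_at_top[of "2::nat"]
  proof eventually_elim
    case (elim r)
    have "ln (real (rank (filtration F r))) \<le> ln (real (Suc (card b)))"
    proof (cases "rank (filtration F r) = 0")
      case False
      then show ?thesis using R[of r] by (subst ln_le_cancel_iff) auto
    qed simp
    then show ?case using elim by (simp add: divide_right_mono)
  qed
  then have "GKdim_wrt F \<le> limsup (\<lambda>r. ereal (ln (real (Suc (card b))) / ln (real r)))"
    unfolding GKdim_wrt_def by (rule Limsup_mono)
  also have "\<dots> = 0"
  proof (rule lim_imp_Limsup)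
    have "(\<lambda>r::nat. ln (real (Suc (card b))) / ln (real r)) \<longlonglongrightarrow> 0"
      by real_asymp
    then show "(\<lambda>r::nat. ereal (ln (real (Suc (card b))) / ln (real r))) \<longlonglongrightarrow> 0"
      by (simp add: zero_ereal_def)
  qed simp
  finally show False using GKdim by simp
qed

text \<open>The expansion coefficients of the generators, closed under \<open>D\<close>: products of
  higher order in C involve powers of \<open>D\<close>, whereas words are formed with
  \<open>cprod 0\<close> alone.\<close>

definition letters :: "'a set"
  where "letters = {(D ^^ k) (cprod j f e) | f j k. f \<in> F}"

lemma letters_B: "letters \<subseteq> B"
  unfolding letters_def using alg.D_pow_B cprod_B[OF unit_B] by blast

lemma finite_letters: "finite letters"
proof -
  have "finite {(D ^^ k) (cprod j f e) | j k. True}" for f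
  proof -
    obtain n where n: "\<And>j. n \<le> j \<Longrightarrow> cprod j f e = 0" using locality by blast
    have "\<forall>j. \<exists>m. \<forall>k\<ge>m. (D ^^ k) (cprod j f e) = 0"
      using alg.D_nilpotent_above cprod_B[OF unit_B] by blast
    then obtain m where m: "\<And>j k. m j \<le> k \<Longrightarrow> (D ^^ k) (cprod j f e) = 0" by metis
    have "{(D ^^ k) (cprod j f e) | j k. True} \<subseteq> insert 0 (\<Union>j<n. (\<lambda>k. (D ^^ k) (cprod j f e)) ` {..<m j})"
    proof
      fix x assume "x \<in> {(D ^^ k) (cprod j f e) | j k. True}"
      then obtain j k where x: "x = (D ^^ k) (cprod j f e)" by blast
      show "x \<in> insert 0 (\<Union>j<n. (\<lambda>k. (D ^^ k) (cprod j f e)) ` {..<m j})"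
      proof (cases "j < n \<and> k < m j")
        case True
        then show ?thesis using x by blast
      next
        case False
        then have "x = 0" using x n[of j] m[of j k] by (cases "j < n") auto
        then show ?thesis by simp
      qed
    qed
    then show ?thesis by (rule finite_subset) simp
  qed
  moreover have "letters = (\<Union>f\<in>F. {(D ^^ k) (cprod j f e) | j k. True})"
    unfolding letters_def by blast
  ultimately show ?thesis using finite_F by simp
qed

lemma D_letters: "a \<in> letters \<Longrightarrow> D a \<in> letters"
proof -
  assume "a \<in> letters"
  then obtain k j f where "f \<in> F" "a = (D ^^ k) (cprod j f e)" unfolding letters_def by blast
  then have "f \<in> F" "D a = (D ^^ Suc k) (cprod j f e)" by simp_all
  then show ?thesis unfolding letters_def by blast
qed

context
  fixes v :: "nat \<Rightarrow> 'a" and k :: nat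
  assumes v: "letters = v ` {..<k}"
begin

interpretation gen: generated_algebra cscale "cprod 0" e B v k
proof
  show "v i \<in> B" if "i < k" for i using letters_B v that by blast
qed

text \<open>\<open>D\<close> maps letters to letters, so by the Leibniz rule it does not raise word
  length.\<close>

lemma filt_D: "a \<in> gen.filt n \<Longrightarrow> D a \<in> gen.filt n"
proof -
  have word: "D (gen.word w) \<in> gen.filt (length w)" if "w \<in> gen.words" for w using that
  proof (induction w)
    case Nil
    then show ?case using cs.subspace_0[OF gen.subspace_filt] by simp
  next
    case (Cons i w)
    then have i: "i < k" "w \<in> gen.words" by (auto simp: gen.words_def)
    have "v i \<in> letters" using v i by blast
    then have "D (v i) \<in> letters" by (rule D_letters)
    then obtain i' where i': "i' < k" "D (v i) = v i'" using v by auto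
    have filt1: "v i \<in> gen.filt 1" if "i < k" for i
      using gen.word_filt[of "[i]"] that gen.generators by (simp add: gen.words_def unit_right)
    have "cprod 0 (D (v i)) (gen.word w) \<in> gen.filt (1 + length w)"
      using gen.mul_filt[OF filt1[OF i'(1)] gen.word_filt[OF i(2)]] i'(2) by simp
    moreover have "cprod 0 (v i) (D (gen.word w)) \<in> gen.filt (1 + length w)"
      using gen.mul_filt[OF filt1[OF i(1)] Cons.IH[OF i(2)]] .
    ultimately have "cprod 0 (D (v i)) (gen.word w) + cprod 0 (v i) (D (gen.word w)) \<in> gen.filt (1 + length w)"
      by (rule cs.subspace_add[OF gen.subspace_filt])
    then show ?case using alg.D_mul[OF gen.generators[OF i(1)] gen.word_B[OF i(2)]] by simp
  qed
  assume "a \<in> gen.filt n"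
  then show ?thesis unfolding gen.filt_def[of n]
  proof (induction rule: cs.span_induct)
    case (step x)
    then obtain w where "w \<in> gen.words" "length w \<le> n" "x = gen.word w" by blast
    then show ?case using word gen.filt_mono unfolding gen.filt_def[symmetric] by blast
  next
    case base
    show ?case unfolding gen.filt_def[symmetric] using gen.subspace_filt[of n]
      by (intro cs.subspaceI)
        (simp_all add: alg.D_add alg.D_scale cs.subspace_0 cs.subspace_add cs.subspace_scale)
  qed
qed

text \<open>The union \<open>A\<close> of the filtration is \<open>D\<close>-stable and closed under
  \<open>cprod 0\<close>, so its \<complex>[\<partial>]-span is a conformal subalgebra containing
  \<open>F\<close>, hence C. Right products with \<open>e\<close> then return every element of
  \<open>B\<close> to \<open>A\<close>.\<close>

lemma filt_exhausts: "B \<subseteq> (\<Union>n. gen.filt n)"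
proof -
  define A where "A = (\<Union>n. gen.filt n)"
  have AB: "A \<subseteq> B" using gen.filt_B by (auto simp: A_def)
  have Dpow: "(D ^^ m) a \<in> A" if "a \<in> A" for m a
    using that
  proof (induction m)
    case (Suc m)
    then obtain n where "(D ^^ m) a \<in> gen.filt n" by (auto simp: A_def)
    then have "D ((D ^^ m) a) \<in> gen.filt n" by (rule filt_D)
    then show ?case by (auto simp: A_def)
  qed simp
  have scaleA: "c \<cdot> a \<in> A" if "a \<in> A" for a c
    using that cs.subspace_scale[OF gen.subspace_filt] by (auto simp: A_def)
  have cprodA: "cprod n a b \<in> span A" if ab: "a \<in> A" "b \<in> A" for n a b
  proof -
    obtain r s where "a \<in> gen.filt r" "(D ^^ n) b \<in> gen.filt s"
      using ab(1) Dpow[OF ab(2), of n] by (auto simp: A_def)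
    then have "cprod 0 a ((D ^^ n) b) \<in> gen.filt (r + s)" by (rule gen.mul_filt)
    then have "cprod 0 a ((D ^^ n) b) \<in> A" by (auto simp: A_def)
    then have "(- 1) ^ n \<cdot> cprod 0 a ((D ^^ n) b) \<in> A" by (rule scaleA)
    moreover have "cprod n a b = (- 1) ^ n \<cdot> cprod 0 a ((D ^^ n) b)"
      using ab(1) AB by (intro cprod_D) blast
    ultimately show ?thesis by (simp add: span_base)
  qed
  have "subalgebra (span A)"
    unfolding subalgebra_def using cprod_cspan_induct[where S = A and T = A, OF _ cprodA] by simp
  moreover have "F \<subseteq> span A"
  proof
    fix f assume f: "f \<in> F"
    have "cprod j f e \<in> A" for j
    proof -
      have "(D ^^ 0) (cprod j f e) \<in> letters" unfolding letters_def using f by blast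
      then obtain i where i: "i < k" "cprod j f e = v i" using v by auto
      then have "cprod j f e \<in> gen.filt 1"
        using gen.word_filt[of "[i]"] gen.generators by (simp add: gen.words_def unit_right)
      then show ?thesis by (auto simp: A_def)
    qed
    have dpowA: "dpow j (cprod j f e) \<in> span A" for j
    proof -
      have "(der ^^ m) x \<in> span A" if "x \<in> span A" for m x
        using that by (induction m) (auto simp: der_def intro: span_scale)
      then show ?thesis unfolding dpow_def using \<open>\<And>j. cprod j f e \<in> A\<close> by (intro span_scale) (blast intro: span_base)
    qed
    obtain n where "\<And>j. n \<le> j \<Longrightarrow> cprod j f e = 0" using locality by blast
    then have "f = (\<Sum>j<n. dpow j (cprod j f e))" by (rule expansion)
    moreover have "(\<Sum>j<n. dpow j (cprod j f e)) \<in> span A" by (intro span_sum dpowA)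
    ultimately show "f \<in> span A" by simp
  qed
  ultimately have "subalgebra hull F \<subseteq> span A" by (intro hull_minimal)
  then have U: "span A = UNIV" using generates by (auto simp: generates_def)
  have subA: "cs.subspace A"
  proof (rule cs.subspaceI)
    show "0 \<in> A" using cs.subspace_0[OF gen.subspace_filt] by (auto simp: A_def)
  next
    fix x y assume "x \<in> A" "y \<in> A"
    then obtain r s where "x \<in> gen.filt r" "y \<in> gen.filt s" by (auto simp: A_def)
    then have "x \<in> gen.filt (max r s)" "y \<in> gen.filt (max r s)"
      using gen.filt_mono[of r "max r s"] gen.filt_mono[of s "max r s"] by auto
    then show "x + y \<in> A" using cs.subspace_add[OF gen.subspace_filt] by (auto simp: A_def)
  qed (rule scaleA)
  have "subspace {f. \<forall>m. cprod m f e \<in> A}"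
    by (rule subspaceI_der)
      (simp_all add: cprod_add_left cprod_scale_left cprod_der cs.subspace_0[OF subA]
        cs.subspace_add[OF subA] scaleA cs.subspace_neg[OF subA])
  moreover have "A \<subseteq> {f. \<forall>m. cprod m f e \<in> A}"
    using AB cs.subspace_0[OF subA] by (auto simp: cprod_unit_B)
  ultimately have "span A \<subseteq> {f. \<forall>m. cprod m f e \<in> A}" by (intro span_minimal)
  then have all: "cprod m f e \<in> A" for m f unfolding U by blast
  show ?thesis
  proof
    fix b assume "b \<in> B"
    then show "b \<in> (\<Union>n. gen.filt n)" using all[of 0 b] by (simp add: unit_right A_def)
  qed
qed

text \<open>A word is the product of its letters and a final \<open>e\<close>; one \<open>s\<close>
  bounds the filtration degree of all of these, hence the factor \<open>n + 1\<close>.\<close>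

lemma filt_subset_filtration: "\<exists>s>0. \<forall>n. gen.filt n \<subseteq> filtration F (s * (n + 1))"
proof -
  have "\<forall>i. \<exists>r. v i \<in> filtration F r" using filtration_exhausts by blast
  then obtain r where r: "\<And>i. v i \<in> filtration F (r i)" by metis
  obtain r0 where r0: "e \<in> filtration F r0" using filtration_exhausts by blast
  define s where "s = Suc (r0 + (\<Sum>i<k. r i))"
  have es: "e \<in> filtration F s" using r0 filtration_mono[of r0 s] by (auto simp: s_def)
  have vs: "v i \<in> filtration F s" if "i < k" for i
  proof -
    have "r i \<le> (\<Sum>i<k. r i)" using that by (intro member_le_sum) auto
    then show ?thesis using r[of i] filtration_mono[of "r i" s] by (auto simp: s_def)
  qed
  have w: "gen.word w \<in> filtration F (s * (length w + 1))" if "w \<in> gen.words" for w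
    using that
  proof (induction w)
    case (Cons i w)
    then have i: "i < k" "w \<in> gen.words" by (auto simp: gen.words_def)
    have "cprod 0 (v i) (gen.word w) \<in> filtration F (s + s * (length w + 1))"
      using filtration_cprod[OF vs[OF i(1)] Cons.IH[OF i(2)]] .
    then show ?case by (simp add: algebra_simps)
  qed (simp add: es)
  have "gen.filt n \<subseteq> filtration F (s * (n + 1))" for n
    unfolding gen.filt_def
  proof (rule cs.span_minimal)
    have "subspace (filtration F (s * (n + 1)))" by (simp add: filtration_def)
    then show "cs.subspace (filtration F (s * (n + 1)))"
      by (intro cs.subspaceI subspace_0 subspace_add subspace_scale)
    show "gen.word ` {w \<in> gen.words. length w \<le> n} \<subseteq> filtration F (s * (n + 1))"
    proof
      fix x assume "x \<in> gen.word ` {w \<in> gen.words. length w \<le> n}"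
      then obtain w where w': "w \<in> gen.words" "length w \<le> n" "x = gen.word w" by blast
      then have "s * (length w + 1) \<le> s * (n + 1)" by (intro mult_le_mono) auto
      then show "x \<in> filtration F (s * (n + 1))" using w[OF w'(1)] w'(3) filtration_mono by blast
    qed
  qed
  then show ?thesis by (intro exI[of _ s]) (simp add: s_def)
qed

lemma matrix_rep_of_generated:
  "\<exists>N\<ge>1. \<exists>\<rho>. alg.matrix_rep N \<rho> \<and> (\<forall>A. \<exists>b\<in>B. \<forall>i<N. \<forall>j<N. \<rho> b i j = A i j)"
proof -
  obtain s where s: "0 < s" "\<And>n. gen.filt n \<subseteq> filtration F (s * (n + 1))"
    using filt_subset_filtration by blast
  have lim: "filterlim (\<lambda>n::nat. s * (n + 1)) at_top at_top"
    by (rule filterlim_subseq) (use s in \<open>simp add: strict_mono_def\<close>)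
  have 1: "eventually (\<lambda>n. real (rank (filtration F (s * (n + 1)))) < real (s * (n + 1)) powr (3/2)) sequentially"
    using filterlim_iff[THEN iffD1, OF lim, rule_format, OF rank_growth] .
  \<comment> \<open>The exponent 3/2 stays below 2, so the inequality holds for large
    \<open>n\<close>; one such \<open>n\<close> is enough for
    \<open>gen.matrix_rep_exists\<close>.\<close>
  have 2: "eventually (\<lambda>n::nat. 2 * (real s * (real n + 1)) powr (3/2) < real n * real n) sequentially"
    using s(1) by real_asymp
  obtain n where n: "real (rank (filtration F (s * (n + 1)))) < real (s * (n + 1)) powr (3/2)"
      "2 * (real s * (real n + 1)) powr (3/2) < real n * real n"
    using eventually_happens'[OF sequentially_bot eventually_conj[OF 1 2]] by blast
  have "real (2 * rank (filtration F (s * (n + 1)))) < real (n * n)"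
    using n by (simp add: algebra_simps)
  then have rank: "2 * rank (filtration F (s * (n + 1))) < n * n" by (simp only: of_nat_less_iff)
  have "2 * card X < n * n" if "finite X" "X \<subseteq> gen.filt n" "cs.independent X" for X
  proof -
    have "X \<subseteq> B" using that(2) gen.filt_B by blast
    then have "independent X" using that(3) by (rule independent_over_poly)
    then have "card X \<le> rank (filtration F (s * (n + 1)))"
      using that s(2) finite_F by (intro card_le_rank) auto
    then show ?thesis using rank by simp
  qed
  then show ?thesis by (intro gen.matrix_rep_exists[OF filt_exhausts, of n])
qed

end

theorem matrix_rep_of_B:
  "\<exists>N\<ge>1. \<exists>\<rho>. alg.matrix_rep N \<rho> \<and> (\<forall>A. \<exists>b\<in>B. \<forall>i<N. \<forall>j<N. \<rho> b i j = A i j)"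
proof -
  obtain k :: nat and v where "letters = v ` {i. i < k}"
    using finite_imp_nat_seg_image_inj_on[OF finite_letters] by blast
  then have "letters = v ` {..<k}" by (simp add: lessThan_def)
  then show ?thesis by (rule matrix_rep_of_generated)
qed

end

section \<open>The localized Weyl algebra and matrix-valued distributions\<close>

text \<open>The function \<open>f\<close> stands for the two-sided formal series \<open>\<Sum>\<^sub>k f(k) t\<^sup>k\<close>, and \<open>x\<close> acts as \<open>d/dt\<close>. The action
  shows that the powers of \<open>x\<close> stay independent in the quotient by the relators.\<close>

primrec letter_op :: "weyl_letter \<Rightarrow> (int \<Rightarrow> complex) \<Rightarrow> (int \<Rightarrow> complex)"
  where "letter_op Lx f = (\<lambda>k. of_int (k + 1) * f (k + 1))"
  | "letter_op Lt f = (\<lambda>k. f (k - 1))"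
  | "letter_op Ltinv f = (\<lambda>k. f (k + 1))"

primrec word_op :: "weyl_word \<Rightarrow> (int \<Rightarrow> complex) \<Rightarrow> (int \<Rightarrow> complex)"
  where "word_op (Word w) f = foldr letter_op w f"

definition weyl_act :: "weyl_free \<Rightarrow> (int \<Rightarrow> complex) \<Rightarrow> (int \<Rightarrow> complex)"
  where "weyl_act p f k = (\<Sum>w\<in>Poly_Mapping.keys p. Poly_Mapping.lookup p w * word_op w f k)"

lemma letter_op_add: "letter_op l (\<lambda>k. f k + g k) = (\<lambda>k. letter_op l f k + letter_op l g k)"
  by (cases l) (simp_all add: fun_eq_iff distrib_left)

lemma letter_op_scale: "letter_op l (\<lambda>k. c * f k) = (\<lambda>k. c * letter_op l f k)"
  by (cases l) (simp_all add: fun_eq_iff)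

lemma word_op_add: "word_op w (\<lambda>k. f k + g k) = (\<lambda>k. word_op w f k + word_op w g k)"
proof (cases w)
  case (Word u)
  show ?thesis unfolding Word by (induction u) (simp_all add: letter_op_add)
qed

lemma word_op_scale: "word_op w (\<lambda>k. c * f k) = (\<lambda>k. c * word_op w f k)"
proof (cases w)
  case (Word u)
  show ?thesis unfolding Word by (induction u) (simp_all add: letter_op_scale)
qed

lemma word_op_plus: "word_op (u + v) f = word_op u (word_op v f)"
  by (cases u; cases v) simp

lemma weyl_act_add: "weyl_act (p + q) f k = weyl_act p f k + weyl_act q f k"
  unfolding weyl_act_def
  by (rule additive_sum_over_keys[of "\<lambda>w c. c * word_op w f k"]) (simp add: distrib_right)

lemma weyl_act_single: "weyl_act (Poly_Mapping.single w c) f k = c * word_op w f k"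
  unfolding weyl_act_def by (rule sum_over_keys_single[of "\<lambda>w c. c * word_op w f k"]) simp

lemma weyl_act_0: "weyl_act 0 f k = 0"
  by (simp add: weyl_act_def)

lemma weyl_act_diff: "weyl_act (p - q) f k = weyl_act p f k - weyl_act q f k"
  using weyl_act_add[of "p - q" q f k] by simp

lemma weyl_act_add_right: "weyl_act p (\<lambda>k. f k + g k) k = weyl_act p f k + weyl_act p g k"
  by (simp add: weyl_act_def word_op_add distrib_left sum.distrib)

lemma weyl_act_mult: "weyl_act (p * q) f k = weyl_act p (weyl_act q f) k"
proof (rule additive_eqI[of "\<lambda>p. weyl_act (p * q) f k" "\<lambda>p. weyl_act p (weyl_act q f) k"])
  fix w c
  show "weyl_act (Poly_Mapping.single w c * q) f k = weyl_act (Poly_Mapping.single w c) (weyl_act q f) k"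
  proof (rule additive_eqI[of "\<lambda>q. weyl_act (Poly_Mapping.single w c * q) f k"
        "\<lambda>q. weyl_act (Poly_Mapping.single w c) (weyl_act q f) k"])
    fix p q
    have "weyl_act (p + q) f = (\<lambda>k. weyl_act p f k + weyl_act q f k)"
      by (simp add: fun_eq_iff weyl_act_add)
    then show "weyl_act (Poly_Mapping.single w c) (weyl_act (p + q) f) k =
        weyl_act (Poly_Mapping.single w c) (weyl_act p f) k + weyl_act (Poly_Mapping.single w c) (weyl_act q f) k"
      by (simp add: weyl_act_add_right)
  next
    fix w' c'
    have "weyl_act (Poly_Mapping.single w' c') f = (\<lambda>k. c' * word_op w' f k)"
      by (simp add: fun_eq_iff weyl_act_single)
    then show "weyl_act (Poly_Mapping.single w c * Poly_Mapping.single w' c') f k =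
        weyl_act (Poly_Mapping.single w c) (weyl_act (Poly_Mapping.single w' c') f) k"
      by (simp add: mult_single weyl_act_single word_op_plus word_op_scale)
  qed (simp add: distrib_left weyl_act_add)
qed (simp_all add: distrib_right weyl_act_add)

lemma weyl_act_letter: "weyl_act (letter l) f k = letter_op l f k"
  by (simp add: letter_def weyl_act_single)

lemma weyl_act_1: "weyl_act 1 f k = f k"
  using weyl_act_single[of 0 1 f k] by (simp only: single_one) (simp add: zero_weyl_word_def)

lemma weyl_act_ideal: "p \<in> weyl_ideal \<Longrightarrow> weyl_act p f k = 0"
proof (induction arbitrary: f k rule: weyl_ideal.induct)
  case (relator r)
  have l: "weyl_act (letter l) f = letter_op l f" for l f by (simp add: fun_eq_iff weyl_act_letter)
  have "weyl_act (letter Lt * letter Ltinv - 1) f k = 0" "weyl_act (letter Ltinv * letter Lt - 1) f k = 0"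
    "weyl_act (letter Lx * letter Lt - letter Lt * letter Lx - 1) f k = 0"
    by (simp_all add: weyl_act_diff weyl_act_add weyl_act_mult weyl_act_1 l algebra_simps)
  with relator show ?case unfolding weyl_relators_def by (elim insertE emptyE) (simp_all only:)
next
  case (mult_left p q)
  then have "weyl_act p f = (\<lambda>k. 0 * 0)" for f by (simp add: fun_eq_iff)
  then show ?case by (simp only: weyl_act_mult) (simp add: weyl_act_def word_op_scale[of _ 0 "\<lambda>_. 0", simplified])
qed (simp_all add: weyl_act_0 weyl_act_add weyl_act_mult)

lift_definition weyl_rep :: "weyl \<Rightarrow> (int \<Rightarrow> complex) \<Rightarrow> (int \<Rightarrow> complex)" is weyl_act
proof -
  fix p q assume "weyl_rel p q"
  then have "weyl_act (p - q) f k = 0" for f k by (simp add: weyl_rel_def weyl_act_ideal)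
  then show "weyl_act p = weyl_act q" by (simp add: fun_eq_iff weyl_act_diff)
qed

lemma weyl_rep_0: "weyl_rep 0 f k = 0"
  by transfer (rule weyl_act_0)

lemma weyl_rep_add: "weyl_rep (a + b) f k = weyl_rep a f k + weyl_rep b f k"
  by transfer (rule weyl_act_add)

lemma weyl_rep_mult: "weyl_rep (a * b) f k = weyl_rep a (weyl_rep b f) k"
  by transfer (rule weyl_act_mult)

lemma weyl_rep_const: "weyl_rep (weyl_const c) f k = c * f k"
  by transfer (simp add: weyl_act_single zero_weyl_word_def)

lemma weyl_rep_x: "weyl_rep weyl_x f k = of_int (k + 1) * f (k + 1)"
  by transfer (simp add: weyl_act_letter)

section \<open>Polynomials in x and powers of t in the Weyl algebra\<close>

lemma weyl_const_central: "weyl_const c * w = w * weyl_const c"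
proof transfer
  fix c and p :: weyl_free
  have "Poly_Mapping.single 0 c * p = p * Poly_Mapping.single 0 c"
    by (rule additive_eqI[of "\<lambda>p. Poly_Mapping.single 0 c * p" "\<lambda>p. p * Poly_Mapping.single 0 c"])
      (simp_all add: distrib_left distrib_right mult_single mult.commute)
  then show "weyl_rel (Poly_Mapping.single 0 c * p) (p * Poly_Mapping.single 0 c)"
    by (simp add: weyl_rel_def weyl_ideal.zero)
qed

lemma weyl_const_left_commute: "w * (weyl_const c * v) = weyl_const c * (w * v)"
  by (metis mult.assoc weyl_const_central)

lemma weyl_const_uminus: "weyl_const (- c) = - weyl_const c"
  using weyl_const_add[of "- c" c] by (simp add: weyl_const_0 eq_neg_iff_add_eq_0)

lemma weyl_poly_0 [simp]: "weyl_poly 0 = 0"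
  by (simp add: weyl_poly_def weyl_const_0)

lemma weyl_poly_pCons: "weyl_poly (pCons c p) = weyl_const c + weyl_x * weyl_poly p"
proof (cases "p = 0")
  case True
  then show ?thesis by (simp add: weyl_poly_def weyl_const_0)
next
  case False
  then show ?thesis
    by (simp add: weyl_poly_def sum.atMost_Suc_shift sum_distrib_left weyl_const_left_commute del: sum.atMost_Suc)
qed

lemma weyl_poly_add: "weyl_poly (p + q) = weyl_poly p + weyl_poly q"
proof (induction p arbitrary: q)
  case (pCons a p)
  obtain b q' where q: "q = pCons b q'" using pCons_cases by metis
  show ?case by (simp add: q pCons.IH weyl_poly_pCons weyl_const_add distrib_left)
qed simp

lemma weyl_poly_smult: "weyl_poly (smult c p) = weyl_const c * weyl_poly p"
  by (induction p) (simp_all add: weyl_poly_pCons weyl_const_mult distrib_left weyl_const_left_commute)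

lemma weyl_poly_minus: "weyl_poly (- p) = - weyl_poly p"
  using weyl_poly_add[of "- p" p] by (simp add: eq_neg_iff_add_eq_0)

lemma weyl_poly_mult: "weyl_poly (p * q) = weyl_poly p * weyl_poly q"
  by (induction p) (simp_all add: weyl_poly_pCons weyl_poly_add weyl_poly_smult distrib_right
      weyl_const_0 mult.assoc)

lemma weyl_poly_sum: "weyl_poly (sum f I) = (\<Sum>i\<in>I. weyl_poly (f i))"
  by (induction I rule: infinite_finite_induct) (simp_all add: weyl_poly_add)

text \<open>The test series is t^-1, whose derivatives (-1)^m m! t^(-1-m) never vanish and are
  independent; a nonnegative power of t would be killed eventually.\<close>

lemma weyl_rep_poly:
  "weyl_rep (weyl_poly p) (\<lambda>k. if k = - 1 then 1 else 0) (- 1 - int m) = (- 1) ^ m * fact m * poly.coeff p m"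
proof (induction p arbitrary: m)
  case (pCons c p)
  show ?case
  proof (cases m)
    case (Suc m')
    have "- 1 - int m + 1 = - 1 - int m'" by (simp add: Suc)
    then have "weyl_rep (weyl_poly (pCons c p)) (\<lambda>k. if k = - 1 then 1 else 0) (- 1 - int m) =
        of_int (- 1 - int m') * ((- 1) ^ m' * fact m' * poly.coeff p m')"
      by (simp only: weyl_poly_pCons weyl_rep_add weyl_rep_const weyl_rep_mult weyl_rep_x pCons.IH)
        (simp add: Suc)
    then show ?thesis by (simp add: Suc algebra_simps)
  qed (simp add: weyl_poly_pCons weyl_rep_add weyl_rep_const weyl_rep_mult weyl_rep_x)
qed (simp add: weyl_rep_0)

lemma weyl_poly_eq_0: "weyl_poly p = 0 \<Longrightarrow> p = 0"
  using weyl_rep_poly[of p] by (intro poly_eqI) (simp add: weyl_rep_0)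

lemma weyl_t_poly: "weyl_t * weyl_poly p = weyl_poly p * weyl_t - weyl_poly (pderiv p)"
proof (induction p)
  case (pCons c p)
  have tx: "weyl_t * weyl_x = weyl_x * weyl_t - 1" using weyl_relations(3) by (simp add: algebra_simps)
  have "weyl_t * weyl_poly (pCons c p) = weyl_const c * weyl_t + (weyl_t * weyl_x) * weyl_poly p"
    by (simp add: weyl_poly_pCons distrib_left mult.assoc weyl_const_central)
  also have "\<dots> = weyl_const c * weyl_t + weyl_x * (weyl_t * weyl_poly p) - weyl_poly p"
    unfolding tx by (simp add: left_diff_distrib mult.assoc)
  also have "\<dots> = weyl_poly (pCons c p) * weyl_t - weyl_poly (pderiv (pCons c p))"
    unfolding pCons.IH
    by (simp add: weyl_poly_pCons pderiv_pCons weyl_poly_add weyl_const_0 distrib_right right_diff_distrib mult.assoc)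
  finally show ?case .
qed simp

lemma weyl_tpow_neg: "weyl_tpow (- int n) = weyl_tinv ^ n"
  by (simp add: weyl_tpow_def)

lemma weyl_tpow_Suc: "weyl_t * weyl_tpow k = weyl_tpow (k + 1)"
proof (cases "k \<ge> 0")
  case True
  then have "nat (k + 1) = Suc (nat k)" by simp
  then show ?thesis using True by (simp add: weyl_tpow_def)
next
  case False
  define n where "n = nat (- k - 1)"
  have "k = - int (Suc n)" "k + 1 = - int n" using False by (simp_all add: n_def)
  then have "weyl_tpow k = weyl_tinv ^ Suc n" "weyl_tpow (k + 1) = weyl_tinv ^ n"
    by (simp_all only: weyl_tpow_neg)
  moreover have "weyl_t * weyl_tinv ^ Suc n = weyl_tinv ^ n"
    by (simp add: weyl_relations(1) flip: mult.assoc)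
  ultimately show ?thesis by simp
qed

lemma weyl_tpow_add: "weyl_t ^ s * weyl_tpow k = weyl_tpow (k + int s)"
proof (induction s)
  case (Suc s)
  have "weyl_t ^ Suc s * weyl_tpow k = weyl_t * (weyl_t ^ s * weyl_tpow k)" by (simp add: mult.assoc)
  then show ?case unfolding Suc by (simp add: weyl_tpow_Suc add_ac)
qed simp

lemma weyl_tpow_nat: "weyl_tpow (int n) = weyl_t ^ n"
  by (simp add: weyl_tpow_def)

text \<open>The sum is the n-fold commutator of t with p(x), and by \<open>weyl_t_poly\<close> each
  commutator is minus the derivative. The induction recombines terms by Pascal's rule.\<close>

lemma weyl_iterated_commutator:
  "(\<Sum>s\<le>n. weyl_const ((- 1) ^ s * of_nat (n choose s)) * (weyl_t ^ (n - s) * weyl_poly p * weyl_t ^ s)) =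
    weyl_poly (smult ((- 1) ^ n) ((pderiv ^^ n) p))"
proof (induction n arbitrary: p)
  case 0
  show ?case by (simp add: weyl_const_1)
next
  case (Suc n)
  define g where "g = (\<lambda>i j. weyl_t ^ i * weyl_poly p * weyl_t ^ j)"
  have g: "weyl_t ^ i * weyl_poly (pderiv p) * weyl_t ^ j = g i (Suc j) - g (Suc i) j" for i j
  proof -
    have "weyl_poly (pderiv p) = weyl_poly p * weyl_t - weyl_t * weyl_poly p"
      by (simp add: weyl_t_poly)
    then have "weyl_t ^ i * weyl_poly (pderiv p) * weyl_t ^ j =
        weyl_t ^ i * weyl_poly p * (weyl_t * weyl_t ^ j) - (weyl_t ^ i * weyl_t) * weyl_poly p * weyl_t ^ j"
      by (simp only: right_diff_distrib left_diff_distrib mult.assoc)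
    then show ?thesis by (simp only: g_def power_Suc power_Suc2[symmetric])
  qed
  define c where "c = (\<lambda>n s. weyl_const ((- 1) ^ s * of_nat (n choose s)))"
  have c: "c (Suc n) (Suc s) = c n (Suc s) - c n s" for s
  proof -
    have "(- 1) ^ Suc s * of_nat (Suc n choose Suc s) =
        (- 1) ^ Suc s * of_nat (n choose Suc s) + - ((- 1) ^ s * of_nat (n choose s) :: complex)"
      by (simp add: algebra_simps)
    then show ?thesis by (simp only: c_def weyl_const_add weyl_const_uminus diff_conv_add_uminus)
  qed
  have "weyl_poly (smult ((- 1) ^ Suc n) ((pderiv ^^ Suc n) p)) =
      - weyl_poly (smult ((- 1) ^ n) ((pderiv ^^ n) (pderiv p)))"
    by (simp add: funpow_swap1 flip: weyl_poly_minus)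
  also have "\<dots> = - (\<Sum>s\<le>n. c n s * (weyl_t ^ (n - s) * weyl_poly (pderiv p) * weyl_t ^ s))"
    by (simp only: Suc[symmetric] c_def)
  also have "\<dots> = (\<Sum>s\<le>n. c n s * g (Suc (n - s)) s) - (\<Sum>s\<le>n. c n s * g (n - s) (Suc s))"
    by (simp only: g right_diff_distrib sum_subtractf minus_diff_eq)
  also have "(\<Sum>s\<le>n. c n s * g (Suc (n - s)) s) = (\<Sum>s\<le>n. c n s * g (Suc n - s) s)"
    by (intro sum.cong refl) (simp add: Suc_diff_le)
  also have "\<dots> = (\<Sum>s\<le>Suc n. c n s * g (Suc n - s) s)"
    by (simp add: c_def weyl_const_0 binomial_eq_0)
  also have "\<dots> = c n 0 * g (Suc n) 0 + (\<Sum>s\<le>n. c n (Suc s) * g (n - s) (Suc s))"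
    by (subst sum.atMost_Suc_shift) simp
  also have "\<dots> - (\<Sum>s\<le>n. c n s * g (n - s) (Suc s)) =
      c n 0 * g (Suc n) 0 + (\<Sum>s\<le>n. c (Suc n) (Suc s) * g (n - s) (Suc s))"
    by (simp add: c left_diff_distrib sum_subtractf)
  also have "\<dots> = (\<Sum>s\<le>Suc n. c (Suc n) s * g (Suc n - s) s)"
    unfolding sum.atMost_Suc_shift[of "\<lambda>s. c (Suc n) s * g (Suc n - s) s" n] by (simp add: c_def)
  finally show ?case by (simp only: c_def g_def)
qed

text \<open>A common factor t^k splits off on the right, and what is left is the iterated commutator
  of t with the entries of \<open>b\<close>.\<close>

lemma distr_prod_field:
  "distr_prod N n (weyl_field a) (weyl_field b) =
    weyl_field (\<lambda>i j. \<Sum>l<N. smult ((- 1) ^ n) (a i l * (pderiv ^^ n) (b l j)))"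
proof (intro ext)
  fix k i j
  define c where "c = (\<lambda>s. weyl_const ((- 1) ^ s * of_nat (n choose s)))"
  have trm: "weyl_field a (int n - int s) i l * weyl_field b (k + int s) l j =
      weyl_poly (a i l) * (weyl_t ^ (n - s) * weyl_poly (b l j) * weyl_t ^ s) * weyl_tpow k" if "s \<le> n" for s l
  proof -
    have "int n - int s = int (n - s)" using that by (simp add: of_nat_diff)
    then show ?thesis
      unfolding weyl_field_def weyl_tpow_add[symmetric] by (simp only: weyl_tpow_nat mult.assoc)
  qed
  have "distr_prod N n (weyl_field a) (weyl_field b) k i j =
      (\<Sum>s\<le>n. c s * (\<Sum>l<N. weyl_poly (a i l) * (weyl_t ^ (n - s) * weyl_poly (b l j) * weyl_t ^ s) * weyl_tpow k))"
    unfolding distr_prod_def c_def using trm by (intro sum.cong refl) simp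
  also have "\<dots> = (\<Sum>l<N. weyl_poly (a i l) *
      (\<Sum>s\<le>n. c s * (weyl_t ^ (n - s) * weyl_poly (b l j) * weyl_t ^ s)) * weyl_tpow k)"
  proof -
    have "c s * (weyl_poly (a i l) * w * weyl_tpow k) = weyl_poly (a i l) * (c s * w) * weyl_tpow k" for s l w
      unfolding c_def by (simp only: weyl_const_left_commute[of "weyl_poly _"] mult.assoc)
    then show ?thesis unfolding sum_distrib_left sum_distrib_right by (subst sum.swap) (simp only:)
  qed
  also have "\<dots> = weyl_field (\<lambda>i j. \<Sum>l<N. smult ((- 1) ^ n) (a i l * (pderiv ^^ n) (b l j))) k i j"
    unfolding c_def weyl_iterated_commutator weyl_field_def weyl_poly_sum sum_distrib_right
    by (simp add: mult_smult_right flip: weyl_poly_mult)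
  finally show "distr_prod N n (weyl_field a) (weyl_field b) k i j = \<dots>" .
qed

section \<open>Linearity and derivation rules for products of distributions\<close>

lemma distr_prod_add_left: "distr_prod N n (u + u') v = distr_prod N n u v + distr_prod N n u' v"
  by (simp add: distr_prod_def fun_eq_iff distrib_left distrib_right sum.distrib)

lemma distr_prod_add_right: "distr_prod N n u (v + v') = distr_prod N n u v + distr_prod N n u v'"
  by (simp add: distr_prod_def fun_eq_iff distrib_left sum.distrib)

lemma distr_prod_const_left:
  "distr_prod N n (\<lambda>k i j. weyl_const c * u k i j) v = (\<lambda>k i j. weyl_const c * distr_prod N n u v k i j)"
  unfolding distr_prod_def sum_distrib_left
  by (intro ext sum.cong refl) (simp only: mult.assoc weyl_const_left_commute[where c = c])

lemma distr_prod_const_right: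
  "distr_prod N n u (\<lambda>k i j. weyl_const c * v k i j) = (\<lambda>k i j. weyl_const c * distr_prod N n u v k i j)"
  unfolding distr_prod_def sum_distrib_left
  by (intro ext sum.cong refl) (simp only: weyl_const_left_commute[where c = c])

text \<open>The rule (n-s) binom(n, s) = n binom(n-1, s) absorbs the factor that differentiation
  produces at the index n - s.\<close>

lemma distr_prod_der_left:
  "distr_prod N n (distr_der u) v = (\<lambda>k i j. weyl_const (- of_nat n) * distr_prod N (n - 1) u v k i j)"
proof (cases n)
  case 0
  show ?thesis by (simp add: 0 distr_prod_def distr_der_def fun_eq_iff weyl_const_0)
next
  case (Suc m)
  define T where "T = (\<lambda>s k i j. \<Sum>l<N. u (int m - int s) i l * v (k + int s) l j)"
  define c where "c = (\<lambda>n s. (- 1) ^ s * of_nat (n choose s) :: complex)"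
  have coef: "c (Suc m) s * - of_int (int (Suc m) - int s) = - of_nat (Suc m) * c m s" if "s \<le> m" for s
  proof -
    have "of_nat (Suc m - s) * of_nat (Suc m choose s) = (of_nat (Suc m) * of_nat (m choose s) :: complex)"
      using binomial_absorb_comp[of "Suc m" s] by (metis diff_Suc_1 of_nat_mult)
    moreover have "of_int (int (Suc m) - int s) = (of_nat (Suc m - s) :: complex)"
      using that by (simp add: of_nat_diff)
    ultimately have "(- 1) ^ s * (of_nat (Suc m choose s) * of_int (int (Suc m) - int s)) =
        (- 1) ^ s * (of_nat (Suc m) * of_nat (m choose s) :: complex)"
      by (simp only: mult.commute)
    then show ?thesis unfolding c_def
      by (simp only: mult_minus_right mult_minus_left mult.assoc mult.left_commute[of "of_nat (Suc m)"])
  qed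
  have "distr_prod N n (distr_der u) v k i j = weyl_const (- of_nat n) * distr_prod N (n - 1) u v k i j" for k i j
  proof -
    have "(\<Sum>l<N. distr_der u (int (Suc m) - int s) i l * v (k + int s) l j) =
        weyl_const (- of_int (int (Suc m) - int s)) * T s k i j" for s
    proof -
      have "int (Suc m) - int s - 1 = int m - int s" by simp
      then show ?thesis unfolding distr_der_def T_def sum_distrib_left by (simp only: mult.assoc)
    qed
    then have "distr_prod N n (distr_der u) v k i j =
        (\<Sum>s\<le>Suc m. weyl_const (c (Suc m) s * - of_int (int (Suc m) - int s)) * T s k i j)"
      unfolding distr_prod_def Suc c_def weyl_const_mult[of _ "- of_int _"] by (simp only: mult.assoc)
    also have "\<dots> = (\<Sum>s\<le>m. weyl_const (c (Suc m) s * - of_int (int (Suc m) - int s)) * T s k i j)"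
      by (simp only: sum.atMost_Suc) (simp add: weyl_const_0)
    also have "\<dots> = (\<Sum>s\<le>m. weyl_const (- of_nat (Suc m) * c m s) * T s k i j)"
      using coef by (intro sum.cong refl) simp
    also have "\<dots> = weyl_const (- of_nat (Suc m)) * (\<Sum>s\<le>m. weyl_const (c m s) * T s k i j)"
      by (simp only: sum_distrib_left weyl_const_mult mult.assoc)
    also have "(\<Sum>s\<le>m. weyl_const (c m s) * T s k i j) = distr_prod N m u v k i j"
      by (simp only: distr_prod_def T_def c_def)
    finally show ?thesis by (simp only: Suc diff_Suc_1)
  qed
  note pointwise = this
  show ?thesis by (intro ext) (rule pointwise)
qed

text \<open>The factor k + s from differentiating \<open>v\<close> splits: k belongs to the
  derivative of the product, and s binom(n, s) = n binom(n-1, s-1) yields the product of order n -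
  1.\<close>

lemma distr_prod_der_right:
  "distr_prod N n u (distr_der v) =
    distr_der (distr_prod N n u v) + (\<lambda>k i j. weyl_const (of_nat n) * distr_prod N (n - 1) u v k i j)"
proof -
  define T where "T = (\<lambda>s k i j. \<Sum>l<N. u (int n - int s) i l * v (k - 1 + int s) l j)"
  define c where "c = (\<lambda>n s. (- 1) ^ s * of_nat (n choose s) :: complex)"
  have 3: "weyl_const (of_nat n) * distr_prod N (n - 1) u v k i j =
      (\<Sum>s\<le>n. weyl_const (- of_nat s * c n s) * T s k i j)" for k i j
  proof (cases n)
    case 0
    then show ?thesis by (simp add: weyl_const_0)
  next
    case (Suc m)
    have coef: "of_nat n * c m s = - of_nat (Suc s) * c n (Suc s)" for s
    proof -
      have "of_nat (Suc s) * of_nat (n choose Suc s) = (of_nat n * of_nat (m choose s) :: complex)"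
        using Suc_times_binomial[of s m] unfolding Suc by (metis of_nat_mult)
      then show ?thesis by (simp add: c_def mult.left_commute del: of_nat_Suc)
    qed
    have "distr_prod N (n - 1) u v k i j = (\<Sum>s\<le>m. weyl_const (c m s) * T (Suc s) k i j)"
      unfolding distr_prod_def T_def c_def by (simp add: Suc)
    then have "weyl_const (of_nat n) * distr_prod N (n - 1) u v k i j =
        (\<Sum>s\<le>m. weyl_const (of_nat n * c m s) * T (Suc s) k i j)"
      by (simp only: sum_distrib_left weyl_const_mult mult.assoc)
    also have "\<dots> = (\<Sum>s\<le>Suc m. weyl_const (- of_nat s * c n s) * T s k i j)"
      unfolding coef sum.atMost_Suc_shift by (simp add: weyl_const_0 del: of_nat_Suc)
    finally show ?thesis by (simp only: Suc)
  qed
  have 1: "distr_prod N n u (distr_der v) k i j =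
      (\<Sum>s\<le>n. weyl_const (c n s * - of_int (k + int s)) * T s k i j)" for k i j
  proof -
    have "(\<Sum>l<N. u (int n - int s) i l * distr_der v (k + int s) l j) =
        weyl_const (- of_int (k + int s)) * T s k i j" for s
    proof -
      have "k + int s - 1 = k - 1 + int s" by simp
      then show ?thesis unfolding distr_der_def T_def sum_distrib_left
        by (simp only: weyl_const_left_commute)
    qed
    then show ?thesis
      unfolding distr_prod_def c_def weyl_const_mult[of _ "- of_int _"] by (simp only: mult.assoc)
  qed
  have 2: "distr_der (distr_prod N n u v) k i j = (\<Sum>s\<le>n. weyl_const (- of_int k * c n s) * T s k i j)" for k i j
  proof -
    have "distr_prod N n u v (k - 1) i j = (\<Sum>s\<le>n. weyl_const (c n s) * T s k i j)"
      by (simp only: distr_prod_def T_def c_def)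
    then show ?thesis unfolding distr_der_def by (simp only: sum_distrib_left weyl_const_mult mult.assoc)
  qed
  have "distr_prod N n u (distr_der v) k i j =
      distr_der (distr_prod N n u v) k i j + weyl_const (of_nat n) * distr_prod N (n - 1) u v k i j" for k i j
  proof -
    have "c n s * - of_int (k + int s) = - of_int k * c n s + - of_nat s * c n s" for s
      by (simp add: algebra_simps)
    then show ?thesis
      unfolding 1 2 3 sum.distrib[symmetric] distrib_right[symmetric] weyl_const_add[symmetric] by (simp only:)
  qed
  then show ?thesis by (simp add: fun_eq_iff)
qed

section \<open>The isomorphism\<close>

lemma distr_scale_const: "distr_scale [:c:] u = (\<lambda>k i j. weyl_const c * u k i j)"
  by (simp add: distr_scale_pCons distr_scale_zero_left distr_der_zero)

lemma distr_der_eq_scale: "distr_der u = distr_scale [:0, 1:] u"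
  by (simp add: distr_scale_pCons[of 0] distr_scale_const weyl_const_0 weyl_const_1 fun_eq_iff)

lemma weyl_field_add: "weyl_field (\<lambda>i j. a i j + b i j) = weyl_field a + weyl_field b"
  by (simp add: weyl_field_def weyl_poly_add distrib_right fun_eq_iff)

lemma weyl_field_zero: "weyl_field (\<lambda>i j. 0) = 0"
  by (simp add: weyl_field_def fun_eq_iff)

lemma weyl_field_smult: "weyl_field (\<lambda>i j. smult c (a i j)) = distr_scale [:c:] (weyl_field a)"
  by (simp add: weyl_field_def weyl_poly_smult distr_scale_const fun_eq_iff mult.assoc)

lemma weyl_field_eq_0:
  assumes "weyl_field a = 0"
  shows "a i j = 0"
proof -
  have "weyl_field a 0 i j = 0" using assms by simp
  then show ?thesis by (simp add: weyl_field_def weyl_tpow_def weyl_poly_eq_0)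
qed

lemma distr_prod_zero_left: "distr_prod N n 0 v = 0"
  by (simp add: distr_prod_def fun_eq_iff)

lemma distr_prod_zero_right: "distr_prod N n u 0 = 0"
  by (simp add: distr_prod_def fun_eq_iff)

locale represented_conformal = unital_simple_conformal scale cprod e
  for scale :: "complex poly \<Rightarrow> 'a::ab_group_add \<Rightarrow> 'a"
    and cprod :: "nat \<Rightarrow> 'a \<Rightarrow> 'a \<Rightarrow> 'a" and e :: 'a +
  fixes N :: nat and \<rho> :: "'a \<Rightarrow> nat \<Rightarrow> nat \<Rightarrow> complex"
  assumes diff_rep: "diff_algebra_rep cscale (cprod 0) e B D N \<rho>"
    and bij: "bij_betw (diff_algebra_rep.\<Phi> D \<rho>) B (poly_matrices N)"
begin

sublocale rep: diff_algebra_rep cscale "cprod 0" e B D N \<rho>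
  by (rule diff_rep)

definition \<Psi> :: "'a \<Rightarrow> weyl_distr"
  where "\<Psi> b = weyl_field (rep.\<Phi> b)"

lemma \<Psi>_add: "a \<in> B \<Longrightarrow> b \<in> B \<Longrightarrow> \<Psi> (a + b) = \<Psi> a + \<Psi> b"
  unfolding \<Psi>_def weyl_field_add[symmetric]
  by (rule arg_cong[of _ _ weyl_field]) (simp add: fun_eq_iff rep.\<Phi>_add)

lemma \<Psi>_scale: "b \<in> B \<Longrightarrow> \<Psi> (c \<cdot> b) = distr_scale [:c:] (\<Psi> b)"
  unfolding \<Psi>_def weyl_field_smult[symmetric]
  by (rule arg_cong[of _ _ weyl_field]) (simp add: fun_eq_iff rep.\<Phi>_scale)

lemma \<Psi>_0 [simp]: "\<Psi> 0 = 0"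
  unfolding \<Psi>_def weyl_field_zero[symmetric]
  by (rule arg_cong[of _ _ weyl_field]) (simp add: fun_eq_iff rep.\<Phi>_0)

lemma cprod_e_B: "cprod j f e \<in> B"
  by (rule cprod_B[OF unit_B])

definition coef :: "nat \<Rightarrow> complex poly"
  where "coef j = monom ((- 1) ^ j / fact j) j"

text \<open>The \<complex>[\<partial>]-linear extension of \<open>\<Psi>\<close> from
  \<open>B\<close>, written through the coefficients in \<open>expansion\<close> so that no basis
  has to be chosen; \<open>coef j\<close> is the polynomial by which \<open>dpow j\<close>
  acts.\<close>

definition \<phi> :: "'a \<Rightarrow> weyl_distr"
  where "\<phi> f = (\<Sum>j | cprod j f e \<noteq> 0. distr_scale (coef j) (\<Psi> (cprod j f e)))"

lemma \<phi>_eq: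
  assumes "\<And>j. n \<le> j \<Longrightarrow> cprod j f e = 0"
  shows "\<phi> f = (\<Sum>j<n. distr_scale (coef j) (\<Psi> (cprod j f e)))"
  unfolding \<phi>_def
proof (rule sum.mono_neutral_left)
  show "{j. cprod j f e \<noteq> 0} \<subseteq> {..<n}" using assms by (metis (mono_tags, lifting) lessThan_iff mem_Collect_eq not_le subsetI)
qed (auto simp: distr.scale_zero_right)

lemma \<phi>_add: "\<phi> (f + g) = \<phi> f + \<phi> g"
proof -
  obtain m n where "\<And>j. m \<le> j \<Longrightarrow> cprod j f e = 0" "\<And>j. n \<le> j \<Longrightarrow> cprod j g e = 0"
    using locality by meson
  then show ?thesis
    by (subst (1 2 3) \<phi>_eq[of "max m n"])
      (simp_all add: cprod_add_left \<Psi>_add cprod_e_B distr_scale_add_right sum.distrib)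
qed

lemma \<phi>_const: "\<phi> (c \<cdot> f) = distr_scale [:c:] (\<phi> f)"
proof -
  obtain n where "\<And>j. n \<le> j \<Longrightarrow> cprod j f e = 0" using locality by blast
  then show ?thesis
    by (subst (1 2) \<phi>_eq[of n])
      (simp_all add: cprod_scale_left \<Psi>_scale cprod_e_B distr.scale_sum_right distr.scale_left_commute)
qed

text \<open>Differentiation shifts the expansion coefficients by one index, with the factor -(j+1)
  that turns \<open>coef (Suc j)\<close> into \<partial> times \<open>coef j\<close>.\<close>

lemma \<phi>_der: "\<phi> (der f) = distr_der (\<phi> f)"
proof -
  obtain n where n: "\<And>j. n \<le> j \<Longrightarrow> cprod j f e = 0" using locality by blast
  have coef: "coef (Suc j) * [:- of_nat (Suc j):] = [:0, 1:] * coef j" for j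
  proof -
    have "(- 1) ^ Suc j / fact (Suc j) * - of_nat (Suc j) = ((- 1) ^ j / fact j :: complex)"
      by (simp add: field_simps del: of_nat_Suc)
    then show ?thesis by (simp add: coef_def smult_monom monom_Suc mult.commute del: power_Suc fact_Suc of_nat_Suc)
  qed
  have trm: "distr_scale (coef (Suc j)) (\<Psi> (cprod (Suc j) (der f) e)) =
      distr_scale [:0, 1:] (distr_scale (coef j) (\<Psi> (cprod j f e)))" for j
  proof -
    have "cprod (Suc j) (der f) e = (- of_nat (Suc j)) \<cdot> cprod j f e"
      unfolding cprod_der cs.scale_minus_left by simp
    then have "\<Psi> (cprod (Suc j) (der f) e) = distr_scale [:- of_nat (Suc j):] (\<Psi> (cprod j f e))"
      by (simp only: \<Psi>_scale[OF cprod_e_B])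
    then show ?thesis by (simp only: distr.scale_scale coef)
  qed
  have "\<phi> (der f) = (\<Sum>j<Suc n. distr_scale (coef j) (\<Psi> (cprod j (der f) e)))"
    using n by (intro \<phi>_eq) (simp add: cprod_der)
  also have "\<dots> = (\<Sum>j<n. distr_scale (coef (Suc j)) (\<Psi> (cprod (Suc j) (der f) e)))"
    by (subst sum.lessThan_Suc_shift) (simp add: cprod_der[of 0] distr.scale_zero_right)
  also have "\<dots> = distr_der (\<phi> f)"
  proof -
    have "\<phi> f = (\<Sum>j<n. distr_scale (coef j) (\<Psi> (cprod j f e)))" by (rule \<phi>_eq) (rule n)
    then show ?thesis by (simp only: trm distr_der_eq_scale distr.scale_sum_right)
  qed
  finally show ?thesis .
qed

lemma \<phi>_scale: "\<phi> (scale p f) = distr_scale p (\<phi> f)"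
proof (induction p)
  case 0
  then show ?case by (simp add: \<phi>_def distr_scale_zero_left)
next
  case (pCons c p)
  show ?case
    by (simp only: pCons_scale[of c p f] \<phi>_add \<phi>_const \<phi>_der pCons.IH distr_scale_pCons[of c p] distr_scale_const)
qed

lemma \<phi>_B: "b \<in> B \<Longrightarrow> \<phi> b = \<Psi> b"
proof -
  assume b: "b \<in> B"
  then have "cprod j b e = 0" if "1 \<le> j" for j using that by (simp add: cprod_unit_B)
  then have "\<phi> b = (\<Sum>j<1. distr_scale (coef j) (\<Psi> (cprod j b e)))" by (rule \<phi>_eq)
  moreover have "coef 0 = 1" by (simp add: coef_def)
  ultimately show ?thesis using b by (simp add: unit_right distr.scale_one)
qed

lemma \<Phi>_D_pow: "b \<in> B \<Longrightarrow> rep.\<Phi> ((D ^^ n) b) i j = (pderiv ^^ n) (rep.\<Phi> b i j)"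
  by (induction n) (simp_all add: rep.\<Phi>_D alg.D_pow_B)

lemma \<phi>_cprod_B:
  assumes "a \<in> B" "b \<in> B"
  shows "\<phi> (cprod n a b) = distr_prod N n (\<phi> a) (\<phi> b)"
proof -
  have "rep.\<Phi> (cprod n a b) = (\<lambda>i j. \<Sum>l<N. smult ((- 1) ^ n) (rep.\<Phi> a i l * (pderiv ^^ n) (rep.\<Phi> b l j)))"
  proof (intro ext)
    fix i j
    have Db: "(D ^^ n) b \<in> B" using assms by (simp add: alg.D_pow_B)
    have "rep.\<Phi> (cprod n a b) i j = smult ((- 1) ^ n) (\<Sum>l<N. rep.\<Phi> a i l * (pderiv ^^ n) (rep.\<Phi> b l j))"
      unfolding cprod_D[OF assms(1), of n b] using assms Db
      by (simp add: rep.\<Phi>_scale alg.mul_B rep.\<Phi>_mul \<Phi>_D_pow)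
    also have "\<dots> = [:(- 1) ^ n:] * (\<Sum>l<N. rep.\<Phi> a i l * (pderiv ^^ n) (rep.\<Phi> b l j))" by simp
    also have "\<dots> = (\<Sum>l<N. smult ((- 1) ^ n) (rep.\<Phi> a i l * (pderiv ^^ n) (rep.\<Phi> b l j)))"
      unfolding sum_distrib_left by simp
    finally show "rep.\<Phi> (cprod n a b) i j = \<dots>" .
  qed
  then show ?thesis
    using assms cprod_B by (simp add: \<phi>_B \<Psi>_def distr_prod_field)
qed

text \<open>Both sides obey the same rules for \<partial> in each argument, so the case of
  \<open>B\<close> extends first in \<open>a\<close>, then in \<open>b\<close>. All orders are
  carried together because \<partial> lowers them.\<close>

lemma \<phi>_cprod: "\<phi> (cprod n a b) = distr_prod N n (\<phi> a) (\<phi> b)"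
proof -
  have neg: "\<phi> (- (c \<cdot> x)) = (\<lambda>k i j. weyl_const (- c) * \<phi> x k i j)" for c x
    by (simp only: cs.scale_minus_left[symmetric] \<phi>_const distr_scale_const)
  have \<phi>0: "\<phi> 0 = 0" by (simp add: \<phi>_def)
  define P where "P = (\<lambda>a b. \<forall>n. \<phi> (cprod n a b) = distr_prod N n (\<phi> a) (\<phi> b))"
  have left: "P a b" if b: "b \<in> B" for a b
  proof -
    have "subspace {a. P a b}"
    proof (rule subspaceI_der)
      fix c x assume "x \<in> {a. P a b}"
      then show "c \<cdot> x \<in> {a. P a b}"
        by (simp add: P_def cprod_scale_left \<phi>_const distr_scale_const distr_prod_const_left)
    next
      fix x assume "x \<in> {a. P a b}"
      then show "der x \<in> {a. P a b}"
        by (simp add: P_def cprod_der neg \<phi>_der distr_prod_der_left)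
    qed (simp_all add: P_def \<phi>0 cprod_add_left \<phi>_add distr_prod_add_left distr_prod_zero_left)
    then have "span B \<subseteq> {a. P a b}"
      using \<phi>_cprod_B b by (intro span_minimal) (auto simp: P_def)
    then show ?thesis unfolding span_B by blast
  qed
  have "subspace {b. P a b}"
  proof (rule subspaceI_der)
    fix c x assume "x \<in> {b. P a b}"
    then show "c \<cdot> x \<in> {b. P a b}"
      by (simp add: P_def cprod_scale_right \<phi>_const distr_scale_const distr_prod_const_right)
  next
    fix x assume "x \<in> {b. P a b}"
    then show "der x \<in> {b. P a b}"
      by (simp add: P_def cprod_der_right \<phi>_add \<phi>_const distr_scale_const \<phi>_der distr_prod_der_right)
  qed (simp_all add: P_def \<phi>0 cprod_add_right \<phi>_add distr_prod_add_right distr_prod_zero_right)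
  then have "span B \<subseteq> {b. P a b}"
    using left by (intro span_minimal) blast
  then have "P a b" unfolding span_B by blast
  then show ?thesis by (simp add: P_def)
qed

text \<open>The kernel is closed under right products with \<open>e\<close>, which land in
  \<open>B\<close>, where \<open>rep.\<Phi>\<close> is injective. With all its coefficients zero,
  \<open>f\<close> is an empty sum by \<open>expansion\<close>.\<close>

lemma \<phi>_eq_0:
  assumes "\<phi> f = 0"
  shows "f = 0"
proof -
  have "cprod m f e = 0" for m
  proof (rule rep.\<Phi>_eq_0[OF cprod_e_B])
    fix i j
    have "weyl_field (rep.\<Phi> (cprod m f e)) = \<phi> (cprod m f e)" by (simp add: \<phi>_B cprod_e_B \<Psi>_def)
    also have "\<dots> = 0" by (simp add: \<phi>_cprod assms distr_prod_zero_left)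
    finally show "rep.\<Phi> (cprod m f e) i j = 0" by (rule weyl_field_eq_0)
  qed
  then show ?thesis using expansion[of 0 f] by simp
qed

lemma \<phi>_range: "range \<phi> = CEnd N"
proof
  have \<Psi>: "\<Psi> b \<in> CEnd N" if "b \<in> B" for b
    unfolding CEnd_def \<Psi>_def using bij that by (intro distr.span_base imageI) (auto simp: bij_betw_def)
  show "range \<phi> \<subseteq> CEnd N"
  proof
    fix u assume "u \<in> range \<phi>"
    then obtain f where "u = \<phi> f" by blast
    then show "u \<in> CEnd N"
      using \<Psi>[OF cprod_e_B] unfolding \<phi>_def CEnd_def by (auto intro: distr.span_sum distr.span_scale)
  qed
  have "distr.subspace (range \<phi>)"
  proof (rule distr.subspaceI)
    have "\<phi> 0 = 0" by (simp add: \<phi>_def)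
    then show "0 \<in> range \<phi>" by (metis rangeI)
    show "u + v \<in> range \<phi>" if "u \<in> range \<phi>" "v \<in> range \<phi>" for u v
      using that by (auto simp flip: \<phi>_add)
    show "distr_scale p u \<in> range \<phi>" if "u \<in> range \<phi>" for p u
      using that by (auto simp flip: \<phi>_scale)
  qed
  moreover have "weyl_field ` poly_matrices N \<subseteq> range \<phi>"
  proof
    fix u assume "u \<in> weyl_field ` poly_matrices N"
    then obtain a where a: "a \<in> poly_matrices N" "u = weyl_field a" by blast
    then have "a \<in> rep.\<Phi> ` B" using bij by (simp add: bij_betw_def)
    then obtain b where "b \<in> B" "u = weyl_field (rep.\<Phi> b)" using a(2) by blast
    then have "u = \<phi> b" by (simp add: \<phi>_B \<Psi>_def)
    then show "u \<in> range \<phi>" by blast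
  qed
  ultimately show "CEnd N \<subseteq> range \<phi>" unfolding CEnd_def by (intro distr.span_minimal)
qed

theorem \<phi>_isomorphism: "conformal_isomorphism scale cprod distr_scale (distr_prod N) (CEnd N) \<phi>"
proof -
  have "module_hom scale distr_scale \<phi>"
    by (intro module_hom.intro module_hom_axioms.intro module_axioms distr.module_axioms \<phi>_add \<phi>_scale)
  moreover have "inj \<phi>"
  proof (rule injI)
    fix f g assume "\<phi> f = \<phi> g"
    have "\<phi> (f + (- 1) \<cdot> g) = \<phi> f + distr_scale [:- 1:] (\<phi> g)" by (simp only: \<phi>_add \<phi>_const)
    also have "\<dots> = 0" using \<open>\<phi> f = \<phi> g\<close> by (simp add: distr_scale_const weyl_const_uminus weyl_const_1 fun_eq_iff)
    finally have "f + (- 1) \<cdot> g = 0" by (rule \<phi>_eq_0)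
    then show "f = g" by simp
  qed
  then have "bij_betw \<phi> UNIV (CEnd N)" using \<phi>_range by (simp add: bij_betw_def)
  ultimately show ?thesis unfolding conformal_isomorphism_def using \<phi>_cprod by blast
qed

end

theorem mainTheorem1:
  fixes scale :: "complex poly \<Rightarrow> 'a::ab_group_add \<Rightarrow> 'a"
    and cprod :: "nat \<Rightarrow> 'a \<Rightarrow> 'a \<Rightarrow> 'a"
    and F :: "'a set"
  assumes "conformal_algebra scale cprod"
    and "conformal_algebra.associative scale cprod"
    and "conformal_algebra.simple scale cprod"
    and "conformal_algebra.unital cprod"
    and "finite F" and "conformal_algebra.generates scale cprod F"
    and "conformal_algebra.GKdim_wrt scale cprod F = 1"
  shows "\<exists>N\<ge>1. \<exists>\<phi>. conformal_isomorphism scale cprod distr_scale (distr_prod N) (CEnd N) \<phi>"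
proof -
  interpret C: conformal_algebra scale cprod by fact
  obtain e where "C.conformal_identity e" using assms(4) unfolding C.unital_def by blast
  then interpret C: linear_growth_conformal scale cprod e F
    using assms by unfold_locales auto
  obtain N \<rho> where N: "1 \<le> N" "C.alg.matrix_rep N \<rho>" "\<forall>A. \<exists>b\<in>C.B. \<forall>i<N. \<forall>j<N. \<rho> b i j = A i j"
    using C.matrix_rep_of_B by blast
  interpret R: diff_algebra_rep C.cscale "cprod 0" e C.B C.D N \<rho>
    by unfold_locales (use N in auto)
  \<comment> \<open>One more element than the N^2 matrix entries, to force a relation in
    \<open>R.rel_exists\<close>.\<close>
  obtain x where "\<And>j. x j \<in> C.B" "C.alg.indep_mod {0} x {..<Suc (N * N)}"
    using C.infinite_dimensional by blast
  then have "bij_betw R.\<Phi> C.B (poly_matrices N)" by (rule R.\<Phi>_bij)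
  then interpret represented_conformal scale cprod e N \<rho>
    by (intro represented_conformal.intro represented_conformal_axioms.intro
        C.unital_simple_conformal_axioms R.diff_algebra_rep_axioms)
  show ?thesis using \<phi>_isomorphism N(1) by blast
qed

end
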